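(* Let $\gamma=(\gamma_1,\dots,\gamma_N)$ be a self-similar map on a compact metric space $K$ satisfying Assumption A. For each $b\in B_\gamma$ and $r=0,1,2,\dots$, there exists a unique finite trace $\tau^{(b,r)}$ on $\mathcal{F}^{(\infty)}$ such that $\tau^{(b,r)}|_A=\mu_0^{(b,r)}$, the restriction of $\tau^{(b,r)}$ to $\mathcal{K}(X^{\otimes i})$ is $\pi_i(\mu_i^{(b,r)})$ for $0\le i\le r$, and the restriction of $\tau^{(b,r)}$ to $\mathcal{K}(X^{\otimes i})$ is zero for $i>r$; that is, $$\tau^{(b,r)}(f)=\Big(\tfrac{1}{N^r}F^r(\delta_b)\Big)(f)=\frac1{N^r}\sum_{x\in h^{-r}(b)}f(x)\qquad (f\in A),$$ $$\tau^{(b,r)}(\theta_{x,y})=\frac{1}{N^i}\mu_i^{(b,r)}((y|x)_A)\qquad (x,y\in X^{\otimes i},\ i\le r),$$ and $\tau^{(b,r)}$ vanishes on $\mathcal{K}(X^{\otimes i})$ for $i>r$.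
   Context: Self-similar maps. $(K,d)$ is a compact metric space, $N\ge 2$, and $\gamma=(\gamma_1,\dots,\gamma_N)$ is a self-similar map on $K$: each $\gamma_j:K\to K$ is a proper contraction (there are constants $0<c'\le c<1$ with $c'd(x,y)\le d(\gamma_j(x),\gamma_j(y))\le c\,d(x,y)$ for all $x,y\in K$) and $K=\bigcup_{j=1}^N\gamma_j(K)$. Put $\Sigma=\{1,\dots,N\}$, $B_\gamma=\{b\in K: b=\gamma_i(a)=\gamma_j(a)\text{ for some }a\in K,\ i\ne j\}$ (branch set), $P_\gamma=\{a\in K:\gamma_{j_1}\circ\cdots\circ\gamma_{j_k}(a)\in B_\gamma\text{ for some }k\ge1,\ (j_1,\dots,j_k)\in\Sigma^k\}$, and $O_{b,k}=\{\gamma_{j_1}\circ\cdots\circ\gamma_{j_k}(b):(j_1,\dots,j_k)\in\Sigma^k\}$ for $k\ge 1$, $O_{b,0}=\{b\}$. Assumption A: (1) there is a continuous map $h:K\to K$ with $h(\gamma_j(y))=y$ for all $y\in K$, $j=1,\dots,N$, and $h^{-1}(y)=\{\gamma_1(y),\dots,\gamma_N(y)\}$; (2) $B_\gamma$ and $P_\gamma$ are finite; (3) $B_\gamma\cap\bigcup_{b\in B_\gamma}\bigcup_{k\ge1}O_{b,k}=\emptyset$. Thus $O_{b,k}=h^{-k}(b)$. The correspondence and the core. $A=C(K)$, $\mathcal{C}=\bigcup_{j=1}^N\{(\gamma_j(y),y):y\in K\}$, $X=C(\mathcal{C})$, with $(a\cdot f\cdot b)(\gamma_j(y),y)=a(\gamma_j(y))f(\gamma_j(y),y)b(y)$,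 $(f|g)_A(y)=\sum_{j=1}^N\overline{f(\gamma_j(y),y)}g(\gamma_j(y),y)$, and left action $\phi(a)f=a\cdot f$; this is a $C^*$-correspondence over $A$. For a Hilbert module $Y$, $\mathcal{L}(Y)$ is the algebra of adjointable operators, $\theta_{x,y}(z)=x(y|z)_A$, and $\mathcal{K}(Y)$ is the $C^*$-algebra generated by the $\theta_{x,y}$. $X^{\otimes n}$ is the $n$-fold inner tensor product, $X^{\otimes 0}=A$, $\mathcal{K}(X^{\otimes 0})=A$. Put $\mathcal{F}^{(n)}=A\otimes I+\mathcal{K}(X)\otimes I+\cdots+\mathcal{K}(X^{\otimes n})\subset\mathcal{L}(X^{\otimes n})$, embedded in $\mathcal{F}^{(n+1)}$ by $T\mapsto T\otimes I$, and $\mathcal{F}^{(\infty)}=\overline{\bigcup_n\mathcal{F}^{(n)}}$ (the core); each $\mathcal{K}(X^{\otimes i})$ is thereby viewed inside $\mathcal{F}^{(\infty)}$. Traces and measures. A finite trace is a bounded positive linear functional with $\tau(xy)=\tau(yx)$. A finite Borel measure $\mu$ on $K$ is identified with the functional $a\mapsto\int a\,d\mu$ on $C(K)$. For a Borel function $a$ put $\tilde a(y)=\sum_{x\in h^{-1}(y)}a(x)$ (no multiplicity), and let $F(\mu)$ be the finite Borel measure $F(\mu)(a)=\mu(\tilde a)$. For a finite Borel measure $\mu$, $\pi_i(\mu)$ is the unique finite trace on $\mathcal{K}(X^{\otimes i})$ with $\pi_i(\mu)(\theta_{\xi,\eta})=N^{-i}\mu((\eta|\xi)_A)$ for $\xi,\eta\in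 X^{\otimes i}$. For $b\in B_\gamma$ and $r\ge0$, $\mu_i^{(b,r)}=N^{-(r-i)}F^{r-i}(\delta_b)$ for $0\le i\le r$, where $\delta_b$ is the Dirac measure at $b$. *)

theory Defs
  imports "HOL-Probability.Probability"
begin

section \<open>Self-similar maps\<close>

text \<open>
  The compact metric space \<open>K\<close> is the whole of a type \<open>'k::metric_space\<close> (compactness of
  \<open>UNIV\<close> is a hypothesis of the theorem). A system of maps is \<open>\<gamma> :: nat \<Rightarrow> 'k \<Rightarrow> 'k\<close>, of which
  only the indices \<open>1, \<dots>, N\<close> matter. For a word \<open>w = [j\<^sub>1, \<dots>, j\<^sub>k]\<close>,
  \<open>foldr \<gamma> w\<close> is the composition \<open>\<gamma> j\<^sub>1 \<circ> \<cdots> \<circ> \<gamma> j\<^sub>k\<close>.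
\<close>

definition proper_contraction :: "('k::metric_space \<Rightarrow> 'k) \<Rightarrow> bool" where
  "proper_contraction g \<longleftrightarrow>
     (\<exists>c' c. 0 < c' \<and> c' \<le> c \<and> c < 1 \<and>
       (\<forall>x y. c' * dist x y \<le> dist (g x) (g y) \<and> dist (g x) (g y) \<le> c * dist x y))"

definition self_similar :: "nat \<Rightarrow> (nat \<Rightarrow> 'k::metric_space \<Rightarrow> 'k) \<Rightarrow> bool" where
  "self_similar N \<gamma> \<longleftrightarrow>
     (\<forall>j\<in>{1..N}. proper_contraction (\<gamma> j)) \<and> (\<Union>j\<in>{1..N}. range (\<gamma> j)) = UNIV"

definition words :: "nat \<Rightarrow> nat \<Rightarrow> nat list set" where
  "words N k = {w. length w = k \<and> set w \<subseteq> {1..N}}"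

definition branch_set :: "nat \<Rightarrow> (nat \<Rightarrow> 'k \<Rightarrow> 'k) \<Rightarrow> 'k set" where
  "branch_set N \<gamma> =
     {b. \<exists>a. \<exists>i\<in>{1..N}. \<exists>j\<in>{1..N}. i \<noteq> j \<and> b = \<gamma> i a \<and> b = \<gamma> j a}"

definition postcritical_set :: "nat \<Rightarrow> (nat \<Rightarrow> 'k \<Rightarrow> 'k) \<Rightarrow> 'k set" where
  "postcritical_set N \<gamma> =
     {a. \<exists>k\<ge>1. \<exists>w\<in>words N k. foldr \<gamma> w a \<in> branch_set N \<gamma>}"

definition orbit :: "nat \<Rightarrow> (nat \<Rightarrow> 'k \<Rightarrow> 'k) \<Rightarrow> 'k \<Rightarrow> nat \<Rightarrow> 'k set" where
  "orbit N \<gamma> b k = {foldr \<gamma> w b | w. w \<in> words N k}"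

definition assumption_A ::
  "nat \<Rightarrow> (nat \<Rightarrow> 'k::metric_space \<Rightarrow> 'k) \<Rightarrow> ('k \<Rightarrow> 'k) \<Rightarrow> bool" where
  "assumption_A N \<gamma> h \<longleftrightarrow>
     continuous_on UNIV h \<and>
     (\<forall>y. \<forall>j\<in>{1..N}. h (\<gamma> j y) = y) \<and>
     (\<forall>y. h -` {y} = (\<lambda>j. \<gamma> j y) ` {1..N}) \<and>
     finite (branch_set N \<gamma>) \<and>
     finite (postcritical_set N \<gamma>) \<and>
     branch_set N \<gamma> \<inter> (\<Union>b\<in>branch_set N \<gamma>. \<Union>k\<in>{1..}. orbit N \<gamma> b k) = {}"


section \<open>Measures\<close>

definition tilde :: "('k \<Rightarrow> 'k) \<Rightarrow> ('k \<Rightarrow> complex) \<Rightarrow> 'k \<Rightarrow> complex" where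
  "tilde h a y = (\<Sum>x\<in>h -` {y}. a x)"

definition transfer_measure ::
  "('k::metric_space \<Rightarrow> 'k) \<Rightarrow> 'k measure \<Rightarrow> 'k measure" where
  "transfer_measure h \<mu> = (THE \<nu>.
     sets \<nu> = sets borel \<and> finite_measure \<nu> \<and>
     (\<forall>a\<in>borel_measurable borel. bounded (range a) \<longrightarrow>
        (\<integral>x. a x \<partial>\<nu>) = (\<integral>y. tilde h a y \<partial>\<mu>)))"

definition dirac :: "'k::metric_space \<Rightarrow> 'k measure" where
  "dirac b = return borel b"

definition mu_br ::
  "nat \<Rightarrow> ('k::metric_space \<Rightarrow> 'k) \<Rightarrow> 'k \<Rightarrow> nat \<Rightarrow> nat \<Rightarrow> 'k measure" where
  "mu_br N h b r i =
     scale_measure (ennreal (1 / real N ^ (r - i))) ((transfer_measure h ^^ (r - i)) (dirac b))"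


section \<open>Separated completion of a pseudometric space\<close>

text \<open>
  A set \<open>V\<close> with a pseudometric \<open>d\<close> is completed to the set of Cauchy sequences in \<open>V\<close> modulo
  sequences at distance tending to \<open>0\<close>. Operations on the completion are computed on
  representatives.
\<close>

definition cauchy_seqs :: "'v set \<Rightarrow> ('v \<Rightarrow> 'v \<Rightarrow> real) \<Rightarrow> (nat \<Rightarrow> 'v) set" where
  "cauchy_seqs V d =
     {s. (\<forall>n. s n \<in> V) \<and> (\<forall>e>0. \<exists>M. \<forall>m\<ge>M. \<forall>n\<ge>M. d (s m) (s n) < e)}"

definition null_rel :: "'v set \<Rightarrow> ('v \<Rightarrow> 'v \<Rightarrow> real) \<Rightarrow> (nat \<Rightarrow> 'v) rel" where
  "null_rel V d =
     {(s, t). s \<in> cauchy_seqs V d \<and> t \<in> cauchy_seqs V d \<and> (\<lambda>n. d (s n) (t n)) \<longlonglongrightarrow> 0}"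

definition completion :: "'v set \<Rightarrow> ('v \<Rightarrow> 'v \<Rightarrow> real) \<Rightarrow> (nat \<Rightarrow> 'v) set set" where
  "completion V d = cauchy_seqs V d // null_rel V d"

definition cls :: "'v set \<Rightarrow> ('v \<Rightarrow> 'v \<Rightarrow> real) \<Rightarrow> (nat \<Rightarrow> 'v) \<Rightarrow> (nat \<Rightarrow> 'v) set" where
  "cls V d s = null_rel V d `` {s}"

definition rep :: "(nat \<Rightarrow> 'v) set \<Rightarrow> nat \<Rightarrow> 'v" where
  "rep C = (SOME s. s \<in> C)"


section \<open>Normed star-algebras and traces\<close>

text \<open>
  Algebras with explicit carriers. No axioms are imposed by the record; all instances below are
  built from adjointable operators.
\<close>

record 't star_alg =
  acarrier :: "'t set"
  aplus :: "'t \<Rightarrow> 't \<Rightarrow> 't"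
  atimes :: "'t \<Rightarrow> 't \<Rightarrow> 't"
  ascale :: "complex \<Rightarrow> 't \<Rightarrow> 't"
  astar :: "'t \<Rightarrow> 't"
  anorm :: "'t \<Rightarrow> real"

definition adist :: "('t, 'z) star_alg_scheme \<Rightarrow> 't \<Rightarrow> 't \<Rightarrow> real" where
  "adist A x y = anorm A (aplus A x (ascale A (-1) y))"

definition closed_star_subalg :: "('t, 'z) star_alg_scheme \<Rightarrow> 't set \<Rightarrow> bool" where
  "closed_star_subalg A B \<longleftrightarrow>
     B \<subseteq> acarrier A \<and>
     (\<forall>x\<in>B. \<forall>y\<in>B. aplus A x y \<in> B \<and> atimes A x y \<in> B) \<and>
     (\<forall>c. \<forall>x\<in>B. ascale A c x \<in> B) \<and>
     (\<forall>x\<in>B. astar A x \<in> B) \<and>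
     (\<forall>s. \<forall>x\<in>acarrier A. (\<forall>n. s n \<in> B) \<and> (\<lambda>n. adist A (s n) x) \<longlonglongrightarrow> 0 \<longrightarrow> x \<in> B)"

definition generated_subalg :: "'t star_alg \<Rightarrow> 't set \<Rightarrow> 't star_alg" where
  "generated_subalg A S = A\<lparr>acarrier := \<Inter>{B. closed_star_subalg A B \<and> S \<subseteq> B}\<rparr>"

definition complete_alg :: "'t star_alg \<Rightarrow> (nat \<Rightarrow> 't) set star_alg" where
  "complete_alg A = (let V = acarrier A; d = adist A in
     \<lparr>acarrier = completion V d,
      aplus = (\<lambda>C D. cls V d (\<lambda>k. aplus A (rep C k) (rep D k))),
      atimes = (\<lambda>C D. cls V d (\<lambda>k. atimes A (rep C k) (rep D k))),
      ascale = (\<lambda>c C. cls V d (\<lambda>k. ascale A c (rep C k))),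
      astar = (\<lambda>C. cls V d (\<lambda>k. astar A (rep C k))),
      anorm = (\<lambda>C. lim (\<lambda>k. anorm A (rep C k)))\<rparr>)"

text \<open>
  Functionals are \<open>extensional\<close> (\<open>undefined\<close> off the carrier), so that HOL equality is equality
  of functionals on the algebra.
\<close>

definition finite_trace :: "'t star_alg \<Rightarrow> ('t \<Rightarrow> complex) \<Rightarrow> bool" where
  "finite_trace A \<tau> \<longleftrightarrow>
     \<tau> \<in> extensional (acarrier A) \<and>
     (\<forall>x\<in>acarrier A. \<forall>y\<in>acarrier A. \<tau> (aplus A x y) = \<tau> x + \<tau> y) \<and>
     (\<forall>c. \<forall>x\<in>acarrier A. \<tau> (ascale A c x) = c * \<tau> x) \<and>
     (\<exists>M. \<forall>x\<in>acarrier A. cmod (\<tau> x) \<le> M * anorm A x) \<and>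
     (\<forall>x\<in>acarrier A. \<tau> (atimes A (astar A x) x) \<in> \<real>\<^sub>\<ge>\<^sub>0) \<and>
     (\<forall>x\<in>acarrier A. \<forall>y\<in>acarrier A. \<tau> (atimes A x y) = \<tau> (atimes A y x))"


section \<open>Hilbert modules over \<open>C(K)\<close>\<close>

definition CK :: "('k::metric_space \<Rightarrow> complex) set" where
  "CK = {a. continuous_on UNIV a}"

definition sup_norm :: "('k \<Rightarrow> complex) \<Rightarrow> real" where
  "sup_norm a = (SUP y. cmod (a y))"

text \<open>
  Since \<open>C(K)\<close> is unital, scalars act through the constant functions.
  Inner products are conjugate-linear in the first variable.
\<close>

record ('e, 'k) hilb_mod =
  hcarrier :: "'e set"
  hplus :: "'e \<Rightarrow> 'e \<Rightarrow> 'e"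
  hact :: "'e \<Rightarrow> ('k \<Rightarrow> complex) \<Rightarrow> 'e"
  hip :: "'e \<Rightarrow> 'e \<Rightarrow> 'k \<Rightarrow> complex"

definition hnorm :: "('e, 'k) hilb_mod \<Rightarrow> 'e \<Rightarrow> real" where
  "hnorm Y x = sqrt (sup_norm (hip Y x x))"

definition hdist :: "('e, 'k) hilb_mod \<Rightarrow> 'e \<Rightarrow> 'e \<Rightarrow> real" where
  "hdist Y x y = hnorm Y (hplus Y x (hact Y y (\<lambda>_. -1)))"

definition complete_mod :: "('e, 'k) hilb_mod \<Rightarrow> ((nat \<Rightarrow> 'e) set, 'k) hilb_mod" where
  "complete_mod Y = (let V = hcarrier Y; d = hdist Y in
     \<lparr>hcarrier = completion V d,
      hplus = (\<lambda>C D. cls V d (\<lambda>k. hplus Y (rep C k) (rep D k))),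
      hact = (\<lambda>C a. cls V d (\<lambda>k. hact Y (rep C k) a)),
      hip = (\<lambda>C D y. lim (\<lambda>k. hip Y (rep C k) (rep D k) y))\<rparr>)"

definition is_adjoint :: "('e, 'k) hilb_mod \<Rightarrow> ('e \<Rightarrow> 'e) \<Rightarrow> ('e \<Rightarrow> 'e) \<Rightarrow> bool" where
  "is_adjoint Y T S \<longleftrightarrow>
     S \<in> hcarrier Y \<rightarrow>\<^sub>E hcarrier Y \<and>
     (\<forall>x\<in>hcarrier Y. \<forall>y\<in>hcarrier Y. hip Y (T x) y = hip Y x (S y))"

text \<open>The algebra \<open>\<L>(Y)\<close>; linearity and boundedness are automatic for adjointable maps.\<close>

definition adjointables :: "('e, 'k) hilb_mod \<Rightarrow> ('e \<Rightarrow> 'e) star_alg" where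
  "adjointables Y =
     \<lparr>acarrier = {T \<in> hcarrier Y \<rightarrow>\<^sub>E hcarrier Y. \<exists>S. is_adjoint Y T S},
      aplus = (\<lambda>T S. \<lambda>x\<in>hcarrier Y. hplus Y (T x) (S x)),
      atimes = (\<lambda>T S. \<lambda>x\<in>hcarrier Y. T (S x)),
      ascale = (\<lambda>c T. \<lambda>x\<in>hcarrier Y. hact Y (T x) (\<lambda>_. c)),
      astar = (\<lambda>T. THE S. is_adjoint Y T S),
      anorm = (\<lambda>T. Sup {hnorm Y (T x) | x. x \<in> hcarrier Y \<and> hnorm Y x \<le> 1})\<rparr>"

definition theta :: "('e, 'k) hilb_mod \<Rightarrow> 'e \<Rightarrow> 'e \<Rightarrow> 'e \<Rightarrow> 'e" where
  "theta Y x y = (\<lambda>z\<in>hcarrier Y. hact Y x (hip Y y z))"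

definition compacts :: "('e, 'k) hilb_mod \<Rightarrow> ('e \<Rightarrow> 'e) star_alg" where
  "compacts Y = generated_subalg (adjointables Y)
     {theta Y x y | x y. x \<in> hcarrier Y \<and> y \<in> hcarrier Y}"


section \<open>The correspondence and its tensor powers\<close>

definition cograph :: "nat \<Rightarrow> (nat \<Rightarrow> 'k \<Rightarrow> 'k) \<Rightarrow> ('k \<times> 'k) set" where
  "cograph N \<gamma> = (\<Union>j\<in>{1..N}. {(\<gamma> j y, y) | y. True})"

text \<open>Functions on the cograph are extended by \<open>0\<close> to \<open>K \<times> K\<close>.\<close>

definition X_carrier ::
  "nat \<Rightarrow> (nat \<Rightarrow> 'k::metric_space \<Rightarrow> 'k) \<Rightarrow> ('k \<times> 'k \<Rightarrow> complex) set" where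
  "X_carrier N \<gamma> =
     {f. continuous_on (cograph N \<gamma>) f \<and> (\<forall>p. p \<notin> cograph N \<gamma> \<longrightarrow> f p = 0)}"

definition X_lact :: "('k \<Rightarrow> complex) \<Rightarrow> ('k \<times> 'k \<Rightarrow> complex) \<Rightarrow> 'k \<times> 'k \<Rightarrow> complex" where
  "X_lact a f = (\<lambda>(x, y). a x * f (x, y))"

definition X_ip :: "nat \<Rightarrow> (nat \<Rightarrow> 'k \<Rightarrow> 'k) \<Rightarrow>
    ('k \<times> 'k \<Rightarrow> complex) \<Rightarrow> ('k \<times> 'k \<Rightarrow> complex) \<Rightarrow> 'k \<Rightarrow> complex" where
  "X_ip N \<gamma> f g y = (\<Sum>j\<in>{1..N}. cnj (f (\<gamma> j y, y)) * g (\<gamma> j y, y))"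

text \<open>
  The pair \<open>([x\<^sub>1, \<dots>, x\<^sub>n], a)\<close> stands for the elementary tensor \<open>x\<^sub>1 \<otimes> \<cdots> \<otimes> x\<^sub>n \<cdot> a\<close>
  with \<open>x\<^sub>i \<in> X\<close>, \<open>a \<in> A\<close> (which is just \<open>a \<in> A = X\<^sup>\<otimes>\<^sup>0\<close> for \<open>n = 0\<close>), and a list of such
  pairs for the sum of its entries. The inner product is the one of the inner tensor product,
  determined by \<open>(u \<otimes> x | v \<otimes> y) = (x | (u|v) \<cdot> y)\<close>. All relations of the algebraic balanced
  tensor product hold modulo the null vectors of this form, so the separated completion is the
  \<open>n\<close>-fold inner tensor product.
\<close>

type_synonym 'k tensor = "(('k \<times> 'k \<Rightarrow> complex) list \<times> ('k \<Rightarrow> complex)) list"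

fun elem_ip :: "nat \<Rightarrow> (nat \<Rightarrow> 'k \<Rightarrow> 'k) \<Rightarrow> ('k \<Rightarrow> complex) \<Rightarrow>
    ('k \<times> 'k \<Rightarrow> complex) list \<Rightarrow> ('k \<times> 'k \<Rightarrow> complex) list \<Rightarrow> 'k \<Rightarrow> complex" where
  "elem_ip N \<gamma> c (x # xs) (y # ys) = elem_ip N \<gamma> (X_ip N \<gamma> x (X_lact c y)) xs ys"
| "elem_ip N \<gamma> c _ _ = c"

definition tensor_ip ::
  "nat \<Rightarrow> (nat \<Rightarrow> 'k \<Rightarrow> 'k) \<Rightarrow> 'k tensor \<Rightarrow> 'k tensor \<Rightarrow> 'k \<Rightarrow> complex" where
  "tensor_ip N \<gamma> u v p =
     (\<Sum>(xs, a)\<leftarrow>u. \<Sum>(ys, b)\<leftarrow>v. cnj (a p) * elem_ip N \<gamma> (\<lambda>_. 1) xs ys p * b p)"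

definition alg_tensor ::
  "nat \<Rightarrow> (nat \<Rightarrow> 'k::metric_space \<Rightarrow> 'k) \<Rightarrow> nat \<Rightarrow> ('k tensor, 'k) hilb_mod" where
  "alg_tensor N \<gamma> n =
     \<lparr>hcarrier = {u. \<forall>(xs, a)\<in>set u. length xs = n \<and> set xs \<subseteq> X_carrier N \<gamma> \<and> a \<in> CK},
      hplus = (@),
      hact = (\<lambda>u b. map (\<lambda>(xs, a). (xs, \<lambda>y. a y * b y)) u),
      hip = tensor_ip N \<gamma>\<rparr>"

definition tensor_pow ::
  "nat \<Rightarrow> (nat \<Rightarrow> 'k::metric_space \<Rightarrow> 'k) \<Rightarrow> nat \<Rightarrow> ((nat \<Rightarrow> 'k tensor) set, 'k) hilb_mod" where
  "tensor_pow N \<gamma> n = complete_mod (alg_tensor N \<gamma> n)"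

abbreviation tcls :: "nat \<Rightarrow> (nat \<Rightarrow> 'k::metric_space \<Rightarrow> 'k) \<Rightarrow> nat \<Rightarrow>
    (nat \<Rightarrow> 'k tensor) \<Rightarrow> (nat \<Rightarrow> 'k tensor) set" where
  "tcls N \<gamma> n \<equiv> cls (hcarrier (alg_tensor N \<gamma> n)) (hdist (alg_tensor N \<gamma> n))"

text \<open>The map \<open>X\<^sup>\<otimes>\<^sup>n \<times> X \<rightarrow> X\<^sup>\<otimes>\<^sup>(\<^sup>n\<^sup>+\<^sup>1\<^sup>)\<close>, \<open>(\<xi>, x) \<mapsto> \<xi> \<otimes> x\<close>.\<close>

definition tensor_right :: "nat \<Rightarrow> (nat \<Rightarrow> 'k::metric_space \<Rightarrow> 'k) \<Rightarrow> nat \<Rightarrow>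
    (nat \<Rightarrow> 'k tensor) set \<Rightarrow> ('k \<times> 'k \<Rightarrow> complex) \<Rightarrow> (nat \<Rightarrow> 'k tensor) set" where
  "tensor_right N \<gamma> n \<xi> x =
     tcls N \<gamma> (Suc n) (\<lambda>k. map (\<lambda>(xs, a). (xs @ [X_lact a x], \<lambda>_. 1)) (rep \<xi> k))"

text \<open>The left action \<open>a \<cdot> (x\<^sub>1 \<otimes> \<cdots>) = (a \<cdot> x\<^sub>1) \<otimes> \<cdots>\<close> on \<open>X\<^sup>\<otimes>\<^sup>n\<close>.\<close>

fun elem_lact :: "('k \<Rightarrow> complex) \<Rightarrow>
    ('k \<times> 'k \<Rightarrow> complex) list \<times> ('k \<Rightarrow> complex) \<Rightarrow>
    ('k \<times> 'k \<Rightarrow> complex) list \<times> ('k \<Rightarrow> complex)" where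
  "elem_lact f ([], a) = ([], \<lambda>y. f y * a y)"
| "elem_lact f (x # xs, a) = (X_lact f x # xs, a)"

definition left_action :: "nat \<Rightarrow> (nat \<Rightarrow> 'k::metric_space \<Rightarrow> 'k) \<Rightarrow> nat \<Rightarrow>
    ('k \<Rightarrow> complex) \<Rightarrow> (nat \<Rightarrow> 'k tensor) set \<Rightarrow> (nat \<Rightarrow> 'k tensor) set" where
  "left_action N \<gamma> n f =
     (\<lambda>\<xi>\<in>hcarrier (tensor_pow N \<gamma> n). tcls N \<gamma> n (\<lambda>k. map (elem_lact f) (rep \<xi> k)))"


section \<open>The core\<close>

type_synonym 'k oper = "(nat \<Rightarrow> 'k tensor) set \<Rightarrow> (nat \<Rightarrow> 'k tensor) set"

abbreviation LX :: "nat \<Rightarrow> (nat \<Rightarrow> 'k::metric_space \<Rightarrow> 'k) \<Rightarrow> nat \<Rightarrow> 'k oper star_alg" where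
  "LX N \<gamma> n \<equiv> adjointables (tensor_pow N \<gamma> n)"

abbreviation KX :: "nat \<Rightarrow> (nat \<Rightarrow> 'k::metric_space \<Rightarrow> 'k) \<Rightarrow> nat \<Rightarrow> 'k oper star_alg" where
  "KX N \<gamma> n \<equiv> compacts (tensor_pow N \<gamma> n)"

text \<open>\<open>T \<mapsto> T \<otimes> I\<close> from \<open>\<L>(X\<^sup>\<otimes>\<^sup>n)\<close> to \<open>\<L>(X\<^sup>\<otimes>\<^sup>(\<^sup>n\<^sup>+\<^sup>1\<^sup>))\<close>, and its \<open>k\<close>-fold iterate.\<close>

definition tensor_id ::
  "nat \<Rightarrow> (nat \<Rightarrow> 'k::metric_space \<Rightarrow> 'k) \<Rightarrow> nat \<Rightarrow> 'k oper \<Rightarrow> 'k oper" where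
  "tensor_id N \<gamma> n T = (THE S. S \<in> acarrier (LX N \<gamma> (Suc n)) \<and>
     (\<forall>\<xi>\<in>hcarrier (tensor_pow N \<gamma> n). \<forall>x\<in>X_carrier N \<gamma>.
        S (tensor_right N \<gamma> n \<xi> x) = tensor_right N \<gamma> n (T \<xi>) x))"

primrec ampl ::
  "nat \<Rightarrow> (nat \<Rightarrow> 'k::metric_space \<Rightarrow> 'k) \<Rightarrow> nat \<Rightarrow> nat \<Rightarrow> 'k oper \<Rightarrow> 'k oper" where
  "ampl N \<gamma> n 0 T = T"
| "ampl N \<gamma> n (Suc k) T = tensor_id N \<gamma> (n + k) (ampl N \<gamma> n k T)"

primrec asum :: "'t star_alg \<Rightarrow> (nat \<Rightarrow> 't) \<Rightarrow> nat \<Rightarrow> 't" where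
  "asum A f 0 = f 0"
| "asum A f (Suc n) = aplus A (asum A f n) (f (Suc n))"

text \<open>\<open>\<F>\<^sup>(\<^sup>n\<^sup>) = A \<otimes> I + \<K>(X) \<otimes> I + \<cdots> + \<K>(X\<^sup>\<otimes>\<^sup>n) \<subseteq> \<L>(X\<^sup>\<otimes>\<^sup>n)\<close>, where \<open>A = \<K>(X\<^sup>\<otimes>\<^sup>0)\<close>.\<close>

definition F_level ::
  "nat \<Rightarrow> (nat \<Rightarrow> 'k::metric_space \<Rightarrow> 'k) \<Rightarrow> nat \<Rightarrow> 'k oper set" where
  "F_level N \<gamma> n = {asum (LX N \<gamma> n) (\<lambda>i. ampl N \<gamma> i (n - i) (S i)) n | S.
     \<forall>i\<le>n. S i \<in> acarrier (KX N \<gamma> i)}"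

text \<open>
  The union of the \<open>\<F>\<^sup>(\<^sup>n\<^sup>)\<close> along the embeddings \<open>T \<mapsto> T \<otimes> I\<close>: the pair \<open>(n, T)\<close> stands for
  \<open>T \<in> \<F>\<^sup>(\<^sup>n\<^sup>)\<close>, and binary operations are performed on the larger of the two levels. The
  embeddings are isometric (\<open>\<phi>\<close> is faithful), and pairs with the same image at a common level
  are at distance \<open>0\<close>; the separated completion is therefore \<open>\<F>\<^sup>(\<^sup>\<infinity>\<^sup>)\<close>.
\<close>

definition to_level ::
  "nat \<Rightarrow> (nat \<Rightarrow> 'k::metric_space \<Rightarrow> 'k) \<Rightarrow> nat \<Rightarrow> nat \<times> 'k oper \<Rightarrow> 'k oper" where
  "to_level N \<gamma> l = (\<lambda>(n, T). ampl N \<gamma> n (l - n) T)"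

definition pre_core ::
  "nat \<Rightarrow> (nat \<Rightarrow> 'k::metric_space \<Rightarrow> 'k) \<Rightarrow> (nat \<times> 'k oper) star_alg" where
  "pre_core N \<gamma> =
     \<lparr>acarrier = {(n, T). T \<in> F_level N \<gamma> n},
      aplus = (\<lambda>x y. let l = max (fst x) (fst y) in
        (l, aplus (LX N \<gamma> l) (to_level N \<gamma> l x) (to_level N \<gamma> l y))),
      atimes = (\<lambda>x y. let l = max (fst x) (fst y) in
        (l, atimes (LX N \<gamma> l) (to_level N \<gamma> l x) (to_level N \<gamma> l y))),
      ascale = (\<lambda>c (n, T). (n, ascale (LX N \<gamma> n) c T)),
      astar = (\<lambda>(n, T). (n, astar (LX N \<gamma> n) T)),
      anorm = (\<lambda>(n, T). anorm (LX N \<gamma> n) T)\<rparr>"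

definition core ::
  "nat \<Rightarrow> (nat \<Rightarrow> 'k::metric_space \<Rightarrow> 'k) \<Rightarrow> (nat \<Rightarrow> nat \<times> 'k oper) set star_alg" where
  "core N \<gamma> = complete_alg (pre_core N \<gamma>)"

definition into_core :: "nat \<Rightarrow> (nat \<Rightarrow> 'k::metric_space \<Rightarrow> 'k) \<Rightarrow> nat \<Rightarrow>
    'k oper \<Rightarrow> (nat \<Rightarrow> nat \<times> 'k oper) set" where
  "into_core N \<gamma> n T = cls (acarrier (pre_core N \<gamma>)) (adist (pre_core N \<gamma>)) (\<lambda>_. (n, T))"

definition A_into_core :: "nat \<Rightarrow> (nat \<Rightarrow> 'k::metric_space \<Rightarrow> 'k) \<Rightarrow>
    ('k \<Rightarrow> complex) \<Rightarrow> (nat \<Rightarrow> nat \<times> 'k oper) set" where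
  "A_into_core N \<gamma> f = into_core N \<gamma> 0 (left_action N \<gamma> 0 f)"


section \<open>The traces\<close>

definition pi_trace :: "nat \<Rightarrow> (nat \<Rightarrow> 'k::metric_space \<Rightarrow> 'k) \<Rightarrow> nat \<Rightarrow>
    'k measure \<Rightarrow> 'k oper \<Rightarrow> complex" where
  "pi_trace N \<gamma> i \<mu> = (THE \<tau>. finite_trace (KX N \<gamma> i) \<tau> \<and>
     (\<forall>\<xi>\<in>hcarrier (tensor_pow N \<gamma> i). \<forall>\<eta>\<in>hcarrier (tensor_pow N \<gamma> i).
        \<tau> (theta (tensor_pow N \<gamma> i) \<xi> \<eta>) =
          (1 / of_nat N ^ i) * (\<integral>y. hip (tensor_pow N \<gamma> i) \<eta> \<xi> y \<partial>\<mu>)))"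

definition restrict_to_K :: "nat \<Rightarrow> (nat \<Rightarrow> 'k::metric_space \<Rightarrow> 'k) \<Rightarrow> nat \<Rightarrow>
    ((nat \<Rightarrow> nat \<times> 'k oper) set \<Rightarrow> complex) \<Rightarrow> 'k oper \<Rightarrow> complex" where
  "restrict_to_K N \<gamma> i \<tau> = (\<lambda>T\<in>acarrier (KX N \<gamma> i). \<tau> (into_core N \<gamma> i T))"

text \<open>The two descriptions of \<open>\<tau>\<^sup>(\<^sup>b\<^sup>,\<^sup>r\<^sup>)\<close>: by its restrictions, and by explicit values.\<close>

definition has_restrictions :: "nat \<Rightarrow> (nat \<Rightarrow> 'k::metric_space \<Rightarrow> 'k) \<Rightarrow> ('k \<Rightarrow> 'k) \<Rightarrow>
    'k \<Rightarrow> nat \<Rightarrow> ((nat \<Rightarrow> nat \<times> 'k oper) set \<Rightarrow> complex) \<Rightarrow> bool" where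
  "has_restrictions N \<gamma> h b r \<tau> \<longleftrightarrow>
     (\<forall>f\<in>CK. \<tau> (A_into_core N \<gamma> f) = (\<integral>x. f x \<partial>mu_br N h b r 0)) \<and>
     (\<forall>i\<le>r. restrict_to_K N \<gamma> i \<tau> = pi_trace N \<gamma> i (mu_br N h b r i)) \<and>
     (\<forall>i>r. \<forall>T\<in>acarrier (KX N \<gamma> i). restrict_to_K N \<gamma> i \<tau> T = 0)"

definition has_values :: "nat \<Rightarrow> (nat \<Rightarrow> 'k::metric_space \<Rightarrow> 'k) \<Rightarrow> ('k \<Rightarrow> 'k) \<Rightarrow>
    'k \<Rightarrow> nat \<Rightarrow> ((nat \<Rightarrow> nat \<times> 'k oper) set \<Rightarrow> complex) \<Rightarrow> bool" where
  "has_values N \<gamma> h b r \<tau> \<longleftrightarrow>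
     (\<forall>f\<in>CK.
        \<tau> (A_into_core N \<gamma> f) =
          (\<integral>x. f x \<partial>scale_measure (ennreal (1 / real N ^ r)) ((transfer_measure h ^^ r) (dirac b))) \<and>
        \<tau> (A_into_core N \<gamma> f) = (1 / of_nat N ^ r) * (\<Sum>x\<in>(h ^^ r) -` {b}. f x)) \<and>
     (\<forall>i\<le>r. \<forall>x\<in>hcarrier (tensor_pow N \<gamma> i). \<forall>y\<in>hcarrier (tensor_pow N \<gamma> i).
        \<tau> (into_core N \<gamma> i (theta (tensor_pow N \<gamma> i) x y)) =
          (1 / of_nat N ^ i) * (\<integral>z. hip (tensor_pow N \<gamma> i) y x z \<partial>mu_br N h b r i)) \<and>
     (\<forall>i>r. \<forall>T\<in>acarrier (KX N \<gamma> i). \<tau> (into_core N \<gamma> i T) = 0)"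

end

theory Submission
  imports Defs
begin

text \<open>Why the theorem is true. The maps \<open>\<gamma>\<^sub>j\<close> are the inverse branches of \<open>h\<close>, so the cograph is the
  graph of \<open>h\<close>, and an elementary tensor \<open>x\<^sub>1 \<otimes> \<cdots> \<otimes> x\<^sub>n \<cdot> a\<close> amounts to the function
  \<open>t \<mapsto> x\<^sub>1(t, h t) \<cdots> x\<^sub>n(h\<^sup>n\<^sup>-\<^sup>1 t, h\<^sup>n t) a(h\<^sup>n t)\<close> on \<open>K\<close>. Hence \<open>X\<^sup>\<otimes>\<^sup>n\<close> is the space \<open>C(K)\<close> with the
  inner product \<open>(f|g)(z) = \<Sum>\<^sub>w cnj (f (\<gamma>\<^sub>w z)) g (\<gamma>\<^sub>w z)\<close>, where \<open>w\<close> runs over the words of length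
  \<open>n\<close> (\<open>\<Phi>_surj\<close>, \<open>\<Phi>_inj\<close>, \<open>\<Phi>_ip\<close>). In this picture \<open>T\<close> and \<open>T \<otimes> I\<close> are the same operator on
  \<open>C(K)\<close> (\<open>tensor_id_eq\<close>), with the same norm at every level (\<open>bnd_level\<close>), and the core is the
  completion of an increasing union of algebras of operators on one space.

  Uniqueness. A bounded functional on the compacts of level \<open>i\<close> is determined by the rank one
  operators (\<open>Kc_functional_zero\<close>), and sums of compacts of all levels are dense in the core
  (\<open>core_trace_unique\<close>).

  Existence. An operator of \<open>\<F>\<^sup>(\<^sup>n\<^sup>)\<close> has a continuous kernel, a matrix \<open>\<kappa> u w z\<close> indexed by words of
  length \<open>n\<close>. It is unique because the \<open>N\<^sup>n\<close> words lead to different points for a dense set of \<open>z\<close>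
  (\<open>regular_dense\<close>, \<open>kern_unique\<close>). Let \<open>b = \<gamma>\<^sub>p(h b) = \<gamma>\<^sub>q(h b)\<close> with \<open>p \<noteq> q\<close>. Take \<open>z\<close> on the
  forward orbit of \<open>b\<close>, let \<open>v\<close> be a word that leads from \<open>z\<close> back to \<open>h b\<close>, and for words \<open>w\<close> of
  length \<open>r\<close> let \<open>e\<^sub>w\<close> be the difference of the unit vectors of the words \<open>w p v\<close> and \<open>w q v\<close>.
  These two words lead from \<open>z\<close> to the same point, and the kernel of a compact operator of level
  \<open>i > r\<close> does not distinguish them, so it kills \<open>e\<^sub>w\<close> (\<open>block_high\<close>). The kernel of a compact
  operator of level \<open>i \<le> r\<close> acts on \<open>w\<close> alone, and maps \<open>e\<^sub>w\<close> to \<open>\<Sum>\<^sub>w\<^sub>' m w' w e\<^sub>w\<^sub>'\<close>, where \<open>m\<close>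
  is its kernel of level \<open>r\<close> over \<open>b\<close> (\<open>block_low\<close>). So the vectors \<open>e\<^sub>w\<close> span a reducing
  subspace, the passage to the block \<open>m\<close> is a homomorphism to matrices of size \<open>N\<^sup>r\<close>, and its
  normalized trace is the trace that is asked for: on rank one operators of level \<open>i \<le> r\<close> it is a
  sum of inner products over the points \<open>\<gamma>\<^sub>v(b)\<close> with \<open>v\<close> of length \<open>r - i\<close>
  (\<open>branch_trace_rank_one\<close>). By part (3) of Assumption A these points are distinct
  (\<open>inj_pt_branch\<close>), so this sum is the integral for \<open>F\<^sup>r\<^sup>-\<^sup>i(\<delta>\<^sub>b)\<close>, although \<open>F\<close> counts preimages
  without multiplicity (\<open>integral_mu_br\<close>).\<close>

section \<open>Completion of a pseudometric space\<close>

locale pseudometric_carrier =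
  fixes V :: "'v set" and d :: "'v \<Rightarrow> 'v \<Rightarrow> real"
  assumes d_self: "x \<in> V \<Longrightarrow> d x x = 0"
    and d_sym: "x \<in> V \<Longrightarrow> y \<in> V \<Longrightarrow> d x y = d y x"
    and d_tri: "x \<in> V \<Longrightarrow> y \<in> V \<Longrightarrow> z \<in> V \<Longrightarrow> d x z \<le> d x y + d y z"
begin

lemma d_nonneg: "x \<in> V \<Longrightarrow> y \<in> V \<Longrightarrow> 0 \<le> d x y"
  using d_tri[of x y x] d_self[of x] d_sym[of x y] by simp

lemma cauchy_seqsD: "s \<in> cauchy_seqs V d \<Longrightarrow> s n \<in> V"
  by (simp add: cauchy_seqs_def)

lemma const_cauchy: "x \<in> V \<Longrightarrow> (\<lambda>_. x) \<in> cauchy_seqs V d"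
  by (simp add: cauchy_seqs_def d_self)

text \<open>The operations of an algebra are Lipschitz in each argument along Cauchy sequences, which are
  bounded. This form covers sums and products, and unary operations with \<open>B' = 0\<close>.\<close>

lemma cauchy_seqs_map:
  assumes s: "s \<in> cauchy_seqs V d" and t: "t \<in> cauchy_seqs V d" and B: "B \<ge> 0" "B' \<ge> 0"
    and u: "\<And>k. u k \<in> V" and le: "\<And>m n. d (u m) (u n) \<le> B * d (s m) (s n) + B' * d (t m) (t n)"
  shows "u \<in> cauchy_seqs V d"
  unfolding cauchy_seqs_def
proof (intro CollectI conjI allI impI u)
  fix e :: real assume e: "e > 0"
  define c where "c = e / (B + B' + 1)"
  have c: "c > 0" using e B by (simp add: c_def)
  have "(B + B' + 1) * c = e" using B by (simp add: c_def)
  then have ce: "B * c + B' * c < e" using c by (simp add: distrib_right)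
  obtain L where L: "\<forall>m\<ge>L. \<forall>n\<ge>L. d (s m) (s n) < c"
    using s c unfolding cauchy_seqs_def by blast
  obtain L' where L': "\<forall>m\<ge>L'. \<forall>n\<ge>L'. d (t m) (t n) < c"
    using t c unfolding cauchy_seqs_def by blast
  have "d (u m) (u n) < e" if "m \<ge> max L L'" "n \<ge> max L L'" for m n
  proof -
    have "d (s m) (s n) < c" "d (t m) (t n) < c" using L L' that by auto
    then have "B * d (s m) (s n) + B' * d (t m) (t n) \<le> B * c + B' * c"
      using B by (intro add_mono mult_left_mono) auto
    then show ?thesis using le[of m n] ce by linarith
  qed
  then show "\<exists>M. \<forall>m\<ge>M. \<forall>n\<ge>M. d (u m) (u n) < e" by blast
qed

lemma equiv_null_rel: "equiv (cauchy_seqs V d) (null_rel V d)"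
proof (rule equivI)
  show "null_rel V d \<subseteq> cauchy_seqs V d \<times> cauchy_seqs V d"
    by (auto simp: null_rel_def)
  show "refl_on (cauchy_seqs V d) (null_rel V d)"
    by (rule refl_onI) (auto simp: null_rel_def d_self cauchy_seqsD)
  show "sym (null_rel V d)"
  proof (rule symI)
    fix s t assume "(s, t) \<in> null_rel V d"
    then have st: "s \<in> cauchy_seqs V d" "t \<in> cauchy_seqs V d" "(\<lambda>n. d (s n) (t n)) \<longlonglongrightarrow> 0"
      by (auto simp: null_rel_def)
    have "(\<lambda>n. d (t n) (s n)) = (\<lambda>n. d (s n) (t n))"
      using st d_sym cauchy_seqsD by fastforce
    then show "(t, s) \<in> null_rel V d" using st by (simp add: null_rel_def)
  qed
  show "trans (null_rel V d)"
  proof (rule transI)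
    fix s t u assume "(s, t) \<in> null_rel V d" "(t, u) \<in> null_rel V d"
    then have c: "s \<in> cauchy_seqs V d" "t \<in> cauchy_seqs V d" "u \<in> cauchy_seqs V d"
      and l: "(\<lambda>n. d (s n) (t n)) \<longlonglongrightarrow> 0" "(\<lambda>n. d (t n) (u n)) \<longlonglongrightarrow> 0"
      by (auto simp: null_rel_def)
    have "(\<lambda>n. d (s n) (t n) + d (t n) (u n)) \<longlonglongrightarrow> 0"
      using tendsto_add[OF l] by simp
    then have "(\<lambda>n. d (s n) (u n)) \<longlonglongrightarrow> 0"
      by (rule tendsto_sandwich[OF _ _ tendsto_const, rotated 2])
         (use c d_tri d_nonneg cauchy_seqsD in \<open>auto intro!: always_eventually\<close>)
    then show "(s, u) \<in> null_rel V d" using c by (simp add: null_rel_def)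
  qed
qed

lemma cls_in: "s \<in> cauchy_seqs V d \<Longrightarrow> cls V d s \<in> completion V d"
  by (simp add: cls_def completion_def quotientI)

lemma cls_eq: "s \<in> cauchy_seqs V d \<Longrightarrow> t \<in> cauchy_seqs V d \<Longrightarrow>
   (\<lambda>n. d (s n) (t n)) \<longlonglongrightarrow> 0 \<Longrightarrow> cls V d s = cls V d t"
  unfolding cls_def
  by (rule equiv_class_eq[OF equiv_null_rel]) (simp add: null_rel_def)

lemma rep_cls:
  assumes "s \<in> cauchy_seqs V d"
  shows "rep (cls V d s) \<in> cauchy_seqs V d"
    and "(\<lambda>n. d (s n) (rep (cls V d s) n)) \<longlonglongrightarrow> 0"
proof -
  have "s \<in> cls V d s"
    unfolding cls_def using equiv_class_self[OF equiv_null_rel assms] .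
  then have "rep (cls V d s) \<in> cls V d s" unfolding rep_def by (rule someI[where P = "\<lambda>t. t \<in> cls V d s"])
  then have "(s, rep (cls V d s)) \<in> null_rel V d" by (simp add: cls_def)
  then show "rep (cls V d s) \<in> cauchy_seqs V d"
    and "(\<lambda>n. d (s n) (rep (cls V d s) n)) \<longlonglongrightarrow> 0"
    by (auto simp: null_rel_def)
qed

text \<open>The operations of a completion are computed on chosen representatives; this lemma replaces
  them by other ones.\<close>

lemma cls_rep_map:
  assumes s: "s \<in> cauchy_seqs V d" and t: "t \<in> cauchy_seqs V d"
    and u: "u \<in> cauchy_seqs V d" "u' \<in> cauchy_seqs V d"
    and le: "\<And>k. d (u k) (u' k) \<le> B * d (s k) (rep (cls V d s) k) + B' * d (t k) (rep (cls V d t) k)"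
  shows "cls V d u = cls V d u'"
proof (rule cls_eq[OF u])
  have "(\<lambda>k. B * d (s k) (rep (cls V d s) k) + B' * d (t k) (rep (cls V d t) k)) \<longlonglongrightarrow> B * 0 + B' * 0"
    by (intro tendsto_intros rep_cls s t)
  then show "(\<lambda>k. d (u k) (u' k)) \<longlonglongrightarrow> 0"
    by (intro tendsto_sandwich[OF _ _ tendsto_const, of _ "\<lambda>k. d (u k) (u' k)"])
       (use le u cauchy_seqsD d_nonneg in \<open>auto intro!: always_eventually\<close>)
qed

lemma completion_cases:
  assumes "C \<in> completion V d"
  obtains s where "s \<in> cauchy_seqs V d" "C = cls V d s"
  using assms by (auto simp: completion_def cls_def elim!: quotientE)

lemma rep_in: "C \<in> completion V d \<Longrightarrow> rep C \<in> cauchy_seqs V d"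
  by (metis completion_cases rep_cls(1))

lemma cls_rep: "C \<in> completion V d \<Longrightarrow> cls V d (rep C) = C"
  by (metis completion_cases rep_cls cls_eq)

text \<open>Equivalent sequences have the same limit under a Lipschitz map, so a limit that is defined
  with the chosen representative can be computed with any other one.\<close>

lemma lim_rep:
  fixes f :: "'v \<Rightarrow> 'c::banach"
  assumes s: "s \<in> cauchy_seqs V d" and M: "M \<ge> 0"
    and lip: "\<And>x y. x \<in> V \<Longrightarrow> y \<in> V \<Longrightarrow> dist (f x) (f y) \<le> M * d x y"
  shows "(\<lambda>k. f (s k)) \<longlonglongrightarrow> lim (\<lambda>k. f (rep (cls V d s) k))"
proof -
  let ?t = "rep (cls V d s)"
  have t: "?t \<in> cauchy_seqs V d" "(\<lambda>n. d (s n) (?t n)) \<longlonglongrightarrow> 0"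
    using rep_cls[OF s] by auto
  have "Cauchy (\<lambda>k. f (?t k))"
    unfolding Cauchy_def
  proof (intro allI impI)
    fix e :: real assume e: "e > 0"
    then have "e / (M + 1) > 0" using M by simp
    then obtain L where L: "\<forall>m\<ge>L. \<forall>n\<ge>L. d (?t m) (?t n) < e / (M + 1)"
      using t(1) unfolding cauchy_seqs_def by blast
    have "dist (f (?t m)) (f (?t n)) < e" if "m \<ge> L" "n \<ge> L" for m n
    proof -
      have "dist (f (?t m)) (f (?t n)) \<le> (M + 1) * d (?t m) (?t n)"
        using lip[of "?t m" "?t n"] d_nonneg[of "?t m" "?t n"] cauchy_seqsD[OF t(1)]
        by (simp add: distrib_right add_increasing2)
      also have "\<dots> < (M + 1) * (e / (M + 1))"
        using L that M by (intro mult_strict_left_mono) auto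
      also have "\<dots> = e" using M by simp
      finally show ?thesis .
    qed
    then show "\<exists>L. \<forall>m\<ge>L. \<forall>n\<ge>L. dist (f (?t m)) (f (?t n)) < e" by blast
  qed
  then have l: "(\<lambda>k. f (?t k)) \<longlonglongrightarrow> lim (\<lambda>k. f (?t k))"
    by (simp add: Cauchy_convergent convergent_LIMSEQ_iff[symmetric])
  have "(\<lambda>k. dist (f (?t k)) (f (s k))) \<longlonglongrightarrow> 0"
  proof (rule tendsto_sandwich[OF _ _ tendsto_const])
    show "\<forall>\<^sub>F k in sequentially. dist (f (?t k)) (f (s k)) \<le> M * d (s k) (?t k)"
      using lip cauchy_seqsD[OF s] cauchy_seqsD[OF t(1)]
      by (auto intro!: always_eventually simp: dist_commute)
    show "(\<lambda>k. M * d (s k) (?t k)) \<longlonglongrightarrow> 0"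
      using tendsto_mult[OF tendsto_const t(2), of M] by simp
  qed auto
  then have "(\<lambda>k. f (?t k) - f (s k)) \<longlonglongrightarrow> 0"
    unfolding dist_norm by (rule tendsto_norm_zero_cancel)
  with l show ?thesis by (rule Lim_transform2)
qed

end

section \<open>Completion of a pre-C*-algebra and its traces\<close>

text \<open>The estimates that let the operations pass to classes of Cauchy sequences. They are
  statements about distances, since in the union of the \<open>\<F>\<^sup>(\<^sup>n\<^sup>)\<close> one operator appears at many levels
  and zero, for example, is unique only up to distance \<open>0\<close>.\<close>

locale pre_cstar =
  fixes A :: "'t star_alg"
  assumes plus_in: "x \<in> acarrier A \<Longrightarrow> y \<in> acarrier A \<Longrightarrow> aplus A x y \<in> acarrier A"
    and times_in: "x \<in> acarrier A \<Longrightarrow> y \<in> acarrier A \<Longrightarrow> atimes A x y \<in> acarrier A"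
    and scale_in: "x \<in> acarrier A \<Longrightarrow> ascale A c x \<in> acarrier A"
    and star_in: "x \<in> acarrier A \<Longrightarrow> astar A x \<in> acarrier A"
    and norm_nonneg: "x \<in> acarrier A \<Longrightarrow> 0 \<le> anorm A x"
    and pm: "pseudometric_carrier (acarrier A) (adist A)"
    and plus_d: "x \<in> acarrier A \<Longrightarrow> x' \<in> acarrier A \<Longrightarrow> y \<in> acarrier A \<Longrightarrow> y' \<in> acarrier A \<Longrightarrow>
       adist A (aplus A x y) (aplus A x' y') \<le> adist A x x' + adist A y y'"
    and times_d: "x \<in> acarrier A \<Longrightarrow> x' \<in> acarrier A \<Longrightarrow> y \<in> acarrier A \<Longrightarrow> y' \<in> acarrier A \<Longrightarrow>
       adist A (atimes A x y) (atimes A x' y') \<le> anorm A x * adist A y y' + adist A x x' * anorm A y'"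
    and scale_d: "x \<in> acarrier A \<Longrightarrow> x' \<in> acarrier A \<Longrightarrow>
       adist A (ascale A c x) (ascale A c x') \<le> cmod c * adist A x x'"
    and star_d: "x \<in> acarrier A \<Longrightarrow> x' \<in> acarrier A \<Longrightarrow>
       adist A (astar A x) (astar A x') \<le> adist A x x'"
    and norm_d: "x \<in> acarrier A \<Longrightarrow> x' \<in> acarrier A \<Longrightarrow>
       \<bar>anorm A x - anorm A x'\<bar> \<le> adist A x x'"
begin

interpretation pseudometric_carrier "acarrier A" "adist A" by (rule pm)

abbreviation "V \<equiv> acarrier A"
abbreviation "CS \<equiv> cauchy_seqs (acarrier A) (adist A)"
abbreviation "cl \<equiv> cls (acarrier A) (adist A)"
abbreviation "Ac \<equiv> complete_alg A"

lemma carrier_complete: "acarrier Ac = completion V (adist A)"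
  by (simp add: complete_alg_def Let_def)

lemma norm_lim:
  assumes s: "s \<in> CS" shows "(\<lambda>k. anorm A (s k)) \<longlonglongrightarrow> anorm Ac (cl s)"
  using lim_rep[OF s, of 1 "anorm A"] norm_d
  by (simp add: complete_alg_def Let_def dist_real_def)

lemma cauchy_bounded:
  assumes s: "s \<in> CS" obtains B where "B > 0" "\<And>k. anorm A (s k) \<le> B"
proof -
  have "Bseq (\<lambda>k. anorm A (s k))"
    using norm_lim[OF s] by (intro convergent_imp_Bseq) (auto simp: convergent_def)
  then obtain B where "B > 0" "\<And>k. norm (anorm A (s k)) \<le> B" by (auto elim!: BseqE)
  then show ?thesis using that by (metis abs_le_D1 real_norm_def)
qed

text \<open>Cauchy sequences are bounded, which makes the product Lipschitz along them.\<close>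

lemma times_seq_le:
  assumes "s \<in> CS" "t \<in> CS" "s' \<in> CS" "t' \<in> CS"
  obtains B B' where "B \<ge> 0" "B' \<ge> 0" "\<And>m n. adist A (atimes A (s m) (t m)) (atimes A (s' n) (t' n)) \<le>
    B * adist A (s m) (s' n) + B' * adist A (t m) (t' n)"
proof -
  obtain B' where B': "B' > 0" "\<And>k. anorm A (s k) \<le> B'" using cauchy_bounded assms by blast
  obtain B where B: "B > 0" "\<And>k. anorm A (t' k) \<le> B" using cauchy_bounded assms by blast
  have "adist A (atimes A (s m) (t m)) (atimes A (s' n) (t' n)) \<le> B * adist A (s m) (s' n) + B' * adist A (t m) (t' n)" for m n
  proof -
    have V: "s m \<in> V" "s' n \<in> V" "t m \<in> V" "t' n \<in> V" using cauchy_seqsD assms by auto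
    have "anorm A (s m) * adist A (t m) (t' n) \<le> B' * adist A (t m) (t' n)"
      "adist A (s m) (s' n) * anorm A (t' n) \<le> adist A (s m) (s' n) * B"
      using B'(2)[of m] B(2)[of n] d_nonneg V by (auto intro!: mult_right_mono mult_left_mono)
    then show ?thesis using times_d[OF V] by (simp add: mult.commute)
  qed
  then show thesis using that[of B B'] B B' by simp
qed

lemma plus_cauchy: "s \<in> CS \<Longrightarrow> t \<in> CS \<Longrightarrow> (\<lambda>k. aplus A (s k) (t k)) \<in> CS"
  by (rule cauchy_seqs_map[of s t 1 1]) (auto intro: plus_in plus_d cauchy_seqsD)

lemma times_cauchy: assumes "s \<in> CS" "t \<in> CS" shows "(\<lambda>k. atimes A (s k) (t k)) \<in> CS"
proof -
  obtain B B' where B: "B \<ge> 0" "B' \<ge> 0" and le: "\<And>m n. adist A (atimes A (s m) (t m)) (atimes A (s n) (t n)) \<le>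
    B * adist A (s m) (s n) + B' * adist A (t m) (t n)" by (rule times_seq_le[OF assms assms]) blast
  show ?thesis
    by (rule cauchy_seqs_map[OF assms B _ le]) (simp add: times_in cauchy_seqsD[OF assms(1)] cauchy_seqsD[OF assms(2)])
qed

lemma scale_cauchy: "s \<in> CS \<Longrightarrow> (\<lambda>k. ascale A c (s k)) \<in> CS"
  by (rule cauchy_seqs_map[of s s "cmod c" 0]) (auto intro: scale_in scale_d cauchy_seqsD)

lemma star_cauchy: "s \<in> CS \<Longrightarrow> (\<lambda>k. astar A (s k)) \<in> CS"
  by (rule cauchy_seqs_map[of s s 1 0]) (auto intro: star_in star_d cauchy_seqsD)

lemma plus_cl:
  assumes s: "s \<in> CS" and t: "t \<in> CS"
  shows "aplus Ac (cl s) (cl t) = cl (\<lambda>k. aplus A (s k) (t k))"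
proof -
  note r = rep_cls(1)[OF s] rep_cls(1)[OF t]
  have "cl (\<lambda>k. aplus A (s k) (t k)) = cl (\<lambda>k. aplus A (rep (cl s) k) (rep (cl t) k))"
    by (rule cls_rep_map[OF s t plus_cauchy[OF s t] plus_cauchy[OF r], of 1 1])
       (simp add: plus_d cauchy_seqsD[OF s] cauchy_seqsD[OF t] cauchy_seqsD[OF r(1)] cauchy_seqsD[OF r(2)])
  then show ?thesis by (simp add: complete_alg_def Let_def)
qed

lemma times_cl:
  assumes s: "s \<in> CS" and t: "t \<in> CS"
  shows "atimes Ac (cl s) (cl t) = cl (\<lambda>k. atimes A (s k) (t k))"
proof -
  note r = rep_cls(1)[OF s] rep_cls(1)[OF t]
  obtain B B' where le: "\<And>m n. adist A (atimes A (s m) (t m)) (atimes A (rep (cl s) n) (rep (cl t) n)) \<le>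
    B * adist A (s m) (rep (cl s) n) + B' * adist A (t m) (rep (cl t) n)"
    by (rule times_seq_le[OF s t r]) (rule that)
  have "cl (\<lambda>k. atimes A (s k) (t k)) = cl (\<lambda>k. atimes A (rep (cl s) k) (rep (cl t) k))"
    by (rule cls_rep_map[OF s t times_cauchy[OF s t] times_cauchy[OF r] le])
  then show ?thesis by (simp add: complete_alg_def Let_def)
qed

lemma scale_cl:
  assumes s: "s \<in> CS" shows "ascale Ac c (cl s) = cl (\<lambda>k. ascale A c (s k))"
proof -
  have "cl (\<lambda>k. ascale A c (s k)) = cl (\<lambda>k. ascale A c (rep (cl s) k))"
    by (rule cls_rep_map[OF s s scale_cauchy[OF s, of c] scale_cauchy[OF rep_cls(1)[OF s], of c], of "cmod c" 0])
       (simp add: scale_d cauchy_seqsD[OF s] cauchy_seqsD[OF rep_cls(1)[OF s]])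
  then show ?thesis by (simp add: complete_alg_def Let_def)
qed

lemma star_cl:
  assumes s: "s \<in> CS" shows "astar Ac (cl s) = cl (\<lambda>k. astar A (s k))"
proof -
  have "cl (\<lambda>k. astar A (s k)) = cl (\<lambda>k. astar A (rep (cl s) k))"
    by (rule cls_rep_map[OF s s star_cauchy[OF s] star_cauchy[OF rep_cls(1)[OF s]], of 1 0])
       (simp add: star_d cauchy_seqsD[OF s] cauchy_seqsD[OF rep_cls(1)[OF s]])
  then show ?thesis by (simp add: complete_alg_def Let_def)
qed

abbreviation const_cl :: "'t \<Rightarrow> (nat \<Rightarrow> 't) set" where "const_cl x \<equiv> cl (\<lambda>_. x)"

lemma const_cl_in: "x \<in> V \<Longrightarrow> const_cl x \<in> acarrier Ac"
  unfolding carrier_complete by (intro cls_in const_cauchy)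

lemma norm_const_cl: "x \<in> V \<Longrightarrow> anorm Ac (const_cl x) = anorm A x"
  using norm_lim[OF const_cauchy] LIMSEQ_unique tendsto_const by metis

text \<open>Constant sequences are dense, so bounded functionals on the completion are determined there.\<close>

lemma traces_eq:
  assumes t: "finite_trace Ac \<tau>" "finite_trace Ac \<tau>'"
    and eq: "\<And>x. x \<in> V \<Longrightarrow> \<tau> (const_cl x) = \<tau>' (const_cl x)"
  shows "\<tau> = \<tau>'"
proof (rule extensionalityI[of _ "acarrier Ac"])
  show "\<tau> \<in> extensional (acarrier Ac)" "\<tau>' \<in> extensional (acarrier Ac)"
    using t by (auto simp: finite_trace_def)
  fix C assume C: "C \<in> acarrier Ac"
  then obtain s where s: "s \<in> CS" "C = cl s"
    unfolding carrier_complete by (rule completion_cases)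
  have diff_small: "(\<lambda>k. \<sigma> (const_cl (s k))) \<longlonglongrightarrow> \<sigma> C" if \<sigma>: "finite_trace Ac \<sigma>" for \<sigma>
  proof -
    have "\<exists>M. \<forall>x\<in>acarrier Ac. cmod (\<sigma> x) \<le> M * anorm Ac x"
      using \<sigma> by (simp only: finite_trace_def)
    then obtain M where M: "\<And>x. x \<in> acarrier Ac \<Longrightarrow> cmod (\<sigma> x) \<le> M * anorm Ac x"
      by meson
    show ?thesis
    proof (rule LIMSEQ_I)
      fix e :: real assume e: "e > 0"
      define B where "B = \<bar>M\<bar> + 1"
      have B: "B > 0" "M \<le> B" by (auto simp: B_def)
      then have "e / (2*B) > 0" using e by auto
      then obtain L where L: "\<forall>m\<ge>L. \<forall>n\<ge>L. adist A (s m) (s n) < e/(2*B)"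
        using s(1) unfolding cauchy_seqs_def by blast
      have "norm (\<sigma> (const_cl (s k)) - \<sigma> C) < e" if k: "k \<ge> L" for k
      proof -
        have sk: "s k \<in> V" using s cauchy_seqsD by blast
        have sc: "(\<lambda>_. ascale A (-1) (s k)) \<in> CS"
          by (rule const_cauchy) (rule scale_in[OF sk])
        have E: "aplus Ac C (ascale Ac (-1) (const_cl (s k))) = cl (\<lambda>j. aplus A (s j) (ascale A (-1) (s k)))"
          unfolding s(2) by (simp add: scale_cl const_cauchy sk plus_cl s(1) sc)
        have Ccar: "ascale Ac (-1) (const_cl (s k)) \<in> acarrier Ac" 
          by (simp add: scale_cl const_cauchy sk carrier_complete cls_in sc)
        have car: "aplus Ac C (ascale Ac (-1) (const_cl (s k))) \<in> acarrier Ac"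
          unfolding E carrier_complete by (intro cls_in plus_cauchy s sc)
        have "(\<lambda>j. adist A (s j) (s k)) \<longlonglongrightarrow> anorm Ac (aplus Ac C (ascale Ac (-1) (const_cl (s k))))"
          unfolding E using norm_lim[OF plus_cauchy[OF s(1) sc]] by (simp add: adist_def)
        moreover have "\<exists>M. \<forall>j\<ge>M. adist A (s j) (s k) \<le> e/(2*B)"
          using L k by (auto intro!: exI[of _ L] less_imp_le)
        ultimately have nle: "anorm Ac (aplus Ac C (ascale Ac (-1) (const_cl (s k)))) \<le> e/(2*B)"
          by (rule LIMSEQ_le_const2)
        have nn: "0 \<le> anorm Ac (aplus Ac C (ascale Ac (-1) (const_cl (s k))))"
          unfolding E
          by (rule LIMSEQ_le_const[OF norm_lim[OF plus_cauchy[OF s(1) sc]]])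
             (use norm_nonneg plus_in cauchy_seqsD s sc scale_in in blast)
        have "\<sigma> (aplus Ac C (ascale Ac (-1) (const_cl (s k)))) = \<sigma> C - \<sigma> (const_cl (s k))"
          using \<sigma> C Ccar const_cl_in[OF sk] by (simp add: finite_trace_def)
        then have "cmod (\<sigma> (const_cl (s k)) - \<sigma> C) \<le> M * anorm Ac (aplus Ac C (ascale Ac (-1) (const_cl (s k))))"
          using M[OF car] by (metis norm_minus_commute)
        also have "\<dots> \<le> B * (e/(2*B))" using B nn nle by (intro mult_mono) auto
        also have "\<dots> < e" using B e by simp
        finally show ?thesis .
      qed
      then show "\<exists>no. \<forall>n\<ge>no. norm (\<sigma> (const_cl (s n)) - \<sigma> C) < e" by blast
    qed
  qed
  have "(\<lambda>k. \<tau> (const_cl (s k))) = (\<lambda>k. \<tau>' (const_cl (s k)))"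
    using eq s cauchy_seqsD by auto
  then show "\<tau> C = \<tau>' C"
    using diff_small[OF t(1)] diff_small[OF t(2)] LIMSEQ_unique by metis
qed

lemma const_cl_plus: "x \<in> V \<Longrightarrow> y \<in> V \<Longrightarrow> aplus Ac (const_cl x) (const_cl y) = const_cl (aplus A x y)"
  by (simp add: plus_cl const_cauchy)
lemma const_cl_times: "x \<in> V \<Longrightarrow> y \<in> V \<Longrightarrow> atimes Ac (const_cl x) (const_cl y) = const_cl (atimes A x y)"
  by (simp add: times_cl const_cauchy)
lemma const_cl_scale: "x \<in> V \<Longrightarrow> ascale Ac c (const_cl x) = const_cl (ascale A c x)"
  by (simp add: scale_cl const_cauchy)
lemma const_cl_star: "x \<in> V \<Longrightarrow> astar Ac (const_cl x) = const_cl (astar A x)"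
  by (simp add: star_cl const_cauchy)

text \<open>A bounded functional is Lipschitz and therefore converges along Cauchy sequences. Each property
  of a trace holds term by term and passes to the limit.\<close>

lemma trace_extends:
  assumes add: "\<And>x y. x \<in> V \<Longrightarrow> y \<in> V \<Longrightarrow> t (aplus A x y) = t x + t y"
    and scale: "\<And>c x. x \<in> V \<Longrightarrow> t (ascale A c x) = c * t x"
    and bound: "\<And>x. x \<in> V \<Longrightarrow> cmod (t x) \<le> M * anorm A x" and M: "M \<ge> 0"
    and pos: "\<And>x. x \<in> V \<Longrightarrow> t (atimes A (astar A x) x) \<in> \<real>\<^sub>\<ge>\<^sub>0"
    and trace: "\<And>x y. x \<in> V \<Longrightarrow> y \<in> V \<Longrightarrow> t (atimes A x y) = t (atimes A y x)"
  obtains \<tau> where "finite_trace Ac \<tau>" "\<And>x. x \<in> V \<Longrightarrow> \<tau> (const_cl x) = t x"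
proof -
  define \<tau> where "\<tau> = (\<lambda>C\<in>acarrier Ac. lim (\<lambda>k. t (rep C k)))"
  have lip: "dist (t x) (t y) \<le> M * adist A x y" if "x \<in> V" "y \<in> V" for x y
  proof -
    have "t x - t y = t (aplus A x (ascale A (-1) y))" using that by (simp add: add scale scale_in)
    then show ?thesis using bound[of "aplus A x (ascale A (-1) y)"] that
      by (simp add: dist_norm adist_def plus_in scale_in)
  qed
  have lim: "(\<lambda>k. t (s k)) \<longlonglongrightarrow> \<tau> (cl s)" if "s \<in> CS" for s
    using lim_rep[OF that M lip] cls_in[OF that] by (simp add: \<tau>_def carrier_complete)
  have "finite_trace Ac \<tau>"
    unfolding finite_trace_def
  proof (intro conjI ballI allI)
    show "\<tau> \<in> extensional (acarrier Ac)" by (simp add: \<tau>_def)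
    show "\<exists>M. \<forall>x\<in>acarrier Ac. cmod (\<tau> x) \<le> M * anorm Ac x"
    proof (intro exI ballI)
      fix C assume "C \<in> acarrier Ac"
      then obtain s where s: "s \<in> CS" "C = cl s"
        unfolding carrier_complete by (rule completion_cases)
      show "cmod (\<tau> C) \<le> M * anorm Ac C" unfolding s(2)
        by (rule LIMSEQ_le[OF tendsto_norm[OF lim] tendsto_mult[OF tendsto_const norm_lim]])
           (use s bound cauchy_seqsD in auto)
    qed
    fix C assume "C \<in> acarrier Ac"
    then obtain s where s: "s \<in> CS" "C = cl s"
      unfolding carrier_complete by (rule completion_cases)
    note sV = cauchy_seqsD[OF s(1)]
    show "\<tau> (ascale Ac c C) = c * \<tau> C" for c
    proof -
      have "(\<lambda>k. t (ascale A c (s k))) \<longlonglongrightarrow> \<tau> (ascale Ac c C)"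
        unfolding s(2) scale_cl[OF s(1)] by (rule lim[OF scale_cauchy[OF s(1)]])
      moreover have "(\<lambda>k. t (ascale A c (s k))) = (\<lambda>k. c * t (s k))" using sV scale by auto
      ultimately show ?thesis
        using tendsto_mult[OF tendsto_const lim[OF s(1)], of c] s(2) LIMSEQ_unique by metis
    qed
    show "\<tau> (atimes Ac (astar Ac C) C) \<in> \<real>\<^sub>\<ge>\<^sub>0"
    proof -
      have "(\<lambda>k. t (atimes A (astar A (s k)) (s k))) \<longlonglongrightarrow> \<tau> (atimes Ac (astar Ac C) C)"
        unfolding s(2) star_cl[OF s(1)] times_cl[OF star_cauchy[OF s(1)] s(1)]
        by (rule lim[OF times_cauchy[OF star_cauchy[OF s(1)] s(1)]])
      then show ?thesis
        by (rule Lim_in_closed_set[OF closed_nonneg_Reals_complex, rotated 2])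
           (use sV pos in auto)
    qed
    fix D assume "D \<in> acarrier Ac"
    then obtain u where u: "u \<in> CS" "D = cl u"
      unfolding carrier_complete by (rule completion_cases)
    note uV = cauchy_seqsD[OF u(1)]
    show "\<tau> (aplus Ac C D) = \<tau> C + \<tau> D"
    proof -
      have "(\<lambda>k. t (aplus A (s k) (u k))) \<longlonglongrightarrow> \<tau> (aplus Ac C D)"
        unfolding s(2) u(2) plus_cl[OF s(1) u(1)] by (rule lim[OF plus_cauchy[OF s(1) u(1)]])
      moreover have "(\<lambda>k. t (aplus A (s k) (u k))) = (\<lambda>k. t (s k) + t (u k))" using sV uV add by auto
      ultimately show ?thesis
        using tendsto_add[OF lim[OF s(1)] lim[OF u(1)]] s(2) u(2) LIMSEQ_unique by metis
    qed
    show "\<tau> (atimes Ac C D) = \<tau> (atimes Ac D C)"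
    proof -
      have "(\<lambda>k. t (atimes A (s k) (u k))) \<longlonglongrightarrow> \<tau> (atimes Ac C D)"
        unfolding s(2) u(2) times_cl[OF s(1) u(1)] by (rule lim[OF times_cauchy[OF s(1) u(1)]])
      moreover have "(\<lambda>k. t (atimes A (u k) (s k))) \<longlonglongrightarrow> \<tau> (atimes Ac D C)"
        unfolding s(2) u(2) times_cl[OF u(1) s(1)] by (rule lim[OF times_cauchy[OF u(1) s(1)]])
      moreover have "(\<lambda>k. t (atimes A (s k) (u k))) = (\<lambda>k. t (atimes A (u k) (s k)))"
        using sV uV trace by auto
      ultimately show ?thesis using LIMSEQ_unique by metis
    qed
  qed
  moreover have "\<tau> (const_cl x) = t x" if "x \<in> V" for x
    using lim[OF const_cauchy[OF that]] LIMSEQ_unique tendsto_const by metis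
  ultimately show ?thesis using that by blast
qed

end

section \<open>Words and fibres\<close>

lemma finite_words [simp]: "finite (words N n)"
  unfolding words_def using finite_lists_length_eq[of "{1..N}" n]
  by (simp add: conj_commute)

lemma words_0 [simp]: "words N 0 = {[]}"
  by (auto simp: words_def)

lemma words_length: "w \<in> words N n \<Longrightarrow> length w = n"
  by (simp add: words_def)

lemma words_append: "u \<in> words N m \<Longrightarrow> v \<in> words N n \<Longrightarrow> u @ v \<in> words N (m + n)"
  by (auto simp: words_def)

lemma words_snoc: "u \<in> words N m \<Longrightarrow> j \<in> {1..N} \<Longrightarrow> u @ [j] \<in> words N (Suc m)"
  by (auto simp: words_def)

lemma words_Cons_iff: "j # w \<in> words N (Suc n) \<longleftrightarrow> j \<in> {1..N} \<and> w \<in> words N n"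
  by (auto simp: words_def)

lemma words_single: "j \<in> {1..N} \<Longrightarrow> [j] \<in> words N (Suc 0)"
  by (auto simp: words_def)

lemma words_splitE:
  assumes "w \<in> words N (m + n)"
  obtains u v where "u \<in> words N m" "v \<in> words N n" "w = u @ v"
proof
  show "take m w \<in> words N m" "drop m w \<in> words N n" "w = take m w @ drop m w"
    using assms set_take_subset[of m w] set_drop_subset[of m w] by (auto simp: words_def)
qed

lemma words_snocE:
  assumes "w \<in> words N (Suc n)"
  obtains u j where "u \<in> words N n" "j \<in> {1..N}" "w = u @ [j]"
proof -
  have "w \<in> words N (n + Suc 0)" using assms by simp
  then obtain u v where "u \<in> words N n" "v \<in> words N (Suc 0)" "w = u @ v" by (rule words_splitE)
  moreover from this obtain j where "v = [j]" "j \<in> {1..N}"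
    by (auto simp: words_def length_Suc_conv)
  ultimately show ?thesis using that by blast
qed

lemma sum_words_append:
  fixes F :: "nat list \<Rightarrow> 'a::comm_monoid_add"
  shows "(\<Sum>w\<in>words N (m + n). F w) = (\<Sum>v\<in>words N n. \<Sum>u\<in>words N m. F (u @ v))"
proof -
  have "(\<Sum>w\<in>words N (m + n). F w) = (\<Sum>(v, u)\<in>words N n \<times> words N m. F (u @ v))"
  proof (rule sum.reindex_bij_witness[where i = "\<lambda>(v, u). u @ v" and j = "\<lambda>w. (drop m w, take m w)"])
    fix w assume "w \<in> words N (m + n)"
    then obtain u v where "u \<in> words N m" "v \<in> words N n" "w = u @ v" by (rule words_splitE)
    then show "(drop m w, take m w) \<in> words N n \<times> words N m" by (simp add: words_def)
  qed (auto simp: words_def)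
  then show ?thesis by (simp add: sum.cartesian_product)
qed

lemma sum_words_1:
  fixes F :: "nat list \<Rightarrow> 'a::comm_monoid_add"
  shows "(\<Sum>w\<in>words N (Suc 0). F w) = (\<Sum>j\<in>{1..N}. F [j])"
  by (rule sum.reindex_bij_witness[where i = "\<lambda>j. [j]" and j = hd])
     (auto simp: words_def length_Suc_conv)

lemma sum_words_Cons:
  fixes F :: "nat list \<Rightarrow> 'a::comm_monoid_add"
  shows "(\<Sum>w\<in>words N (Suc n). F w) = (\<Sum>w\<in>words N n. \<Sum>j\<in>{1..N}. F (j # w))"
  using sum_words_append[of F N "Suc 0" n] by (simp add: sum_words_1)

lemma sum_words_snoc:
  fixes F :: "nat list \<Rightarrow> 'a::comm_monoid_add"
  shows "(\<Sum>w\<in>words N (Suc n). F w) = (\<Sum>j\<in>{1..N}. \<Sum>w\<in>words N n. F (w @ [j]))"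
  using sum_words_append[of F N n "Suc 0"] by (simp add: sum_words_1)

lemma card_words: "card (words N n) = N ^ n"
  unfolding words_def using card_lists_length_eq[of "{1..N}" n]
  by (simp add: conj_commute)

lemma CK_const [intro, simp]: "(\<lambda>_. c) \<in> CK"
  and CK_add [intro]: "f \<in> CK \<Longrightarrow> g \<in> CK \<Longrightarrow> (\<lambda>x. f x + g x) \<in> CK"
  and CK_diff [intro]: "f \<in> CK \<Longrightarrow> g \<in> CK \<Longrightarrow> (\<lambda>x. f x - g x) \<in> CK"
  and CK_mult [intro]: "f \<in> CK \<Longrightarrow> g \<in> CK \<Longrightarrow> (\<lambda>x. f x * g x) \<in> CK"
  and CK_cnj [intro]: "f \<in> CK \<Longrightarrow> (\<lambda>x. cnj (f x)) \<in> CK"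
  by (auto simp: CK_def intro!: continuous_intros)

lemma CK_sum [intro]: "(\<And>i. i \<in> I \<Longrightarrow> f i \<in> CK) \<Longrightarrow> (\<lambda>x. \<Sum>i\<in>I. f i x) \<in> CK"
  by (auto simp: CK_def intro!: continuous_on_sum)

lemma CK_comp: "f \<in> CK \<Longrightarrow> continuous_on UNIV g \<Longrightarrow> (\<lambda>x. f (g x)) \<in> CK"
  by (auto simp: CK_def intro!: continuous_on_compose2[of UNIV f])

text \<open>Lagrange interpolation, with quotients of distances in place of linear factors.\<close>

lemma CK_interpolate:
  fixes S :: "'k::metric_space set"
  assumes "finite S"
  shows "\<exists>f\<in>CK. \<forall>x\<in>S. f x = v x"
  using assms
proof induction
  case empty
  then show ?case by (auto intro!: bexI[of _ "\<lambda>_. 0"])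
next
  case (insert x S)
  then obtain f where f: "f \<in> CK" "\<forall>x\<in>S. f x = v x" by blast
  define q where "q = (\<lambda>y. complex_of_real (\<Prod>s\<in>S. dist y s / dist x s))"
  have q: "q \<in> CK" unfolding q_def CK_def mem_Collect_eq divide_inverse by (intro continuous_intros)
  have qx: "q x = 1" using insert.hyps by (auto simp: q_def intro!: prod.neutral)
  have qS: "q y = 0" if "y \<in> S" for y
    using that insert.hyps by (auto simp: q_def)
  have "(\<lambda>y. f y + (v x - f x) * q y) \<in> CK" by (intro CK_add CK_mult CK_const f q)
  then show ?case
    by (rule bexI[rotated]) (use f qx qS in auto)
qed

lemma CK_Urysohn:
  fixes y :: "'k::metric_space"
  assumes "finite S"
  obtains q where "q \<in> CK" "q y = 1" "\<And>z. z \<in> S \<Longrightarrow> z \<noteq> y \<Longrightarrow> q z = 0"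
  using CK_interpolate[of "insert y S" "\<lambda>x. if x = y then 1 else 0"] assms by auto

locale self_similar_system =
  fixes N :: nat and \<gamma> :: "nat \<Rightarrow> 'k::metric_space \<Rightarrow> 'k" and h :: "'k \<Rightarrow> 'k"
  assumes compact_K: "compact (UNIV :: 'k set)"
    and N2: "N \<ge> 2"
    and selfsim: "self_similar N \<gamma>"
    and asmA: "assumption_A N \<gamma> h"
    and branch_ne: "branch_set N \<gamma> \<noteq> {}"
begin

abbreviation pt :: "nat list \<Rightarrow> 'k \<Rightarrow> 'k" where "pt w \<equiv> foldr \<gamma> w"

abbreviation W :: "nat \<Rightarrow> nat list set" where "W n \<equiv> words N n"

lemma cont_h: "continuous_on UNIV h"
  and h_gamma: "j \<in> {1..N} \<Longrightarrow> h (\<gamma> j y) = y"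
  and h_vimage: "h -` {y} = (\<lambda>j. \<gamma> j y) ` {1..N}"
  and finite_branch: "finite (branch_set N \<gamma>)"
  using asmA by (auto simp: assumption_A_def)

lemma branch_orbit:
  assumes "b \<in> branch_set N \<gamma>" "k \<ge> 1" "w \<in> W k"
  shows "pt w b \<notin> branch_set N \<gamma>"
proof -
  have "pt w b \<in> (\<Union>b\<in>branch_set N \<gamma>. \<Union>k\<in>{1..}. orbit N \<gamma> b k)"
    using assms by (auto simp: orbit_def intro!: bexI[of _ b] bexI[of _ k])
  then show ?thesis using asmA unfolding assumption_A_def by blast
qed

lemma cont_gamma: assumes "j \<in> {1..N}" shows "continuous_on UNIV (\<gamma> j)"
proof -
  obtain c' c where c: "0 < c'" "c' \<le> c" "c < 1"
    "\<forall>x y. c' * dist x y \<le> dist (\<gamma> j x) (\<gamma> j y) \<and> dist (\<gamma> j x) (\<gamma> j y) \<le> c * dist x y"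
    using selfsim assms unfolding self_similar_def proper_contraction_def by blast
  have "c-lipschitz_on UNIV (\<gamma> j)" using c by (intro lipschitz_onI) auto
  then show ?thesis by (rule lipschitz_on_continuous_on)
qed

lemma cont_pt: "w \<in> W n \<Longrightarrow> continuous_on UNIV (pt w)"
proof (induction n arbitrary: w)
  case 0
  then show ?case by simp
next
  case (Suc n)
  then obtain j v where w: "w = j # v" "j \<in> {1..N}" "v \<in> W n"
    by (cases w) (auto simp: words_def)
  have "continuous_on UNIV (\<gamma> j \<circ> pt v)"
    by (intro continuous_on_compose Suc.IH w continuous_on_subset[OF cont_gamma[OF w(2)]]) auto
  then show ?case by (simp add: w)
qed

lemma cont_hn: "continuous_on UNIV (h ^^ n)"
proof (induction n)
  case (Suc n)
  have "continuous_on UNIV (h \<circ> (h ^^ n))"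
    by (intro continuous_on_compose Suc.IH continuous_on_subset[OF cont_h]) auto
  then show ?case by (simp add: o_def)
qed (auto simp: id_def)

lemma CK_pt: "f \<in> CK \<Longrightarrow> w \<in> W n \<Longrightarrow> (\<lambda>z. f (pt w z)) \<in> CK"
  by (rule CK_comp[OF _ cont_pt])

lemma CK_hn: "f \<in> CK \<Longrightarrow> (\<lambda>z. f ((h ^^ n) z)) \<in> CK"
  by (rule CK_comp[OF _ cont_hn])

lemma hn_pt: "w \<in> W n \<Longrightarrow> (h ^^ n) (pt w z) = z"
proof (induction n arbitrary: w)
  case (Suc n)
  then obtain j v where w: "w = j # v" "j \<in> {1..N}" "v \<in> W n"
    by (cases w) (auto simp: words_def)
  have "(h ^^ Suc n) (pt w z) = (h ^^ n) (h (\<gamma> j (pt v z)))"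
    unfolding w(1) by (simp add: funpow_swap1)
  also have "\<dots> = z" using Suc.IH[OF w(3)] h_gamma[OF w(2)] by simp
  finally show ?case .
qed simp

lemma ex_letter: "\<exists>j\<in>{1..N}. x = \<gamma> j (h x)"
proof -
  have "x \<in> h -` {h x}" by simp
  then show ?thesis unfolding h_vimage by auto
qed

lemma ex_word: "\<exists>w\<in>W n. pt w ((h ^^ n) x) = x"
proof (induction n arbitrary: x)
  case (Suc n)
  obtain j where j: "j \<in> {1..N}" "x = \<gamma> j (h x)" using ex_letter by blast
  obtain w where w: "w \<in> W n" "pt w ((h ^^ n) (h x)) = h x" using Suc by blast
  have "j # w \<in> W (Suc n)" using j w by (simp add: words_Cons_iff)
  moreover have "pt (j # w) ((h ^^ Suc n) x) = x"
    using j(2) w(2) by (simp add: funpow_swap1)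
  ultimately show ?case by blast
qed simp

lemma hn_vimage: "(h ^^ n) -` {y} = (\<lambda>w. pt w y) ` W n"
proof
  show "(h ^^ n) -` {y} \<subseteq> (\<lambda>w. pt w y) ` W n"
  proof
    fix x assume "x \<in> (h ^^ n) -` {y}"
    then have "(h ^^ n) x = y" by simp
    then obtain w where "w \<in> W n" "pt w y = x" using ex_word[of n x] by blast
    then show "x \<in> (\<lambda>w. pt w y) ` W n" by blast
  qed
qed (auto simp: hn_pt)

text \<open>Applying \<open>h\<close> strips letters from the left until the remaining suffixes agree; the two letters
  in front of them then send one point to a common image, which is a branch point.\<close>

lemma pt_not_branch_inj:
  assumes "u \<in> W n" "w \<in> W n" "pt u z = pt w z" "u \<noteq> w"
  shows "\<exists>k<n. \<exists>v\<in>W (Suc k). pt v z \<in> branch_set N \<gamma>"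
  using assms
proof (induction n arbitrary: u w)
  case (Suc n)
  obtain i u' where u: "u = i # u'" "i \<in> {1..N}" "u' \<in> W n"
    using Suc.prems(1) by (cases u) (auto simp: words_def)
  obtain j w' where w: "w = j # w'" "j \<in> {1..N}" "w' \<in> W n"
    using Suc.prems(2) by (cases w) (auto simp: words_def)
  have eq: "\<gamma> i (pt u' z) = \<gamma> j (pt w' z)" using Suc.prems u w by simp
  then have eq': "pt u' z = pt w' z" using u w h_gamma by metis
  show ?case
  proof (cases "u' = w'")
    case True
    then have "i \<noteq> j" using Suc.prems u w by auto
    moreover have "pt u z = \<gamma> i (pt u' z)" "pt u z = \<gamma> j (pt u' z)"
      using eq unfolding eq' u(1) by (simp_all add: eq')
    ultimately have "pt u z \<in> branch_set N \<gamma>" using u(2) w(2) unfolding branch_set_def by blast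
    then show ?thesis using Suc.prems by blast
  next
    case False
    then show ?thesis using Suc.IH[OF u(3) w(3) eq'] by (meson less_Suc_eq)
  qed
qed simp

text \<open>A collision would put a branch point into the orbit of \<open>b\<close>, against part (3) of
  Assumption A.\<close>

lemma inj_pt_branch:
  assumes "b \<in> branch_set N \<gamma>" shows "inj_on (\<lambda>w. pt w b) (W n)"
proof (rule inj_onI, rule ccontr)
  fix u w assume "u \<in> W n" "w \<in> W n" "pt u b = pt w b" "u \<noteq> w"
  then obtain k v where "v \<in> W (Suc k)" "pt v b \<in> branch_set N \<gamma>"
    using pt_not_branch_inj by blast
  then show False using branch_orbit[OF assms, of "Suc k" v] by simp
qed

text \<open>Images of \<open>K\<close> under long words are small and never a single point, so \<open>K\<close> is perfect.\<close>

lemma perfect: "x islimpt (UNIV :: 'k set)"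
proof -
  obtain b where b: "b \<in> branch_set N \<gamma>" using branch_ne by blast
  have ne: "pt [1] b \<noteq> b"
    using branch_orbit[OF b, of 1 "[1]"] b N2 words_single[of 1 N] by auto
  obtain D where D: "\<And>x y :: 'k. dist x y \<le> (D::real)" 
    using compact_imp_bounded[OF compact_K] unfolding bounded_two_points by (metis UNIV_I)
  have "\<forall>j\<in>{1..N}. \<exists>c. 0 \<le> c \<and> c < 1 \<and> (\<forall>x y. dist (\<gamma> j x) (\<gamma> j y) \<le> c * dist x y)"
  proof
    fix j assume "j \<in> {1..N}"
    then obtain c' c where c: "0 < c'" "c' \<le> c" "c < 1"
      "\<forall>x y. c' * dist x y \<le> dist (\<gamma> j x) (\<gamma> j y) \<and> dist (\<gamma> j x) (\<gamma> j y) \<le> c * dist x y"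
      using selfsim unfolding self_similar_def proper_contraction_def by blast
    then show "\<exists>c. 0 \<le> c \<and> c < 1 \<and> (\<forall>x y. dist (\<gamma> j x) (\<gamma> j y) \<le> c * dist x y)"
      by (intro exI[of _ c]) auto
  qed
  then obtain c where c: "\<And>j. j \<in> {1..N} \<Longrightarrow> 0 \<le> c j \<and> c j < 1 \<and> (\<forall>x y. dist (\<gamma> j x) (\<gamma> j y) \<le> c j * dist x y)"
    by metis
  define C where "C = Max (c ` {1..N})"
  have "C \<in> c ` {1..N}" unfolding C_def using N2 by (intro Max_in) auto
  then have C: "0 \<le> C" "C < 1" using c by auto
  have cC: "c j \<le> C" if "j \<in> {1..N}" for j unfolding C_def using that by auto
  have small: "dist (pt w x) (pt w y) \<le> C ^ n * dist x y" if "w \<in> W n" for w n x y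
    using that
  proof (induction n arbitrary: w)
    case (Suc n)
    then obtain j v where w: "w = j # v" "j \<in> {1..N}" "v \<in> W n"
      by (cases w) (auto simp: words_def)
    have "dist (\<gamma> j (pt v x)) (\<gamma> j (pt v y)) \<le> c j * dist (pt v x) (pt v y)" using c w by blast
    also have "\<dots> \<le> C * (C ^ n * dist x y)"
      using cC w C Suc.IH[of v] c[of j] by (intro mult_mono) auto
    finally show ?case using w by simp
  qed simp
  show ?thesis
    unfolding islimpt_approachable
  proof (intro allI impI)
    fix e :: real assume e: "e > 0"
    have "(\<lambda>n. C ^ n * D) \<longlonglongrightarrow> 0 * D" using C by (intro tendsto_intros LIMSEQ_power_zero) auto
    then have "\<forall>\<^sub>F n in sequentially. C ^ n * D < e" using e by (intro order_tendstoD) auto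
    then obtain n where n: "C ^ n * D < e" by (auto simp: eventually_sequentially)
    obtain w where w: "w \<in> W n" "pt w ((h ^^ n) x) = x" using ex_word by blast
    have ne2: "pt w b \<noteq> pt w (pt [1] b)" using ne hn_pt[OF w(1)] by metis
    have near: "dist (pt w y) x < e" for y
    proof -
      have "dist (pt w y) (pt w ((h ^^ n) x)) \<le> C ^ n * dist y ((h ^^ n) x)" using small w by blast
      also have "\<dots> \<le> C ^ n * D" using D C by (intro mult_left_mono) auto
      finally show ?thesis using n w by simp
    qed
    show "\<exists>x'\<in>UNIV. x' \<noteq> x \<and> dist x' x < e" using near ne2 by (metis UNIV_I)
  qed
qed

text \<open>The points over which the fibre of \<open>h\<^sup>n\<close> consists of \<open>N\<^sup>n\<close> points.\<close>

definition regular :: "nat \<Rightarrow> 'k set" where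
  "regular n = {z. inj_on (\<lambda>w. pt w z) (W n)}"

text \<open>Points that are not regular are images of branch points under powers of \<open>h\<close>. There are only
  finitely many of them, and no point of \<open>K\<close> is isolated.\<close>

lemma regular_dense: "closure (regular n) = UNIV"
proof -
  define B where "B = (\<Union>k\<in>{..<n}. (h ^^ Suc k) ` branch_set N \<gamma>)"
  have fB: "finite B" unfolding B_def using finite_branch by blast
  have sub: "- B \<subseteq> regular n"
  proof
    fix z assume z: "z \<in> - B"
    show "z \<in> regular n"
    proof (rule ccontr)
      assume "z \<notin> regular n"
      then obtain u w where "u \<in> W n" "w \<in> W n" "pt u z = pt w z" "u \<noteq> w"
        by (auto simp: regular_def inj_on_def)
      then obtain k v where k: "k < n" "v \<in> W (Suc k)" "pt v z \<in> branch_set N \<gamma>"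
        using pt_not_branch_inj by blast
      have "(h ^^ Suc k) (pt v z) = z" by (rule hn_pt[OF k(2)])
      then have "z \<in> (h ^^ Suc k) ` branch_set N \<gamma>" using k(3) by (metis imageI)
      then show False using z k(1) unfolding B_def by blast
    qed
  qed
  have "x islimpt (- B)" for x
  proof -
    have "x islimpt (B \<union> - B)" using perfect by simp
    then show ?thesis using islimpt_Un_finite[OF fB] by blast
  qed
  then show ?thesis
    using sub by (metis UNIV_eq_I closure_def Un_iff islimpt_subset mem_Collect_eq)
qed

lemma eq_on_regular:
  assumes "f \<in> CK" "g \<in> CK" "\<And>z. z \<in> regular n \<Longrightarrow> f z = g z"
  shows "f = (g :: 'k \<Rightarrow> complex)"
proof
  fix z
  have "closed {z. f z = g z}"
    using assms(1,2) by (intro closed_Collect_eq) (auto simp: CK_def)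
  then have "closure (regular n) \<subseteq> {z. f z = g z}"
    using assms(3) by (intro closure_minimal) auto
  then show "f z = g z" by (auto simp: regular_dense)
qed

lemma le_on_regular:
  assumes "continuous_on UNIV f" "\<And>z. z \<in> regular n \<Longrightarrow> f z \<le> c"
  shows "f z \<le> (c::real)"
proof -
  have "closed {z. f z \<le> c}"
    using assms(1) by (intro closed_Collect_le) (auto intro: continuous_intros)
  then have "closure (regular n) \<subseteq> {z. f z \<le> c}"
    using assms(2) by (intro closure_minimal) auto
  then show "f z \<le> c" by (auto simp: regular_dense)
qed

lemma CK_bounded: assumes "f \<in> CK" obtains B where "\<And>x. cmod (f (x::'k)) \<le> B"
proof -
  have "compact (range f)" using assms compact_K by (auto simp: CK_def intro: compact_continuous_image)
  then have "bounded (range f)" by (rule compact_imp_bounded)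
  then show ?thesis using that by (auto simp: bounded_iff)
qed

end

section \<open>Adjointable operators on \<open>C(K)\<close>\<close>

type_synonym 'k fop = "('k \<Rightarrow> complex) \<Rightarrow> 'k \<Rightarrow> complex"

context self_similar_system begin

text \<open>The inner product of \<open>X\<^sup>\<otimes>\<^sup>n\<close> when its vectors are read as functions on \<open>K\<close>. With \<open>fsq\<close> for
  the squared norm in the fibre over \<open>z\<close>, most estimates can be made fibre by fibre.\<close>

definition ip :: "nat \<Rightarrow> ('k \<Rightarrow> complex) \<Rightarrow> ('k \<Rightarrow> complex) \<Rightarrow> 'k \<Rightarrow> complex" where
  "ip n f g z = (\<Sum>w\<in>W n. cnj (f (pt w z)) * g (pt w z))"

definition fsq :: "nat \<Rightarrow> ('k \<Rightarrow> complex) \<Rightarrow> 'k \<Rightarrow> real" where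
  "fsq n f z = (\<Sum>w\<in>W n. (cmod (f (pt w z)))\<^sup>2)"

lemma ip_self: "ip n f f z = complex_of_real (fsq n f z)"
  unfolding ip_def fsq_def of_real_sum
  by (intro sum.cong refl) (metis complex_norm_square mult.commute)

lemma fsq_nonneg: "0 \<le> fsq n f z"
  unfolding fsq_def by (intro sum_nonneg) auto

lemma fsq_ge: "w \<in> W n \<Longrightarrow> (cmod (f (pt w z)))\<^sup>2 \<le> fsq n f z"
  unfolding fsq_def by (rule member_le_sum[of w "W n" "\<lambda>w. (cmod (f (pt w z)))\<^sup>2"]) auto

lemma fsq_ge_hn: "(cmod (f x))\<^sup>2 \<le> fsq n f ((h ^^ n) x)"
proof -
  obtain w where "w \<in> W n" "pt w ((h ^^ n) x) = x" using ex_word by blast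
  then show ?thesis using fsq_ge by metis
qed

lemma fsq_le: "(\<And>x. cmod (f x) \<le> B) \<Longrightarrow> fsq n f z \<le> real (N ^ n) * B\<^sup>2"
  unfolding fsq_def using sum_bounded_above[of "W n" "\<lambda>w. (cmod (f (pt w z)))\<^sup>2" "B\<^sup>2"]
  by (simp add: power_mono card_words)

lemma ip_CK [intro]: "f \<in> CK \<Longrightarrow> g \<in> CK \<Longrightarrow> ip n f g \<in> CK"
  unfolding ip_def[abs_def] by (intro CK_sum CK_mult CK_cnj CK_pt) auto

lemma cont_fsq: assumes "f \<in> CK" shows "continuous_on UNIV (fsq n f)"
proof -
  have "fsq n f = (\<lambda>z. Re (ip n f f z))" by (simp add: ip_self)
  then show ?thesis using ip_CK[OF assms assms, of n] by (auto simp: CK_def intro: continuous_intros)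
qed

lemma ip_cnj: "cnj (ip n f g z) = ip n g f z"
  by (simp add: ip_def mult.commute)

lemma ip_add_right: "ip n f (\<lambda>x. g x + g' x) z = ip n f g z + ip n f g' z"
  and ip_add_left: "ip n (\<lambda>x. g x + g' x) f z = ip n g f z + ip n g' f z"
  and ip_diff_left: "ip n (\<lambda>x. g x - g' x) f z = ip n g f z - ip n g' f z"
  and ip_scale_right: "ip n f (\<lambda>x. c * g x) z = c * ip n f g z"
  and ip_scale_left: "ip n (\<lambda>x. c * f x) g z = cnj c * ip n f g z"
  by (simp_all add: ip_def algebra_simps sum.distrib sum_subtractf sum_distrib_left)

lemma CK_mod: "f \<in> CK \<Longrightarrow> q \<in> CK \<Longrightarrow> (\<lambda>x. f x * q ((h ^^ n) x)) \<in> CK"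
  by (intro CK_mult CK_hn)

lemma ip_mod_right: "ip n f (\<lambda>x. g x * q ((h ^^ n) x)) z = ip n f g z * q z"
  and ip_mod_left: "ip n (\<lambda>x. f x * q ((h ^^ n) x)) g z = ip n f g z * cnj (q z)"
  by (simp_all add: ip_def hn_pt mult_ac sum_distrib_left)

lemma fsq_mod: "fsq n (\<lambda>x. f x * q ((h ^^ n) x)) z = fsq n f z * (cmod (q z))\<^sup>2"
  by (simp add: fsq_def hn_pt norm_mult power_mult_distrib sum_distrib_right)

lemma ip_Suc: "ip (Suc n) f g z = (\<Sum>j\<in>{1..N}. ip n f g (\<gamma> j z))"
  by (simp add: ip_def sum_words_snoc)

lemma fsq_Suc: "fsq (Suc n) f z = (\<Sum>j\<in>{1..N}. fsq n f (\<gamma> j z))"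
  by (simp add: fsq_def sum_words_snoc)

lemma fsq_zero_imp: assumes "\<And>z. fsq n f z = 0" shows "f x = 0"
  using fsq_ge_hn[of f x n] assms by simp

lemma ip_nondegenerate:
  assumes f: "f \<in> CK" "f' \<in> CK" and eq: "\<And>g z. g \<in> CK \<Longrightarrow> ip n f g z = ip n f' g z"
  shows "f = f'"
proof
  fix x
  let ?g = "\<lambda>x. f x - f' x"
  have g: "?g \<in> CK" using f by blast
  have "ip n ?g ?g z = 0" for z
    using eq[OF g, of z] by (simp add: ip_diff_left[of n f f' ?g z])
  then have "fsq n ?g z = 0" for z by (simp add: ip_self)
  then show "f x = f' x" using fsq_zero_imp[of n ?g x] by simp
qed

text \<open>Operators are extensional on \<open>C(K)\<close>, so that an operator is the same object at every
  level \<open>n\<close>.\<close>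

definition isadj :: "nat \<Rightarrow> 'k fop \<Rightarrow> 'k fop \<Rightarrow> bool" where
  "isadj n t s \<longleftrightarrow> t \<in> CK \<rightarrow>\<^sub>E CK \<and> s \<in> CK \<rightarrow>\<^sub>E CK \<and>
     (\<forall>f\<in>CK. \<forall>g\<in>CK. \<forall>z. ip n (t f) g z = ip n f (s g) z)"

definition Adj :: "nat \<Rightarrow> 'k fop set" where
  "Adj n = {t. \<exists>s. isadj n t s}"

definition opadd :: "'k fop \<Rightarrow> 'k fop \<Rightarrow> 'k fop" where "opadd t s = (\<lambda>f\<in>CK. \<lambda>x. t f x + s f x)"
definition opmul :: "'k fop \<Rightarrow> 'k fop \<Rightarrow> 'k fop" where "opmul t s = (\<lambda>f\<in>CK. t (s f))"
definition opscale :: "complex \<Rightarrow> 'k fop \<Rightarrow> 'k fop" where "opscale c t = (\<lambda>f\<in>CK. \<lambda>x. c * t f x)"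

lemma isadj_CK: "isadj n t s \<Longrightarrow> f \<in> CK \<Longrightarrow> t f \<in> CK" "isadj n t s \<Longrightarrow> f \<in> CK \<Longrightarrow> s f \<in> CK"
  by (auto simp: isadj_def)

lemma isadjD: "isadj n t s \<Longrightarrow> f \<in> CK \<Longrightarrow> g \<in> CK \<Longrightarrow> ip n (t f) g z = ip n f (s g) z"
  by (auto simp: isadj_def)

lemma isadj_sym: assumes "isadj n t s" shows "isadj n s t"
proof -
  have "ip n (s f) g z = ip n f (t g) z" if "f \<in> CK" "g \<in> CK" for f g z
    using isadjD[OF assms that(2) that(1), of z] by (metis ip_cnj)
  then show ?thesis using assms by (auto simp: isadj_def)
qed

lemma Adj_CK: "t \<in> Adj n \<Longrightarrow> f \<in> CK \<Longrightarrow> t f \<in> CK"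
  by (auto simp: Adj_def dest: isadj_CK)

lemma Adj_ext: "t \<in> Adj n \<Longrightarrow> t \<in> CK \<rightarrow>\<^sub>E CK"
  by (auto simp: Adj_def isadj_def)

lemma Adj_eqI: "t \<in> Adj n \<Longrightarrow> s \<in> Adj m \<Longrightarrow> (\<And>f. f \<in> CK \<Longrightarrow> t f = s f) \<Longrightarrow> t = s"
  by (rule PiE_ext[OF Adj_ext Adj_ext])

text \<open>The inner product of level \<open>n + 1\<close> is a sum of inner products of level \<open>n\<close>, so an adjoint at one
  level is an adjoint at all higher ones.\<close>

lemma isadj_Suc: "isadj n t s \<Longrightarrow> isadj (Suc n) t s"
  by (simp add: isadj_def ip_Suc)

lemma isadj_mono: "isadj n t s \<Longrightarrow> n \<le> m \<Longrightarrow> isadj m t s"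
  by (induction m) (auto simp: le_Suc_eq isadj_Suc)

lemma Adj_mono: "t \<in> Adj n \<Longrightarrow> n \<le> m \<Longrightarrow> t \<in> Adj m"
  unfolding Adj_def using isadj_mono by blast

lemma isadj_unique:
  assumes "isadj n t s" "isadj m t s'" shows "s = s'"
proof -
  let ?l = "max n m"
  have a: "isadj ?l t s" "isadj ?l t s'" using assms isadj_mono by auto
  show ?thesis
  proof (rule PiE_ext[of s CK "\<lambda>_. CK" s'])
    fix f :: "'k \<Rightarrow> complex" assume f: "f \<in> CK"
    show "s f = s' f"
    proof (rule ip_nondegenerate[of _ _ ?l])
      show "s f \<in> CK" "s' f \<in> CK" using a f by (auto simp: isadj_CK)
      fix g z assume g: "(g :: 'k \<Rightarrow> complex) \<in> CK"
      have "ip ?l g (s f) z = ip ?l g (s' f) z"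
        using isadjD[OF a(1) g f] isadjD[OF a(2) g f] by simp
      then show "ip ?l (s f) g z = ip ?l (s' f) g z" by (metis ip_cnj)
    qed
  qed (use assms in \<open>auto simp: isadj_def\<close>)
qed

definition opstar :: "'k fop \<Rightarrow> 'k fop" where "opstar t = (THE s. \<exists>n. isadj n t s)"

lemma opstar_eq: "isadj n t s \<Longrightarrow> opstar t = s"
  unfolding opstar_def by (rule the_equality) (auto intro: isadj_unique)

lemma isadj_opstar: "t \<in> Adj n \<Longrightarrow> isadj n t (opstar t)"
  by (auto simp: Adj_def opstar_eq)

lemma opstar_Adj: "t \<in> Adj n \<Longrightarrow> opstar t \<in> Adj n"
  using isadj_opstar isadj_sym unfolding Adj_def by blast

lemma opstar_opstar: "t \<in> Adj n \<Longrightarrow> opstar (opstar t) = t"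
  using isadj_opstar isadj_sym opstar_eq by blast

text \<open>The inner product is nondegenerate, so each identity may be tested against \<open>t* g\<close>. The last
  one is linearity over \<open>C(K)\<close>, which acts on the right through \<open>h\<^sup>n\<close>.\<close>

lemma Adj_linear:
  assumes t: "t \<in> Adj n" and f: "f \<in> CK" and g: "g \<in> CK"
  shows "t (\<lambda>x. f x + g x) = (\<lambda>x. t f x + t g x)"
    and "t (\<lambda>x. f x - g x) = (\<lambda>x. t f x - t g x)"
    and "t (\<lambda>x. c * f x) = (\<lambda>x. c * t f x)"
    and "q \<in> CK \<Longrightarrow> t (\<lambda>x. f x * q ((h ^^ n) x)) = (\<lambda>x. t f x * q ((h ^^ n) x))"
proof -
  obtain s where s: "isadj n t s" using t by (auto simp: Adj_def)
  note C = isadj_CK[OF s]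
  note f g [intro]
  show "t (\<lambda>x. f x + g x) = (\<lambda>x. t f x + t g x)"
    by (rule ip_nondegenerate[of _ _ n]) (auto simp: isadjD[OF s] ip_add_left f g C CK_add)
  show "t (\<lambda>x. f x - g x) = (\<lambda>x. t f x - t g x)"
    by (rule ip_nondegenerate[of _ _ n]) (auto simp: isadjD[OF s] ip_diff_left f g C CK_diff)
  show "t (\<lambda>x. c * f x) = (\<lambda>x. c * t f x)"
    by (rule ip_nondegenerate[of _ _ n]) (auto simp: isadjD[OF s] ip_scale_left f g C CK_mult)
  assume q: "q \<in> CK"
  have fq: "(\<lambda>x. f x * q ((h ^^ n) x)) \<in> CK" "(\<lambda>x. t f x * q ((h ^^ n) x)) \<in> CK"
    by (intro CK_mod f q C)+
  show "t (\<lambda>x. f x * q ((h ^^ n) x)) = (\<lambda>x. t f x * q ((h ^^ n) x))"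
    by (rule ip_nondegenerate[of _ _ n]) (simp_all add: isadjD[OF s] ip_mod_left f g C fq)
qed

lemma isadj_add: assumes "isadj n t s" "isadj n t' s'" shows "isadj n (opadd t t') (opadd s s')"
  using assms unfolding isadj_def opadd_def
  by (auto simp: ip_add_left ip_add_right intro!: CK_add)

lemma isadj_scale: assumes "isadj n t s" shows "isadj n (opscale c t) (opscale (cnj c) s)"
  using assms unfolding isadj_def opscale_def
  by (auto simp: ip_scale_left ip_scale_right intro!: CK_mult)

lemma isadj_mul: assumes "isadj n t s" "isadj n t' s'" shows "isadj n (opmul t t') (opmul s' s)"
proof -
  have "ip n (t (t' f)) g z = ip n f (s' (s g)) z" if "f \<in> CK" "g \<in> CK" for f g z
    using isadjD[OF assms(1), of "t' f" g z] isadjD[OF assms(2), of f "s g" z] that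
      isadj_CK[OF assms(1)] isadj_CK[OF assms(2)] by simp
  then show ?thesis using isadj_CK[OF assms(1)] isadj_CK[OF assms(2)]
    unfolding isadj_def opmul_def by auto
qed

lemma Adj_add: "t \<in> Adj n \<Longrightarrow> s \<in> Adj n \<Longrightarrow> opadd t s \<in> Adj n"
  and Adj_mul: "t \<in> Adj n \<Longrightarrow> s \<in> Adj n \<Longrightarrow> opmul t s \<in> Adj n"
  and Adj_scale: "t \<in> Adj n \<Longrightarrow> opscale c t \<in> Adj n"
  unfolding Adj_def using isadj_add isadj_mul isadj_scale by blast+

text \<open>Adjointable operators are bounded by the Baire category theorem: at each point the value
  of \<open>t f\<close> is read off from an inner product \<open>(t f | g) = (f | t* g)\<close>, so it depends
  continuously on \<open>f\<close>.\<close>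

lemma Adj_sup_bounded:
  assumes t: "t \<in> Adj n"
  shows "\<exists>M. \<forall>f\<in>CK. \<forall>B>0. (\<forall>x. cmod (f x) \<le> B) \<longrightarrow> (\<forall>x. cmod (t f x) \<le> M * B)"
proof -
  obtain s where s: "isadj n t s" using t by (auto simp: Adj_def)
  define A where "A = (\<lambda>k::nat. {F :: ('k, complex) bcontfun. \<forall>x. cmod (t (apply_bcontfun F) x) \<le> real k})"
  have app: "apply_bcontfun F \<in> CK" for F :: "('k, complex) bcontfun"
    by (simp add: CK_def)
  have app_cont: "continuous_on UNIV (\<lambda>F :: ('k, complex) bcontfun. apply_bcontfun F y)" for y
  proof (rule lipschitz_on_continuous_on[of 1], rule lipschitz_onI)
    fix F G :: "('k, complex) bcontfun"
    show "dist (apply_bcontfun F y) (apply_bcontfun G y) \<le> 1 * dist F G"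
      using dist_bounded[of F y G] by simp
  qed simp
  have tcont: "continuous_on UNIV (\<lambda>F :: ('k, complex) bcontfun. t (apply_bcontfun F) x)" for x
  proof -
    define z where "z = (h ^^ n) x"
    obtain g where g: "g \<in> CK" "g x = 1" "\<And>y. y \<in> (\<lambda>w. pt w z) ` W n \<Longrightarrow> y \<noteq> x \<Longrightarrow> g y = 0"
      by (rule CK_Urysohn[of "(\<lambda>w. pt w z) ` W n" x]) auto
    \<comment> \<open>Each word that leads to \<open>x\<close> contributes the value at \<open>x\<close> to the inner product with \<open>g\<close>.\<close>
    define m where "m = card {w\<in>W n. pt w z = x}"
    have m: "m > 0" unfolding m_def card_gt_0_iff using ex_word[of n x] by (auto simp: z_def)
    have "ip n f g z = of_nat m * cnj (f x)" for f
    proof -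
      have "ip n f g z = (\<Sum>w\<in>W n. if pt w z = x then cnj (f x) else 0)"
        unfolding ip_def by (intro sum.cong refl) (use g in auto)
      then show ?thesis by (simp add: m_def sum.If_cases Int_def)
    qed
    then have "t f x = cnj (ip n f (s g) z) / of_nat m" if "f \<in> CK" for f
      using isadjD[OF s that g(1), of z] m by (metis complex_cnj_cnj complex_cnj_mult complex_cnj_of_nat nonzero_mult_div_cancel_left of_nat_0_less_iff less_numeral_extra(3) of_nat_eq_0_iff)
    then have eq: "cnj (\<Sum>w\<in>W n. cnj (apply_bcontfun F (pt w z)) * s g (pt w z)) / of_nat m = t (apply_bcontfun F) x"
      for F :: "('k, complex) bcontfun"
      using app by (simp add: ip_def)
    have "continuous_on UNIV (\<lambda>F :: ('k, complex) bcontfun.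
        cnj (\<Sum>w\<in>W n. cnj (apply_bcontfun F (pt w z)) * s g (pt w z)) / of_nat m)"
      using m by (intro continuous_intros app_cont) auto
    then show ?thesis by (rule continuous_on_eq) (rule eq)
  qed
  have closed: "closed (A k)" for k
    unfolding A_def using tcont
    by (intro closed_Collect_all closed_Collect_le continuous_intros)
  have cover: "\<Union>(range A) = UNIV"
  proof -
    have "\<exists>k. F \<in> A k" for F
    proof -
      obtain B where "\<And>x. cmod (t (apply_bcontfun F) x) \<le> B"
        using CK_bounded Adj_CK[OF t app] by blast
      moreover obtain k where "B \<le> real k" using real_arch_simple by blast
      ultimately show ?thesis unfolding A_def mem_Collect_eq by (meson order_trans)
    qed
    then show ?thesis by auto
  qed
  have "\<exists>k. interior (A k) \<noteq> {}"
  proof (rule ccontr)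
    assume "\<not> ?thesis"
    then have "euclidean interior_of \<Union>(range A) = {}"
      using closed
      by (intro Baire_category_alt) (auto simp: completely_metrizable_space_euclidean)
    then show False unfolding cover by simp
  qed
  then obtain k F0 where "F0 \<in> interior (A k)" by blast
  then obtain r where r: "r > 0" "cball F0 r \<subseteq> A k" by (auto simp: mem_interior_cball)
  have "cmod (t f x) \<le> (2 * real k / r) * B"
    if f: "f \<in> CK" and B: "B > 0" "\<forall>x. cmod (f x) \<le> B" for f B x
  proof -
    define c where "c = complex_of_real (r / B)"
    have fb: "f \<in> bcontfun" using f B by (intro bcontfun_normI) (auto simp: CK_def)
    define F1 where "F1 = Bcontfun (\<lambda>x. apply_bcontfun F0 x + c * f x)"
    have cf: "(\<lambda>x. c * f x) \<in> CK" using f by auto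
    have rb: "cmod (c * f x) \<le> r" for x
    proof -
      have "cmod (c * f x) = (r / B) * cmod (f x)" using B r by (simp add: c_def norm_mult norm_divide)
      also have "\<dots> \<le> (r / B) * B" using B r by (intro mult_left_mono) auto
      finally show ?thesis using B by simp
    qed
    have cb: "(\<lambda>x. c * f x) \<in> bcontfun"
      by (rule bcontfun_normI[where b = r]) (use cf rb in \<open>auto simp: CK_def\<close>)
    have aF1: "apply_bcontfun F1 = (\<lambda>x. apply_bcontfun F0 x + c * f x)"
      unfolding F1_def by (rule Bcontfun_inverse, rule plus_cont[OF apply_bcontfun cb])
    have "dist F0 F1 \<le> r"
      by (rule dist_bound) (use rb in \<open>simp add: aF1 dist_norm\<close>)
    then have "F1 \<in> A k" "F0 \<in> A k" using r by auto
    then have "cmod (t (apply_bcontfun F1) x) \<le> k" "cmod (t (apply_bcontfun F0) x) \<le> k" by (auto simp: A_def)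
    moreover have "t (apply_bcontfun F1) x = t (apply_bcontfun F0) x + c * t f x"
      unfolding aF1 Adj_linear(1)[OF t app cf] Adj_linear(3)[OF t f f] by simp
    ultimately have "cmod (c * t f x) \<le> 2 * k"
      using norm_triangle_ineq4[of "t (apply_bcontfun F1) x" "t (apply_bcontfun F0) x"] by simp
    then show ?thesis using B r by (simp add: c_def norm_mult norm_divide field_simps)
  qed
  then show ?thesis by (intro exI[of _ "2 * real k / r"]) blast
qed

text \<open>The bound holds fibrewise. Multiplying \<open>f\<close> by a function of \<open>h\<^sup>n\<close> commutes with \<open>t\<close> and
  can make the fibre over \<open>z\<close> the one where the norm of \<open>f\<close> is attained.\<close>

definition bnd :: "nat \<Rightarrow> 'k fop \<Rightarrow> real \<Rightarrow> bool" where
  "bnd n t M \<longleftrightarrow> 0 \<le> M \<and> (\<forall>f\<in>CK. \<forall>z. fsq n (t f) z \<le> M\<^sup>2 * fsq n f z)"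

lemma fibrewise_bound:
  assumes t: "t \<in> Adj n" and M: "M \<ge> 0"
    and sup: "\<And>f c. f \<in> CK \<Longrightarrow> c > 0 \<Longrightarrow> (\<And>z. fsq n f z \<le> c) \<Longrightarrow> (\<And>z. fsq n (t f) z \<le> M\<^sup>2 * c)"
  shows "bnd n t M"
  unfolding bnd_def
proof (intro conjI ballI allI M)
  fix f :: "'k \<Rightarrow> complex" and z assume f: "f \<in> CK"
  show "fsq n (t f) z \<le> M\<^sup>2 * fsq n f z"
  proof (rule field_le_epsilon)
    fix e' :: real assume e': "e' > 0"
    define e where "e = e' / (M\<^sup>2 + 1)"
    have "M\<^sup>2 + 1 > 0" by (smt (verit) zero_le_power2)
    then have e: "e > 0" "M\<^sup>2 * e \<le> e'" using e' unfolding e_def by (auto simp: field_simps)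
    define c where "c = fsq n f z + e"
    have c: "c > 0" using fsq_nonneg[of n f z] e by (simp add: c_def)
    \<comment> \<open>This cut-off scales every fibre norm down to at most \<open>c\<close> and leaves the fibre over \<open>z\<close> alone.\<close>
    define q where "q = (\<lambda>y. complex_of_real (sqrt (c / max c (fsq n f y))))"
    have q: "q \<in> CK" unfolding q_def CK_def mem_Collect_eq
      using c by (intro continuous_intros cont_fsq[OF f]) (simp add: max.strict_coboundedI1 less_imp_neq[symmetric])
    have qz: "q z = 1" using c e by (simp add: q_def c_def)
    have q2: "(cmod (q y))\<^sup>2 = c / max c (fsq n f y)" for y using c by (simp add: q_def)
    let ?g = "\<lambda>x. f x * q ((h ^^ n) x)"
    have g: "?g \<in> CK" by (intro CK_mod f q)
    have "fsq n ?g y \<le> c" for y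
    proof -
      have "fsq n f y * (c / max c (fsq n f y)) \<le> max c (fsq n f y) * (c / max c (fsq n f y))"
        using c by (intro mult_right_mono) auto
      also have "\<dots> = c" using c by auto
      finally show ?thesis by (simp add: fsq_mod q2)
    qed
    then have "fsq n (t ?g) z \<le> M\<^sup>2 * c" using sup[OF g c] by blast
    then have "fsq n (t f) z \<le> M\<^sup>2 * c"
      using Adj_linear(4)[OF t f f q] by (simp add: fsq_mod qz)
    then show "fsq n (t f) z \<le> M\<^sup>2 * fsq n f z + e'" using e by (simp add: c_def distrib_left)
  qed
qed

lemma Adj_bnd: assumes t: "t \<in> Adj n" shows "\<exists>M. bnd n t M"
proof -
  obtain M where M: "\<forall>f\<in>CK. \<forall>B>0. (\<forall>x. cmod (f x) \<le> B) \<longrightarrow> (\<forall>x. cmod (t f x) \<le> M * B)"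
    using Adj_sup_bounded[OF t] by blast
  define M' where "M' = sqrt (real (N ^ n)) * M"
  have "cmod (t (\<lambda>_. 1) (SOME x. True)) \<le> M * 1"
    using M[rule_format, of "\<lambda>_. 1" 1] by simp
  then have M0: "M \<ge> 0" using norm_ge_zero[of "t (\<lambda>_. 1) (SOME x. True)"] by linarith
  have "bnd n t M'"
  proof (rule fibrewise_bound[OF t])
    show "M' \<ge> 0" using M0 by (simp add: M'_def)
    fix f :: "'k \<Rightarrow> complex" and c :: real and z assume f: "f \<in> CK" "c > 0" "\<And>z. fsq n f z \<le> c"
    have "cmod (f x) \<le> sqrt c" for x
      by (rule real_le_rsqrt) (meson fsq_ge_hn f(3) order_trans)
    then have "cmod (t f x) \<le> M * sqrt c" for x using M f by simp
    then have "fsq n (t f) z \<le> real (N ^ n) * (M * sqrt c)\<^sup>2" by (rule fsq_le)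
    then show "fsq n (t f) z \<le> M'\<^sup>2 * c" using f by (simp add: M'_def power_mult_distrib)
  qed
  then show ?thesis ..
qed

text \<open>The fibrewise bound does not depend on the level. Upwards one sums over fibres; downwards
  one multiplies \<open>f\<close> by a function of \<open>h\<^sup>n\<close> supported near one of the points of the larger fibre.\<close>

lemma bnd_Suc: assumes "bnd n t M" shows "bnd (Suc n) t M"
  using assms unfolding bnd_def fsq_Suc by (auto simp: sum_distrib_left intro!: sum_mono)

lemma bnd_down:
  assumes t: "t \<in> Adj n" and b: "bnd (Suc n) t M" shows "bnd n t M"
  unfolding bnd_def
proof (intro conjI ballI allI)
  show "0 \<le> M" using b by (simp add: bnd_def)
  fix f :: "'k \<Rightarrow> complex" and z assume f: "f \<in> CK"
  define y where "y = h z"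
  define m where "m = card {j\<in>{1..N}. \<gamma> j y = z}"
  have m: "m > 0" unfolding m_def card_gt_0_iff using ex_letter[of z] by (auto simp: y_def)
  \<comment> \<open>Of the points \<open>\<gamma>\<^sub>j(y)\<close> only \<open>z\<close> survives the factor \<open>q\<close>, once for each of the \<open>m\<close> letters that lead to it.\<close>
  obtain q where q: "q \<in> CK" "q z = 1" "\<And>x. x \<in> (\<lambda>j. \<gamma> j y) ` {1..N} \<Longrightarrow> x \<noteq> z \<Longrightarrow> q x = 0"
    by (rule CK_Urysohn[of "(\<lambda>j. \<gamma> j y) ` {1..N}" z]) auto
  let ?g = "\<lambda>x. f x * q ((h ^^ n) x)"
  have g: "?g \<in> CK" by (intro CK_mod f q(1))
  have sums: "fsq (Suc n) (\<lambda>x. a x * q ((h ^^ n) x)) y = real m * fsq n a z" for a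
  proof -
    have "fsq (Suc n) (\<lambda>x. a x * q ((h ^^ n) x)) y = (\<Sum>j\<in>{1..N}. if \<gamma> j y = z then fsq n a z else 0)"
      unfolding fsq_Suc fsq_mod using q by (intro sum.cong) auto
    then show ?thesis by (simp add: m_def sum.If_cases Int_def)
  qed
  have "fsq (Suc n) (t ?g) y \<le> M\<^sup>2 * fsq (Suc n) ?g y" using b g by (simp add: bnd_def)
  then have "real m * fsq n (t f) z \<le> real m * (M\<^sup>2 * fsq n f z)"
    unfolding Adj_linear(4)[OF t f f q(1)] sums by (simp add: mult.left_commute)
  then show "fsq n (t f) z \<le> M\<^sup>2 * fsq n f z" using m by simp
qed

lemma bnd_mono: "bnd n t M \<Longrightarrow> n \<le> m \<Longrightarrow> bnd m t M"
  by (induction m) (auto simp: le_Suc_eq bnd_Suc)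

lemma bnd_level:
  assumes t: "t \<in> Adj n" and b: "bnd m t M" shows "bnd n t M"
proof -
  have "bnd (n + k) t M \<Longrightarrow> bnd n t M" for k
  proof (induction k)
    case (Suc k)
    then show ?case using bnd_down[OF Adj_mono[OF t, of "n + k"]] by simp
  qed simp
  moreover have "bnd (n + m) t M" using bnd_mono[OF b] by simp
  ultimately show ?thesis by blast
qed

text \<open>The least fibrewise bound. The level is quantified away, because all levels at which an operator
  is adjointable have the same bounds.\<close>

definition op_norm :: "'k fop \<Rightarrow> real" where "op_norm t = Inf {M. \<exists>n. bnd n t M}"

lemma bnd_bdd_below: "bdd_below {M. \<exists>n. bnd n t M}"
  by (rule bdd_belowI[of _ 0]) (auto simp: bnd_def)

lemma op_norm_le: "bnd n t M \<Longrightarrow> op_norm t \<le> M"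
  unfolding op_norm_def by (rule cInf_lower) (use bnd_bdd_below in auto)

lemma bnd_op_norm: assumes t: "t \<in> Adj n" shows "bnd n t (op_norm t)"
proof -
  have ne: "{M. \<exists>n. bnd n t M} \<noteq> {}" using Adj_bnd[OF t] by blast
  have o0: "op_norm t \<ge> 0" unfolding op_norm_def using ne by (intro cInf_greatest) (auto simp: bnd_def)
  have "fsq n (t f) z \<le> (op_norm t)\<^sup>2 * fsq n f z" if f: "f \<in> CK" for f z
  proof (rule LIMSEQ_le_const)
    show "(\<lambda>k. (op_norm t + inverse (real (Suc k)))\<^sup>2 * fsq n f z) \<longlonglongrightarrow> (op_norm t)\<^sup>2 * fsq n f z"
      using tendsto_mult[OF tendsto_power[OF tendsto_add[OF tendsto_const LIMSEQ_inverse_real_of_nat], of "op_norm t" 2] tendsto_const, of "fsq n f z"]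
      by simp
    show "\<exists>L. \<forall>k\<ge>L. fsq n (t f) z \<le> (op_norm t + inverse (real (Suc k)))\<^sup>2 * fsq n f z"
    proof (intro exI allI impI)
      fix k :: nat
      have "op_norm t < op_norm t + inverse (real (Suc k))" by simp
      then obtain M m where M: "bnd m t M" "M < op_norm t + inverse (real (Suc k))"
        unfolding op_norm_def using cInf_lessD[OF ne] by blast
      have b: "bnd n t M" using bnd_level[OF t M(1)] .
      then have "fsq n (t f) z \<le> M\<^sup>2 * fsq n f z" using f by (simp add: bnd_def)
      also have "\<dots> \<le> (op_norm t + inverse (real (Suc k)))\<^sup>2 * fsq n f z"
        using b M(2) fsq_nonneg[of n f z] by (intro mult_right_mono power_mono) (auto simp: bnd_def)
      finally show "fsq n (t f) z \<le> (op_norm t + inverse (real (Suc k)))\<^sup>2 * fsq n f z" .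
    qed
  qed
  then show ?thesis using o0 by (simp add: bnd_def)
qed

lemma op_norm_nonneg: "t \<in> Adj n \<Longrightarrow> 0 \<le> op_norm t"
  using bnd_op_norm by (auto simp: bnd_def)

lemma fsq_triangle: "sqrt (fsq n (\<lambda>x. f x + g x) z) \<le> sqrt (fsq n f z) + sqrt (fsq n g z)"
proof -
  have "sqrt (fsq n (\<lambda>x. f x + g x) z) \<le> L2_set (\<lambda>w. cmod (f (pt w z)) + cmod (g (pt w z))) (W n)"
    unfolding fsq_def L2_set_def
    by (intro real_sqrt_le_mono sum_mono power_mono norm_triangle_ineq) auto
  also have "\<dots> \<le> L2_set (\<lambda>w. cmod (f (pt w z))) (W n) + L2_set (\<lambda>w. cmod (g (pt w z))) (W n)"
    by (rule L2_set_triangle_ineq)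
  finally show ?thesis by (simp add: fsq_def L2_set_def)
qed

lemma sqrt_fsq_le: "bnd n t M \<Longrightarrow> f \<in> CK \<Longrightarrow> sqrt (fsq n (t f) z) \<le> M * sqrt (fsq n f z)"
  using real_sqrt_le_mono[of "fsq n (t f) z" "M\<^sup>2 * fsq n f z"]
  by (simp add: bnd_def real_sqrt_mult)

lemma bndI:
  assumes "0 \<le> M" "\<And>f z. f \<in> CK \<Longrightarrow> sqrt (fsq n (t f) z) \<le> M * sqrt (fsq n f z)"
  shows "bnd n t M"
proof -
  have "fsq n (t f) z \<le> M\<^sup>2 * fsq n f z" if "f \<in> CK" for f z
    using power_mono[OF assms(2)[OF that, of z], of 2] fsq_nonneg[of n]
    by (simp add: power_mult_distrib)
  then show ?thesis using assms(1) by (simp add: bnd_def)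
qed

lemma op_norm_add: assumes "t \<in> Adj n" "s \<in> Adj n" shows "op_norm (opadd t s) \<le> op_norm t + op_norm s"
proof (rule op_norm_le[of n], rule bndI)
  show "0 \<le> op_norm t + op_norm s" using op_norm_nonneg assms by (simp add: add_nonneg_nonneg)
  fix f :: "'k \<Rightarrow> complex" and z assume f: "f \<in> CK"
  have "sqrt (fsq n (opadd t s f) z) \<le> sqrt (fsq n (t f) z) + sqrt (fsq n (s f) z)"
    using fsq_triangle f by (simp add: opadd_def)
  also have "\<dots> \<le> op_norm t * sqrt (fsq n f z) + op_norm s * sqrt (fsq n f z)"
    by (intro add_mono sqrt_fsq_le bnd_op_norm assms f)
  finally show "sqrt (fsq n (opadd t s f) z) \<le> (op_norm t + op_norm s) * sqrt (fsq n f z)"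
    by (simp add: distrib_right)
qed

lemma op_norm_mul: assumes "t \<in> Adj n" "s \<in> Adj n" shows "op_norm (opmul t s) \<le> op_norm t * op_norm s"
proof (rule op_norm_le[of n], rule bndI)
  show "0 \<le> op_norm t * op_norm s" using op_norm_nonneg assms by simp
  fix f :: "'k \<Rightarrow> complex" and z assume f: "f \<in> CK"
  have "sqrt (fsq n (t (s f)) z) \<le> op_norm t * sqrt (fsq n (s f) z)"
    by (intro sqrt_fsq_le bnd_op_norm assms Adj_CK[OF assms(2)] f)
  also have "\<dots> \<le> op_norm t * (op_norm s * sqrt (fsq n f z))"
    by (intro mult_left_mono sqrt_fsq_le bnd_op_norm assms f op_norm_nonneg[OF assms(1)])
  finally show "sqrt (fsq n (opmul t s f) z) \<le> op_norm t * op_norm s * sqrt (fsq n f z)"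
    using f by (simp add: opmul_def mult.assoc)
qed

lemma op_norm_scale_le: assumes "t \<in> Adj n" shows "op_norm (opscale c t) \<le> cmod c * op_norm t"
proof (rule op_norm_le[of n])
  show "bnd n (opscale c t) (cmod c * op_norm t)"
    using bnd_op_norm[OF assms] op_norm_nonneg[OF assms]
    by (auto simp: bnd_def opscale_def fsq_def norm_mult power_mult_distrib sum_distrib_left[symmetric]
        mult.assoc intro!: mult_left_mono)
qed

text \<open>The Cauchy-Schwarz inequality in the fibre, applied to \<open>(t* f | t* f) = (t t* f | f)\<close>.\<close>

lemma op_norm_star_le: assumes t: "t \<in> Adj n" shows "op_norm (opstar t) \<le> op_norm t"
proof (rule op_norm_le[of n], rule bndI)
  show "0 \<le> op_norm t" by (rule op_norm_nonneg[OF t])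
  fix f :: "'k \<Rightarrow> complex" and z assume f: "f \<in> CK"
  let ?s = "opstar t"
  have sf: "?s f \<in> CK" using Adj_CK[OF opstar_Adj[OF t] f] .
  have "fsq n (?s f) z = cmod (ip n (t (?s f)) f z)"
    using isadjD[OF isadj_opstar[OF t] sf f] fsq_nonneg[of n "?s f" z] by (simp add: ip_self)
  also have "\<dots> \<le> (\<Sum>w\<in>W n. \<bar>cmod (t (?s f) (pt w z))\<bar> * \<bar>cmod (f (pt w z))\<bar>)"
    unfolding ip_def by (rule order_trans[OF norm_sum]) (simp add: norm_mult)
  also have "\<dots> \<le> L2_set (\<lambda>w. cmod (t (?s f) (pt w z))) (W n) * L2_set (\<lambda>w. cmod (f (pt w z))) (W n)"
    by (rule L2_set_mult_ineq)
  also have "\<dots> = sqrt (fsq n (t (?s f)) z) * sqrt (fsq n f z)" by (simp add: L2_set_def fsq_def)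
  also have "\<dots> \<le> (op_norm t * sqrt (fsq n (?s f) z)) * sqrt (fsq n f z)"
    using fsq_nonneg[of n f z] by (intro mult_right_mono sqrt_fsq_le bnd_op_norm t sf) auto
  finally have le: "sqrt (fsq n (?s f) z) * sqrt (fsq n (?s f) z) \<le> sqrt (fsq n (?s f) z) * (op_norm t * sqrt (fsq n f z))"
    using fsq_nonneg[of n "?s f" z] by (simp add: mult_ac)
  show "sqrt (fsq n (?s f) z) \<le> op_norm t * sqrt (fsq n f z)"
  proof (cases "sqrt (fsq n (?s f) z) = 0")
    case True
    then show ?thesis using op_norm_nonneg[OF t] fsq_nonneg[of n f z] by simp
  next
    case False
    then have "sqrt (fsq n (?s f) z) > 0" using fsq_nonneg[of n "?s f" z] by simp
    then show ?thesis using le by (simp only: mult_le_cancel_left_pos)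
  qed
qed


section \<open>The operator metric\<close>

definition op_dist where "op_dist s t = op_norm (opadd s (opscale (-1) t))"

lemma op_dist_Adj: "s \<in> Adj n \<Longrightarrow> t \<in> Adj n \<Longrightarrow> opadd s (opscale (-1) t) \<in> Adj n"
  by (intro Adj_add Adj_scale)

lemma op_dist_apply: "f \<in> CK \<Longrightarrow> opadd s (opscale (-1) t) f = (\<lambda>x. s f x - t f x)"
  by (simp add: opadd_def opscale_def)

lemma opadd_apply: "f \<in> CK \<Longrightarrow> opadd s t f = (\<lambda>x. s f x + t f x)"
  and opscale_apply: "f \<in> CK \<Longrightarrow> opscale c t f = (\<lambda>x. c * t f x)"
  by (simp_all add: opadd_def opscale_def)

lemma op_dist_le: assumes "0 \<le> M" "\<And>f z. f \<in> CK \<Longrightarrow> fsq n (\<lambda>x. s f x - t f x) z \<le> M\<^sup>2 * fsq n f z"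
  shows "op_dist s t \<le> M"
  unfolding op_dist_def by (rule op_norm_le[of n]) (use assms in \<open>auto simp: bnd_def op_dist_apply\<close>)

lemma op_dist_bound:
  "s \<in> Adj n \<Longrightarrow> t \<in> Adj n \<Longrightarrow> f \<in> CK \<Longrightarrow> fsq n (\<lambda>x. s f x - t f x) z \<le> (op_dist s t)\<^sup>2 * fsq n f z"
  using bnd_op_norm[OF op_dist_Adj[of s n t]] by (auto simp: bnd_def op_dist_def op_dist_apply)

lemma op_dist_nonneg: "s \<in> Adj n \<Longrightarrow> t \<in> Adj n \<Longrightarrow> 0 \<le> op_dist s t"
  unfolding op_dist_def by (rule op_norm_nonneg[OF op_dist_Adj])

lemma op_dist_self: "s \<in> Adj n \<Longrightarrow> op_dist s s = 0"
  using op_dist_nonneg[of s n s] op_dist_le[of 0 n s s] by (simp add: fsq_def)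

lemma fsq_minus_commute: "fsq n (\<lambda>x. a x - b x) z = fsq n (\<lambda>x. b x - a x) z"
  by (simp add: fsq_def norm_minus_commute)

lemma op_dist_sym: assumes "s \<in> Adj n" "t \<in> Adj n" shows "op_dist s t = op_dist t s"
proof (rule antisym)
  show "op_dist s t \<le> op_dist t s" using assms
    by (intro op_dist_le[of _ n] op_dist_nonneg) (auto simp: fsq_minus_commute[of n "s _"] intro!: op_dist_bound)
  show "op_dist t s \<le> op_dist s t" using assms
    by (intro op_dist_le[of _ n] op_dist_nonneg) (auto simp: fsq_minus_commute[of n "t _"] intro!: op_dist_bound)
qed

lemma op_dist_eqI:
  assumes "\<And>f. f \<in> CK \<Longrightarrow> (\<lambda>x. s f x - t f x) = (\<lambda>x. a f x)" "a \<in> Adj n"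
  shows "op_dist s t = op_norm a"
proof -
  have "opadd s (opscale (-1) t) = a"
    by (rule PiE_ext[of _ CK "\<lambda>_. CK"])
       (use assms Adj_ext[OF assms(2)] in \<open>auto simp: opadd_def opscale_def PiE_iff\<close>)
  then show ?thesis by (simp add: op_dist_def)
qed

lemma op_dist_tri:
  assumes "s \<in> Adj n" "t \<in> Adj n" "u \<in> Adj n" shows "op_dist s u \<le> op_dist s t + op_dist t u"
proof -
  let ?a = "opadd s (opscale (-1) t)" and ?b = "opadd t (opscale (-1) u)"
  have "op_dist s u = op_norm (opadd ?a ?b)"
    by (rule op_dist_eqI[of _ _ _ n]) (simp add: opadd_def opscale_def algebra_simps, intro Adj_add Adj_scale assms)
  also have "\<dots> \<le> op_norm ?a + op_norm ?b" by (intro op_norm_add[of _ n] op_dist_Adj assms)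
  finally show ?thesis by (simp add: op_dist_def)
qed

lemma op_dist_add:
  assumes "s \<in> Adj n" "s' \<in> Adj n" "t \<in> Adj n" "t' \<in> Adj n"
  shows "op_dist (opadd s t) (opadd s' t') \<le> op_dist s s' + op_dist t t'"
proof -
  let ?a = "opadd s (opscale (-1) s')" and ?b = "opadd t (opscale (-1) t')"
  have "op_dist (opadd s t) (opadd s' t') = op_norm (opadd ?a ?b)"
    by (rule op_dist_eqI[of _ _ _ n]) (simp add: opadd_def opscale_def algebra_simps, intro Adj_add Adj_scale assms)
  also have "\<dots> \<le> op_norm ?a + op_norm ?b" by (intro op_norm_add[of _ n] op_dist_Adj assms)
  finally show ?thesis by (simp add: op_dist_def)
qed

lemma op_dist_scale:
  assumes "s \<in> Adj n" "t \<in> Adj n" shows "op_dist (opscale c s) (opscale c t) \<le> cmod c * op_dist s t"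
proof -
  let ?a = "opadd s (opscale (-1) t)"
  have "op_dist (opscale c s) (opscale c t) = op_norm (opscale c ?a)"
    by (rule op_dist_eqI[of _ _ _ n]) (simp add: opadd_def opscale_def algebra_simps, intro Adj_add Adj_scale assms)
  also have "\<dots> \<le> cmod c * op_norm ?a" by (intro op_norm_scale_le[of _ n] op_dist_Adj assms)
  finally show ?thesis by (simp add: op_dist_def)
qed

lemma op_dist_mul:
  assumes "s \<in> Adj n" "s' \<in> Adj n" "t \<in> Adj n" "t' \<in> Adj n"
  shows "op_dist (opmul s t) (opmul s' t') \<le> op_norm s * op_dist t t' + op_dist s s' * op_norm t'"
proof -
  let ?a = "opadd s (opscale (-1) s')" and ?b = "opadd t (opscale (-1) t')"
  have C: "t f \<in> CK" "t' f \<in> CK" if "f \<in> CK" for f using assms that Adj_CK by auto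
  have "op_dist (opmul s t) (opmul s' t') = op_norm (opadd (opmul s ?b) (opmul ?a t'))"
    by (rule op_dist_eqI[of _ _ _ n])
       (simp add: opmul_def op_dist_apply opadd_def[of "restrict _ _"] C Adj_linear(2)[OF assms(1)],
        intro Adj_add Adj_mul Adj_scale assms)
  also have "\<dots> \<le> op_norm (opmul s ?b) + op_norm (opmul ?a t')" by (intro op_norm_add[of _ n] Adj_mul op_dist_Adj assms)
  also have "\<dots> \<le> op_norm s * op_norm ?b + op_norm ?a * op_norm t'" by (intro add_mono op_norm_mul[of _ n] op_dist_Adj assms)
  finally show ?thesis by (simp add: op_dist_def)
qed

lemma opstar_add: "s \<in> Adj n \<Longrightarrow> t \<in> Adj n \<Longrightarrow> opstar (opadd s t) = opadd (opstar s) (opstar t)"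
  by (intro opstar_eq isadj_add isadj_opstar)
lemma opstar_scale: "s \<in> Adj n \<Longrightarrow> opstar (opscale c s) = opscale (cnj c) (opstar s)"
  by (intro opstar_eq isadj_scale isadj_opstar)
lemma opstar_mul: "s \<in> Adj n \<Longrightarrow> t \<in> Adj n \<Longrightarrow> opstar (opmul s t) = opmul (opstar t) (opstar s)"
  by (intro opstar_eq isadj_mul isadj_opstar)

lemma op_dist_star:
  assumes "s \<in> Adj n" "t \<in> Adj n" shows "op_dist (opstar s) (opstar t) \<le> op_dist s t"
  using op_norm_star_le[OF op_dist_Adj[OF assms]] opstar_add[OF assms(1) Adj_scale[OF assms(2)], of "-1"]
    opstar_scale[OF assms(2), of "-1"]
  by (simp add: op_dist_def)

lemma op_norm_diff: assumes "s \<in> Adj n" "t \<in> Adj n" shows "\<bar>op_norm s - op_norm t\<bar> \<le> op_dist s t"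
proof -
  have *: "op_norm s \<le> op_norm t + op_dist s t" if "s \<in> Adj n" "t \<in> Adj n" for s t
  proof -
    let ?a = "opadd s (opscale (-1) t)"
    have "s = opadd t ?a"
      by (rule PiE_ext[OF Adj_ext[OF that(1)] Adj_ext[OF Adj_add[OF that(2) op_dist_Adj[OF that]]]])
         (simp add: opadd_def opscale_def)
    then have "op_norm s \<le> op_norm t + op_norm ?a" using op_norm_add[OF that(2) op_dist_Adj[OF that]] by simp
    then show ?thesis by (simp add: op_dist_def)
  qed
  show ?thesis using *[OF assms] *[OF assms(2,1)] op_dist_sym[OF assms] by linarith
qed

lemma op_norm_limit_apply:
  assumes s: "\<And>j. s j \<in> Adj n" and t: "t \<in> Adj n" and l: "(\<lambda>j. op_dist (s j) t) \<longlonglongrightarrow> 0" and f: "f \<in> CK"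
  shows "(\<lambda>j. s j f x) \<longlonglongrightarrow> t f x"
proof -
  let ?z = "(h ^^ n) x"
  have "cmod (s j f x - t f x) \<le> op_dist (s j) t * sqrt (fsq n f ?z)" for j
  proof -
    have "(cmod (s j f x - t f x))\<^sup>2 \<le> fsq n (\<lambda>x. s j f x - t f x) ?z" by (rule fsq_ge_hn)
    also have "\<dots> \<le> (op_dist (s j) t)\<^sup>2 * fsq n f ?z" by (rule op_dist_bound[OF s t f])
    also have "\<dots> = (op_dist (s j) t * sqrt (fsq n f ?z))\<^sup>2" by (simp add: power_mult_distrib fsq_nonneg)
    finally show ?thesis by (rule power2_le_imp_le) (simp add: op_dist_nonneg[OF s t] fsq_nonneg)
  qed
  then have "\<forall>\<^sub>F j in sequentially. norm (s j f x - t f x) \<le> op_dist (s j) t * sqrt (fsq n f ?z)"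
    by (rule always_eventually[OF allI])
  then have "(\<lambda>j. s j f x - t f x) \<longlonglongrightarrow> 0"
    by (rule Lim_null_comparison[OF _ tendsto_mult_left_zero[OF l]])
  then show ?thesis by (simp add: LIM_zero_iff)
qed

section \<open>Continuous kernels\<close>

text \<open>A continuous matrix that represents \<open>t\<close> on every fibre. It acts on \<open>N\<^sup>n\<close> coordinates also
  over those points whose fibre is smaller, and there it carries more information than \<open>t\<close> restricted
  to the fibre.\<close>

definition kern where
  "kern n t k \<longleftrightarrow> t \<in> Adj n \<and> (\<forall>u\<in>W n. \<forall>w\<in>W n. k u w \<in> CK) \<and>
     (\<forall>f\<in>CK. \<forall>z. \<forall>u\<in>W n. t f (pt u z) = (\<Sum>w\<in>W n. k u w z * f (pt w z)))"

lemma kern_Adj: "kern n t k \<Longrightarrow> t \<in> Adj n"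
  and kern_CK: "kern n t k \<Longrightarrow> u \<in> W n \<Longrightarrow> w \<in> W n \<Longrightarrow> k u w \<in> CK"
  and kernD: "kern n t k \<Longrightarrow> f \<in> CK \<Longrightarrow> u \<in> W n \<Longrightarrow> t f (pt u z) = (\<Sum>w\<in>W n. k u w z * f (pt w z))"
  by (auto simp: kern_def)

lemma interpolate_regular:
  assumes "z \<in> regular n"
  obtains f where "f \<in> CK" "\<And>w. w \<in> W n \<Longrightarrow> f (pt w z) = v w"
proof -
  obtain f where f: "f \<in> CK" "\<forall>x\<in>(\<lambda>w. pt w z) ` W n. f x = v (inv_into (W n) (\<lambda>w. pt w z) x)"
    using CK_interpolate[of "(\<lambda>w. pt w z) ` W n" "\<lambda>x. v (inv_into (W n) (\<lambda>w. pt w z) x)"] by auto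
  show thesis
  proof (rule that[of f])
    fix w assume w: "w \<in> W n"
    have "inv_into (W n) (\<lambda>w. pt w z) (pt w z) = w"
      using assms w unfolding regular_def by (intro inv_into_f_f[where f = "\<lambda>w. pt w z"]) auto
    then show "f (pt w z) = v w" using f(2) w by auto
  qed (rule f(1))
qed

text \<open>Over a regular point the kernel is the matrix of \<open>t\<close> on the fibre, and regular points are
  dense.\<close>

lemma kern_unique:
  assumes k: "kern n t k" "kern n t k'" and u: "u \<in> W n" and w: "w \<in> W n"
  shows "k u w = k' u w"
proof (rule eq_on_regular[of _ _ n])
  fix z assume z: "z \<in> regular n"
  obtain f where f: "f \<in> CK" "\<And>x. x \<in> W n \<Longrightarrow> f (pt x z) = (if x = w then 1 else 0)"
    using interpolate_regular[OF z, where v = "\<lambda>x. if x = w then 1 else 0"] by blast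
  have "t f (pt u z) = \<kappa> u w z" if "kern n t \<kappa>" for \<kappa>
  proof -
    have "t f (pt u z) = (\<Sum>x\<in>W n. if x = w then \<kappa> u x z else 0)"
      unfolding kernD[OF that f(1) u] by (intro sum.cong refl) (simp add: f)
    then show ?thesis using w by simp
  qed
  then show "k u w z = k' u w z" using k by metis
qed (use assms kern_CK in auto)

text \<open>Over a regular point every vector \<open>v\<close> is the restriction of a continuous function to the fibre.
  Continuity of the kernel extends the estimate to the other points.\<close>

lemma kern_bound:
  assumes k: "kern n t k"
  shows "(\<Sum>u\<in>W n. (cmod (\<Sum>w\<in>W n. k u w z * v w))\<^sup>2) \<le> (op_norm t)\<^sup>2 * (\<Sum>w\<in>W n. (cmod (v w))\<^sup>2)"
proof (rule le_on_regular[of _ n])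
  show "continuous_on UNIV (\<lambda>z. \<Sum>u\<in>W n. (cmod (\<Sum>w\<in>W n. k u w z * v w))\<^sup>2)"
    using kern_CK[OF k] by (intro continuous_intros) (auto simp: CK_def)
  fix z assume z: "z \<in> regular n"
  obtain f where f: "f \<in> CK" "\<And>w. w \<in> W n \<Longrightarrow> f (pt w z) = v w"
    using interpolate_regular[OF z] by blast
  have "fsq n (t f) z = (\<Sum>u\<in>W n. (cmod (\<Sum>w\<in>W n. k u w z * v w))\<^sup>2)"
    unfolding fsq_def by (intro sum.cong refl) (simp add: kernD[OF k f(1)] f(2))
  moreover have "fsq n f z = (\<Sum>w\<in>W n. (cmod (v w))\<^sup>2)"
    unfolding fsq_def by (intro sum.cong refl) (simp add: f(2))
  ultimately show "(\<Sum>u\<in>W n. (cmod (\<Sum>w\<in>W n. k u w z * v w))\<^sup>2) \<le> (op_norm t)\<^sup>2 * (\<Sum>w\<in>W n. (cmod (v w))\<^sup>2)"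
    using bnd_op_norm[OF kern_Adj[OF k]] f(1) by (metis bnd_def)
qed

lemma kern_row_bound:
  assumes k: "kern n t k" and u: "u \<in> W n"
  shows "(cmod (\<Sum>w\<in>W n. k u w z * v w))\<^sup>2 \<le> (op_norm t)\<^sup>2 * (\<Sum>w\<in>W n. (cmod (v w))\<^sup>2)"
proof -
  have "(cmod (\<Sum>w\<in>W n. k u w z * v w))\<^sup>2 \<le> (\<Sum>u\<in>W n. (cmod (\<Sum>w\<in>W n. k u w z * v w))\<^sup>2)"
    using u by (intro member_le_sum[of u "W n" "\<lambda>u. (cmod (\<Sum>w\<in>W n. k u w z * v w))\<^sup>2"]) auto
  then show ?thesis using kern_bound[OF k, of z v] by linarith
qed

lemma kern_entry_bound:
  assumes k: "kern n t k" and u: "u \<in> W n" and w: "w \<in> W n" shows "cmod (k u w z) \<le> op_norm t"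
proof -
  have "(\<Sum>x\<in>W n. k u x z * (if x = w then 1 else 0)) = k u w z" using w by (simp add: if_distrib cong: if_cong)
  moreover have "(\<Sum>x\<in>W n. (cmod (if x = w then 1 else 0))\<^sup>2) = 1"
    using w by (simp add: if_distrib[of cmod] if_distrib[of "\<lambda>x. x\<^sup>2"] cong: if_cong)
  ultimately have "(cmod (k u w z))\<^sup>2 \<le> (op_norm t)\<^sup>2"
    using kern_row_bound[OF k u, of z "\<lambda>x. if x = w then 1 else 0"] by simp
  then show ?thesis by (rule power2_le_imp_le) (rule op_norm_nonneg[OF kern_Adj[OF k]])
qed

lemma kern_add: "kern n t k \<Longrightarrow> kern n s l \<Longrightarrow> kern n (opadd t s) (\<lambda>u w z. k u w z + l u w z)"
  unfolding kern_def by (auto simp: opadd_apply distrib_right sum.distrib intro!: Adj_add CK_add)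

lemma kern_scale: "kern n t k \<Longrightarrow> kern n (opscale c t) (\<lambda>u w z. c * k u w z)"
  unfolding kern_def by (auto simp: opscale_apply mult.assoc sum_distrib_left intro!: Adj_scale CK_mult)

lemma kern_mul:
  assumes k: "kern n t k" and l: "kern n s l"
  shows "kern n (opmul t s) (\<lambda>u w z. \<Sum>x\<in>W n. k u x z * l x w z)"
  unfolding kern_def
proof (intro conjI ballI allI)
  show "opmul t s \<in> Adj n" by (intro Adj_mul kern_Adj[OF k] kern_Adj[OF l])
  fix f u z assume f: "(f::'k\<Rightarrow>complex) \<in> CK" and u: "u \<in> W n"
  have "opmul t s f (pt u z) = (\<Sum>x\<in>W n. k u x z * (\<Sum>w\<in>W n. l x w z * f (pt w z)))"
    using kernD[OF k Adj_CK[OF kern_Adj[OF l] f] u] kernD[OF l f] f by (simp add: opmul_def)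
  also have "\<dots> = (\<Sum>x\<in>W n. \<Sum>w\<in>W n. k u x z * l x w z * f (pt w z))"
    by (simp add: sum_distrib_left mult.assoc)
  also have "\<dots> = (\<Sum>w\<in>W n. \<Sum>x\<in>W n. k u x z * l x w z * f (pt w z))" by (rule sum.swap)
  finally show "opmul t s f (pt u z) = (\<Sum>w\<in>W n. (\<Sum>x\<in>W n. k u x z * l x w z) * f (pt w z))"
    by (simp add: sum_distrib_right)
qed (use kern_CK[OF k] kern_CK[OF l] in \<open>auto intro!: CK_sum CK_mult\<close>)

text \<open>Over a regular point this is the conjugate transpose of a matrix; both sides are continuous.\<close>

lemma kern_star:
  assumes k: "kern n t k" shows "kern n (opstar t) (\<lambda>u w z. cnj (k w u z))"
  unfolding kern_def
proof (intro conjI ballI allI)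
  note t = kern_Adj[OF k]
  show "opstar t \<in> Adj n" by (rule opstar_Adj[OF t])
  show C: "(\<lambda>z. cnj (k w u z)) \<in> CK" if "u \<in> W n" "w \<in> W n" for u w using kern_CK[OF k] that by auto
  fix f z u assume f: "(f::'k\<Rightarrow>complex) \<in> CK" and u: "u \<in> W n"
  have "(\<lambda>z. opstar t f (pt u z)) = (\<lambda>z. \<Sum>w\<in>W n. cnj (k w u z) * f (pt w z))"
  proof (rule eq_on_regular[of _ _ n])
    show "(\<lambda>z. opstar t f (pt u z)) \<in> CK" by (rule CK_pt[OF Adj_CK[OF opstar_Adj[OF t] f] u])
    show "(\<lambda>z. \<Sum>w\<in>W n. cnj (k w u z) * f (pt w z)) \<in> CK"
      by (intro CK_sum CK_mult C u CK_pt[OF f])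
    fix z assume z: "z \<in> regular n"
    obtain g where g: "g \<in> CK" "\<And>x. x \<in> W n \<Longrightarrow> g (pt x z) = (if x = u then 1 else 0)"
      using interpolate_regular[OF z, where v = "\<lambda>x. if x = u then 1 else 0"] by blast
    have "ip n g (opstar t f) z = (\<Sum>x\<in>W n. if x = u then opstar t f (pt x z) else 0)"
      unfolding ip_def by (intro sum.cong refl) (simp add: g)
    then have 1: "ip n g (opstar t f) z = opstar t f (pt u z)" using u by simp
    have tg: "t g (pt w z) = k w u z" if "w \<in> W n" for w
    proof -
      have "t g (pt w z) = (\<Sum>x\<in>W n. if x = u then k w x z else 0)"
        unfolding kernD[OF k g(1) that] by (intro sum.cong refl) (simp add: g)
      then show ?thesis using u by simp
    qed
    have "ip n (t g) f z = (\<Sum>w\<in>W n. cnj (k w u z) * f (pt w z))"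
      unfolding ip_def by (intro sum.cong refl) (simp add: tg)
    then show "opstar t f (pt u z) = (\<Sum>w\<in>W n. cnj (k w u z) * f (pt w z))"
      using 1 isadjD[OF isadj_opstar[OF t] g(1) f, of z] by simp
  qed
  then show "opstar t f (pt u z) = (\<Sum>w\<in>W n. cnj (k w u z) * f (pt w z))" by (rule fun_cong)
qed

text \<open>The kernel of \<open>T \<otimes> I\<close> is block diagonal, with one block for each last letter.\<close>

definition amp where
  "amp k = (\<lambda>u w z. if last u = last w then k (butlast u) (butlast w) (\<gamma> (last u) z) else (0::complex))"

lemma amp_snoc: "amp k (u @ [i]) (w @ [j]) z = (if i = j then k u w (\<gamma> i z) else 0)"
  by (simp add: amp_def)

lemma kern_Suc: assumes k: "kern n t k" shows "kern (Suc n) t (amp k)"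
  unfolding kern_def
proof (intro conjI ballI allI)
  show "t \<in> Adj (Suc n)" using Adj_mono[OF kern_Adj[OF k]] by simp
  fix u assume "u \<in> W (Suc n)"
  then obtain u' i where u: "u' \<in> W n" "i \<in> {1..N}" "u = u' @ [i]" by (rule words_snocE)
  show "amp k u w \<in> CK" if "w \<in> W (Suc n)" for w
  proof -
    obtain w' j where w: "w' \<in> W n" "j \<in> {1..N}" "w = w' @ [j]" using \<open>w \<in> W (Suc n)\<close> by (rule words_snocE)
    show ?thesis
      using CK_comp[OF kern_CK[OF k u(1) w(1)] cont_gamma[OF u(2)]]
      by (cases "i = j") (simp_all add: u w amp_def)
  qed
  fix f z assume f: "(f::'k\<Rightarrow>complex) \<in> CK"
  have "(\<Sum>w\<in>W (Suc n). amp k u w z * f (pt w z)) =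
      (\<Sum>j\<in>{1..N}. if i = j then \<Sum>w\<in>W n. k u' w (\<gamma> i z) * f (pt w (\<gamma> i z)) else 0)"
    unfolding sum_words_snoc u amp_snoc by (intro sum.cong refl) auto
  also have "\<dots> = t f (pt u' (\<gamma> i z))"
    using u(2) by (simp add: kernD[OF k f u(1)])
  finally show "t f (pt u z) = (\<Sum>w\<in>W (Suc n). amp k u w z * f (pt w z))" by (simp add: u)
qed

text \<open>The norm dominates the entries of kernels, so along a convergent sequence of operators the
  kernels converge uniformly.\<close>

lemma kern_limit:
  assumes k: "\<And>j. kern n (s j) (k j)" and t: "t \<in> Adj n" and l: "(\<lambda>j. op_dist (s j) t) \<longlonglongrightarrow> 0"
  obtains \<kappa> where "kern n t \<kappa>" "\<And>u w z. u \<in> W n \<Longrightarrow> w \<in> W n \<Longrightarrow> (\<lambda>j. k j u w z) \<longlonglongrightarrow> \<kappa> u w z"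
proof -
  note sL = kern_Adj[OF k]
  have diff: "cmod (k i u w z - k j u w z) \<le> op_dist (s i) t + op_dist (s j) t"
    if "u \<in> W n" "w \<in> W n" for i j u w z
  proof -
    have "cmod (k i u w z + (-1) * k j u w z) \<le> op_norm (opadd (s i) (opscale (-1) (s j)))"
      by (rule kern_entry_bound[OF kern_add[OF k kern_scale[OF k]] that])
    also have "\<dots> = op_dist (s i) (s j)" by (simp add: op_dist_def)
    also have "\<dots> \<le> op_dist (s i) t + op_dist t (s j)" by (rule op_dist_tri[OF sL t sL])
    finally show ?thesis using op_dist_sym[OF sL t] by simp
  qed
  have "\<exists>l. uniform_limit UNIV (\<lambda>j. k j u w) l sequentially" if uw: "u \<in> W n" "w \<in> W n" for u w
  proof -
    have "uniformly_Cauchy_on UNIV (\<lambda>j. k j u w)"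
      unfolding uniformly_Cauchy_on_def
    proof (intro allI impI)
      fix e :: real assume e: "e > 0"
      then have "\<forall>\<^sub>F j in sequentially. op_dist (s j) t < e/2" using l by (intro order_tendstoD) auto
      then obtain M where M: "\<And>j. j \<ge> M \<Longrightarrow> op_dist (s j) t < e/2" by (auto simp: eventually_sequentially)
      have "dist (k i u w z) (k j u w z) < e" if "i \<ge> M" "j \<ge> M" for i j z
        using diff[OF uw, of i z j] M[OF that(1)] M[OF that(2)] unfolding dist_norm by linarith
      then show "\<exists>M. \<forall>x\<in>UNIV. \<forall>m\<ge>M. \<forall>n\<ge>M. dist (k m u w x) (k n u w x) < e" by blast
    qed
    then have "uniformly_convergent_on UNIV (\<lambda>j. k j u w)"
      by (rule Cauchy_uniformly_convergent)
    then show ?thesis by (simp add: uniformly_convergent_on_def)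
  qed
  then obtain \<kappa> where \<kappa>: "\<And>u w. u \<in> W n \<Longrightarrow> w \<in> W n \<Longrightarrow> uniform_limit UNIV (\<lambda>j. k j u w) (\<kappa> u w) sequentially"
    by metis
  have lim: "(\<lambda>j. k j u w z) \<longlonglongrightarrow> \<kappa> u w z" if "u \<in> W n" "w \<in> W n" for u w z
    by (rule tendsto_uniform_limitI[OF \<kappa>[OF that]]) simp
  have "kern n t \<kappa>" unfolding kern_def
  proof (intro conjI ballI allI t)
    show "\<kappa> u w \<in> CK" if uw: "u \<in> W n" "w \<in> W n" for u w
    proof -
      have "\<forall>\<^sub>F j in sequentially. continuous_on UNIV (k j u w)"
        using kern_CK[OF k uw] by (simp add: CK_def)
      then show ?thesis unfolding CK_def mem_Collect_eq
        by (rule uniform_limit_theorem[OF _ \<kappa>[OF uw]]) simp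
    qed
    fix f z u assume f: "(f::'k\<Rightarrow>complex) \<in> CK" and u: "u \<in> W n"
    have "(\<lambda>j. \<Sum>w\<in>W n. k j u w z * f (pt w z)) \<longlonglongrightarrow> (\<Sum>w\<in>W n. \<kappa> u w z * f (pt w z))"
      by (intro tendsto_intros lim u)
    then have "(\<lambda>j. s j f (pt u z)) \<longlonglongrightarrow> (\<Sum>w\<in>W n. \<kappa> u w z * f (pt w z))"
      by (simp add: kernD[OF k f u])
    then show "t f (pt u z) = (\<Sum>w\<in>W n. \<kappa> u w z * f (pt w z))"
      by (rule LIMSEQ_unique[OF op_norm_limit_apply[OF sL t l f]])
  qed
  then show ?thesis using lim that by blast
qed

section \<open>Compact operators and the algebras \<open>\<F>\<^sup>(\<^sup>n\<^sup>)\<close>\<close>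

text \<open>The operator \<open>\<theta>\<^sub>f\<^sub>,\<^sub>g\<close> on \<open>X\<^sup>\<otimes>\<^sup>n\<close>, read on \<open>C(K)\<close>.\<close>

definition rank_one where "rank_one n f g = (\<lambda>e\<in>CK. \<lambda>x. f x * ip n g e ((h ^^ n) x))"

lemma rank_one_apply: "e \<in> CK \<Longrightarrow> rank_one n f g e = (\<lambda>x. f x * ip n g e ((h ^^ n) x))"
  by (simp add: rank_one_def)

lemma isadj_rank_one: assumes "f \<in> CK" "g \<in> CK" shows "isadj n (rank_one n f g) (rank_one n g f)"
proof -
  have "ip n (rank_one n f g e) e' z = ip n e (rank_one n g f e') z" if "e \<in> CK" "e' \<in> CK" for e e' z
    using that assms by (simp add: rank_one_def ip_mod_left ip_mod_right ip_cnj)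
  then show ?thesis using assms unfolding isadj_def rank_one_def
    by (auto intro!: CK_mod ip_CK)
qed

lemma rank_one_Adj: "f \<in> CK \<Longrightarrow> g \<in> CK \<Longrightarrow> rank_one n f g \<in> Adj n"
  and opstar_rank_one: "f \<in> CK \<Longrightarrow> g \<in> CK \<Longrightarrow> opstar (rank_one n f g) = rank_one n g f"
  using isadj_rank_one opstar_eq unfolding Adj_def by blast+

lemma opmul_rank_one: assumes t: "t \<in> Adj n" and fg: "f \<in> CK" "g \<in> CK"
  shows "opmul t (rank_one n f g) = rank_one n (t f) g" and "opmul (rank_one n f g) t = rank_one n f (opstar t g)"
proof -
  show "opmul t (rank_one n f g) = rank_one n (t f) g"
    using Adj_linear(4)[OF t fg(1) fg(1) ip_CK[OF fg(2)]]
    by (auto simp: opmul_def rank_one_def fun_eq_iff restrict_def)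
  have "ip n g (t e) = ip n (opstar t g) e" if "e \<in> CK" for e
    using isadjD[OF isadj_sym[OF isadj_opstar[OF t]] fg(2) that] by auto
  then show "opmul (rank_one n f g) t = rank_one n f (opstar t g)"
    using Adj_CK[OF t] by (auto simp: opmul_def rank_one_def fun_eq_iff restrict_def)
qed

lemma kern_rank_one:
  assumes "f \<in> CK" "g \<in> CK" shows "kern n (rank_one n f g) (\<lambda>u w z. f (pt u z) * cnj (g (pt w z)))"
  unfolding kern_def using assms
  by (auto simp: rank_one_Adj rank_one_apply ip_def hn_pt sum_distrib_left mult.assoc intro!: CK_mult CK_cnj CK_pt)

definition closed_sub where
  "closed_sub n B \<longleftrightarrow> B \<subseteq> Adj n \<and>
     (\<forall>s\<in>B. \<forall>t\<in>B. opadd s t \<in> B \<and> opmul s t \<in> B) \<and> (\<forall>c. \<forall>s\<in>B. opscale c s \<in> B) \<and>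
     (\<forall>s\<in>B. opstar s \<in> B) \<and>
     (\<forall>s. \<forall>t\<in>Adj n. (\<forall>j. s j \<in> B) \<and> (\<lambda>j. op_dist (s j) t) \<longlonglongrightarrow> 0 \<longrightarrow> t \<in> B)"

text \<open>The compact operators on \<open>X\<^sup>\<otimes>\<^sup>n\<close>, read on \<open>C(K)\<close>.\<close>

definition Kc where
  "Kc n = \<Inter>{B. closed_sub n B \<and> {rank_one n f g | f g. f \<in> CK \<and> g \<in> CK} \<subseteq> B}"

lemma closed_sub_Adj: "closed_sub n (Adj n)"
  unfolding closed_sub_def by (auto intro: Adj_add Adj_mul Adj_scale opstar_Adj)

lemma Kc_least: "closed_sub n B \<Longrightarrow> (\<And>f g. f \<in> CK \<Longrightarrow> g \<in> CK \<Longrightarrow> rank_one n f g \<in> B) \<Longrightarrow> Kc n \<subseteq> B"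
  unfolding Kc_def by blast

lemma Kc_Adj: "Kc n \<subseteq> Adj n"
  by (rule Kc_least[OF closed_sub_Adj rank_one_Adj])

lemma Kc_rank_one: "f \<in> CK \<Longrightarrow> g \<in> CK \<Longrightarrow> rank_one n f g \<in> Kc n"
  unfolding Kc_def by blast

lemma closed_sub_Kc: "closed_sub n (Kc n)"
proof -
  have Adj: "Kc n \<subseteq> Adj n" by (rule Kc_Adj)
  show ?thesis
    unfolding closed_sub_def
  proof (intro conjI Adj ballI allI impI)
    fix s t assume "s \<in> Kc n" "t \<in> Kc n"
    then show "opadd s t \<in> Kc n" "opmul s t \<in> Kc n"
      unfolding Kc_def closed_sub_def by simp_all
  next
    fix c s assume "s \<in> Kc n"
    then show "opscale c s \<in> Kc n" "opstar s \<in> Kc n"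
      unfolding Kc_def closed_sub_def by simp_all
  next
    fix s t assume t: "t \<in> Adj n" and s: "(\<forall>j. s j \<in> Kc n) \<and> (\<lambda>j. op_dist (s j) t) \<longlonglongrightarrow> 0"
    show "t \<in> Kc n" unfolding Kc_def
    proof (rule InterI, elim CollectE conjE)
      fix B assume B: "closed_sub n B" "{rank_one n f g | f g. f \<in> CK \<and> g \<in> CK} \<subseteq> B"
      then have "\<forall>j. s j \<in> B" using s unfolding Kc_def by blast
      then show "t \<in> B" using B(1) t s unfolding closed_sub_def by blast
    qed
  qed
qed

lemma Kc_add: "s \<in> Kc n \<Longrightarrow> t \<in> Kc n \<Longrightarrow> opadd s t \<in> Kc n"
  and Kc_mul: "s \<in> Kc n \<Longrightarrow> t \<in> Kc n \<Longrightarrow> opmul s t \<in> Kc n"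
  and Kc_scale: "s \<in> Kc n \<Longrightarrow> opscale c s \<in> Kc n"
  and Kc_star: "s \<in> Kc n \<Longrightarrow> opstar s \<in> Kc n"
  using closed_sub_Kc[of n] by (simp_all add: closed_sub_def)

lemma Kc_limit: "t \<in> Adj n \<Longrightarrow> (\<And>j. s j \<in> Kc n) \<Longrightarrow> (\<lambda>j. op_dist (s j) t) \<longlonglongrightarrow> 0 \<Longrightarrow> t \<in> Kc n"
  using closed_sub_Kc[of n] unfolding closed_sub_def by blast

text \<open>The operators that multiply \<open>\<L>(X\<^sup>\<otimes>\<^sup>n)\<close> into the compacts from both sides form a closed
  subalgebra that contains the rank one operators.\<close>

lemma Kc_ideal: assumes "s \<in> Kc n" "t \<in> Adj n" shows "opmul t s \<in> Kc n" "opmul s t \<in> Kc n"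
proof -
  let ?B = "{s \<in> Adj n. \<forall>t\<in>Adj n. opmul t s \<in> Kc n \<and> opmul s t \<in> Kc n}"
  have "closed_sub n ?B"
    unfolding closed_sub_def
  proof (intro conjI ballI allI impI)
    fix s s' assume s: "s \<in> ?B" "s' \<in> ?B"
    have 1: "opmul t (opadd s s') = opadd (opmul t s) (opmul t s')"
            "opmul (opadd s s') t = opadd (opmul s t) (opmul s' t)" if t: "t \<in> Adj n" for t
      using s Adj_CK Adj_linear(1)[OF t] Adj_CK[OF t]
      by (auto simp: opmul_def opadd_def fun_eq_iff restrict_def)
    show "opadd s s' \<in> ?B" using s 1 by (simp add: Adj_add Kc_add)
    have 2: "opmul t (opmul s s') = opmul (opmul t s) s'"
            "opmul (opmul s s') t = opmul s (opmul s' t)" if t: "t \<in> Adj n" for t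
      using s Adj_CK Adj_CK[OF t] by (auto simp: opmul_def fun_eq_iff restrict_def)
    show "opmul s s' \<in> ?B"
    proof -
      have "opmul (opmul t s) s' \<in> Kc n \<and> opmul s (opmul s' t) \<in> Kc n" if "t \<in> Adj n" for t
        using s that Adj_mul[of _ n] by blast
      then show ?thesis using s 2 by (simp add: Adj_mul)
    qed
  next
    fix c s assume s: "s \<in> ?B"
    have 1: "opmul t (opscale c s) = opscale c (opmul t s)"
            "opmul (opscale c s) t = opscale c (opmul s t)" if t: "t \<in> Adj n" for t
      using s Adj_CK Adj_linear(3)[OF t] Adj_CK[OF t]
      by (auto simp: opmul_def opscale_def fun_eq_iff restrict_def)
    show "opscale c s \<in> ?B" using s 1 by (simp add: Adj_scale Kc_scale)
  next
    fix s assume s: "s \<in> ?B"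
    have "opmul t (opstar s) \<in> Kc n \<and> opmul (opstar s) t \<in> Kc n" if t: "t \<in> Adj n" for t
    proof -
      have "opmul t (opstar s) = opstar (opmul s (opstar t))" "opmul (opstar s) t = opstar (opmul (opstar t) s)"
        using s t by (simp_all add: opstar_mul[of _ n] opstar_opstar[of _ n] opstar_Adj)
      then show ?thesis using s opstar_Adj[OF t] by (simp add: Kc_star)
    qed
    then show "opstar s \<in> ?B" using s by (simp add: opstar_Adj)
  next
    fix s l assume l: "l \<in> Adj n" and s: "(\<forall>j. s j \<in> ?B) \<and> (\<lambda>j. op_dist (s j) l) \<longlonglongrightarrow> 0"
    have sL: "s j \<in> Adj n" for j using s by blast
    have "opmul t l \<in> Kc n \<and> opmul l t \<in> Kc n" if t: "t \<in> Adj n" for t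
    proof
      have l1: "(\<lambda>j. op_norm t * op_dist (s j) l) \<longlonglongrightarrow> 0" "(\<lambda>j. op_dist (s j) l * op_norm t) \<longlonglongrightarrow> 0"
        using s by (auto intro: tendsto_mult_right_zero tendsto_mult_left_zero)
      show "opmul t l \<in> Kc n"
      proof (rule Kc_limit[where s = "\<lambda>j. opmul t (s j)"])
        have "op_dist (opmul t (s j)) (opmul t l) \<le> op_norm t * op_dist (s j) l" for j
          using op_dist_mul[OF t t sL l] op_dist_self[OF t] by simp
        then show "(\<lambda>j. op_dist (opmul t (s j)) (opmul t l)) \<longlonglongrightarrow> 0"
          by (intro tendsto_sandwich[OF _ _ tendsto_const l1(1)])
             (auto intro!: always_eventually op_dist_nonneg[of _ n] Adj_mul t sL l)
      qed (use s t l Adj_mul in auto)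
      show "opmul l t \<in> Kc n"
      proof (rule Kc_limit[where s = "\<lambda>j. opmul (s j) t"])
        have "op_dist (opmul (s j) t) (opmul l t) \<le> op_dist (s j) l * op_norm t" for j
          using op_dist_mul[OF sL l t t] op_dist_self[OF t] by simp
        then show "(\<lambda>j. op_dist (opmul (s j) t) (opmul l t)) \<longlonglongrightarrow> 0"
          by (intro tendsto_sandwich[OF _ _ tendsto_const l1(2)])
             (auto intro!: always_eventually op_dist_nonneg[of _ n] Adj_mul t sL l)
      qed (use s t l Adj_mul in auto)
    qed
    then show "l \<in> ?B" using l by simp
  qed auto
  moreover have "rank_one n f g \<in> ?B" if "f \<in> CK" "g \<in> CK" for f g
    using that by (simp add: opmul_rank_one rank_one_Adj Kc_rank_one Adj_CK[of _ n] opstar_Adj)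
  ultimately have "Kc n \<subseteq> ?B" by (rule Kc_least)
  then show "opmul t s \<in> Kc n" "opmul s t \<in> Kc n" using assms by blast+
qed

text \<open>Words that lead to the same point are not distinguished by the kernel. The kernels of compact
  operators have this property, and the kernels of \<open>T \<otimes> I\<close> can lose it over images of branch points. The
  traces of branch points live on that difference.\<close>

definition fibre_inv where
  "fibre_inv n k \<longleftrightarrow> (\<forall>u\<in>W n. \<forall>u'\<in>W n. \<forall>w\<in>W n. \<forall>w'\<in>W n. \<forall>z.
     pt u z = pt u' z \<longrightarrow> pt w z = pt w' z \<longrightarrow> k u w z = (k u' w' z :: complex))"

text \<open>Rank one operators have such kernels, and the operations and limits preserve them.\<close>

lemma Kc_kern: assumes "t \<in> Kc n" shows "\<exists>k. kern n t k \<and> fibre_inv n k"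
proof -
  let ?B = "{t \<in> Adj n. \<exists>k. kern n t k \<and> fibre_inv n k}"
  have "closed_sub n ?B"
    unfolding closed_sub_def
  proof (intro conjI ballI allI impI)
    fix s t assume "s \<in> ?B" "t \<in> ?B"
    then obtain k l where k: "kern n s k" "fibre_inv n k" and l: "kern n t l" "fibre_inv n l" by blast
    have "fibre_inv n (\<lambda>u w z. k u w z + l u w z)"
      unfolding fibre_inv_def
    proof (intro ballI allI impI)
      fix u u' w w' z assume "u \<in> W n" "u' \<in> W n" "w \<in> W n" "w' \<in> W n" "pt u z = pt u' z" "pt w z = pt w' z"
      then show "k u w z + l u w z = k u' w' z + l u' w' z"
        using k(2) l(2) unfolding fibre_inv_def by metis
    qed
    then show "opadd s t \<in> ?B" using kern_add[OF k(1) l(1)] kern_Adj by blast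
    have "fibre_inv n (\<lambda>u w z. \<Sum>x\<in>W n. k u x z * l x w z)"
      unfolding fibre_inv_def
    proof (intro ballI allI impI)
      fix u u' w w' z assume a: "u \<in> W n" "u' \<in> W n" "w \<in> W n" "w' \<in> W n" "pt u z = pt u' z" "pt w z = pt w' z"
      have "k u x z * l x w z = k u' x z * l x w' z" if "x \<in> W n" for x
        using k(2) l(2) a that unfolding fibre_inv_def by metis
      then show "(\<Sum>x\<in>W n. k u x z * l x w z) = (\<Sum>x\<in>W n. k u' x z * l x w' z)" by simp
    qed
    then show "opmul s t \<in> ?B" using kern_mul[OF k(1) l(1)] kern_Adj by blast
  next
    fix c s assume "s \<in> ?B"
    then obtain k where k: "kern n s k" "fibre_inv n k" by blast
    have "fibre_inv n (\<lambda>u w z. c * k u w z)" using k(2) unfolding fibre_inv_def by metis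
    then show "opscale c s \<in> ?B" using kern_scale[OF k(1)] kern_Adj by blast
    have "fibre_inv n (\<lambda>u w z. cnj (k w u z))" using k(2) unfolding fibre_inv_def by metis
    then show "opstar s \<in> ?B" using kern_star[OF k(1)] kern_Adj by blast
  next
    fix s t assume t: "t \<in> Adj n" and s: "(\<forall>j. s j \<in> ?B) \<and> (\<lambda>j. op_dist (s j) t) \<longlonglongrightarrow> 0"
    then have "\<forall>j. \<exists>k. kern n (s j) k \<and> fibre_inv n k" by blast
    then obtain k where k: "\<And>j. kern n (s j) (k j)" "\<And>j. fibre_inv n (k j)" by metis
    obtain \<kappa> where \<kappa>: "kern n t \<kappa>" "\<And>u w z. u \<in> W n \<Longrightarrow> w \<in> W n \<Longrightarrow> (\<lambda>j. k j u w z) \<longlonglongrightarrow> \<kappa> u w z"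
      using kern_limit[OF k(1) t conjunct2[OF s]] by blast
    have "fibre_inv n \<kappa>" unfolding fibre_inv_def
    proof (intro ballI allI impI)
      fix u u' w w' z assume a: "u \<in> W n" "u' \<in> W n" "w \<in> W n" "w' \<in> W n" "pt u z = pt u' z" "pt w z = pt w' z"
      have "k j u w z = k j u' w' z" for j using k(2) a unfolding fibre_inv_def by metis
      then show "\<kappa> u w z = \<kappa> u' w' z"
        using \<kappa>(2)[OF a(1,3), of z] \<kappa>(2)[OF a(2,4), of z] LIMSEQ_unique by auto
    qed
    then show "t \<in> ?B" using \<kappa>(1) t by blast
  qed auto
  moreover have "rank_one n f g \<in> ?B" if "f \<in> CK" "g \<in> CK" for f g
    using kern_rank_one[OF that, of n] rank_one_Adj[OF that] by (auto simp: fibre_inv_def intro!: exI)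
  ultimately have "Kc n \<subseteq> ?B" by (rule Kc_least)
  then show ?thesis using assms by blast
qed

lemma opadd_zero: "a \<in> Adj m \<Longrightarrow> opadd a (opscale 0 t) = a"
  by (rule PiE_ext[of _ CK "\<lambda>_. CK"]) (auto simp: opadd_def opscale_def PiE_iff Adj_CK dest: Adj_ext)

lemma ex_Kc: "\<exists>t. t \<in> Kc n"
  using Kc_rank_one[of "\<lambda>_. 1" "\<lambda>_. 1"] by auto

text \<open>The algebra \<open>\<F>\<^sup>(\<^sup>n\<^sup>)\<close>. The embeddings \<open>T \<mapsto> T \<otimes> I\<close> leave operators on \<open>C(K)\<close> unchanged, so it
  is a plain sum of the compacts of the levels up to \<open>n\<close>.\<close>

primrec Fc where
  "Fc 0 = Kc 0"
| "Fc (Suc n) = {opadd a s | a s. a \<in> Fc n \<and> s \<in> Kc (Suc n)}"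

lemma Fc_Suc_mono: "Fc n \<subseteq> Adj n \<and> Fc n \<subseteq> Fc (Suc n)"
proof (induction n)
  case 0
  have "a \<in> Fc (Suc 0)" if "a \<in> Kc 0" for a
  proof -
    obtain t where t: "t \<in> Kc (Suc 0)" using ex_Kc by blast
    have "a = opadd a (opscale 0 t)" using opadd_zero Kc_Adj that by (metis subsetD)
    moreover have "opscale 0 t \<in> Kc (Suc 0)" using t by (rule Kc_scale)
    ultimately show ?thesis unfolding Fc.simps using that by blast
  qed
  then show ?case using Kc_Adj by auto
next
  case (Suc n)
  have L: "Fc (Suc n) \<subseteq> Adj (Suc n)"
  proof
    fix t assume "t \<in> Fc (Suc n)"
    then obtain a s where "t = opadd a s" "a \<in> Fc n" "s \<in> Kc (Suc n)" by auto
    then show "t \<in> Adj (Suc n)" using Suc Kc_Adj Adj_mono[of a n "Suc n"] by (auto intro!: Adj_add)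
  qed
  have "a \<in> Fc (Suc (Suc n))" if a: "a \<in> Fc (Suc n)" for a
  proof -
    obtain t where t: "t \<in> Kc (Suc (Suc n))" using ex_Kc by blast
    have "a = opadd a (opscale 0 t)" using opadd_zero L a by (metis subsetD)
    moreover have "opscale 0 t \<in> Kc (Suc (Suc n))" using t Kc_scale by blast
    ultimately show ?thesis unfolding Fc.simps(2)[of "Suc n"] using a by blast
  qed
  then show ?case using L by blast
qed

lemma Fc_Adj: "Fc n \<subseteq> Adj n" using Fc_Suc_mono by blast

lemma Fc_mono: "n \<le> m \<Longrightarrow> Fc n \<subseteq> Fc m"
  by (rule lift_Suc_mono_le[of Fc]) (use Fc_Suc_mono in blast)+

lemma Kc_Fc: "Kc n \<subseteq> Fc n"
proof (cases n)
  case (Suc m)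
  have "s \<in> Fc n" if s: "s \<in> Kc n" for s
  proof -
    obtain t where t: "t \<in> Kc 0" using ex_Kc by blast
    have "opscale 0 t \<in> Fc m" using Fc_mono[of 0 m] Kc_scale[OF t] by auto
    moreover have "s = opadd (opscale 0 t) s"
      by (rule PiE_ext[of _ CK "\<lambda>_. CK"]) (use Adj_ext[OF subsetD[OF Kc_Adj s]] in \<open>auto simp: opadd_def opscale_def PiE_iff\<close>)
    ultimately show ?thesis using s Suc by auto
  qed
  then show ?thesis by blast
qed simp

text \<open>A product of compacts of two levels is compact at the higher level, where both factors are
  adjointable and one of them is compact.\<close>

lemma Fc_closed:
  "s \<in> Fc n \<Longrightarrow> t \<in> Fc n \<Longrightarrow> opadd s t \<in> Fc n \<and> opmul s t \<in> Fc n \<and> opscale c s \<in> Fc n \<and> opstar s \<in> Fc n"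
proof (induction n arbitrary: s t)
  case 0
  then show ?case by (simp add: Kc_add Kc_mul Kc_scale Kc_star)
next
  case (Suc n)
  then obtain a x b y where
    s: "s = opadd a x" "a \<in> Fc n" "x \<in> Kc (Suc n)" and t: "t = opadd b y" "b \<in> Fc n" "y \<in> Kc (Suc n)"
    by auto
  note IH = Suc.IH[OF s(2) t(2)]
  have L: "a \<in> Adj (Suc n)" "b \<in> Adj (Suc n)" "x \<in> Adj (Suc n)" "y \<in> Adj (Suc n)"
    using Adj_mono[OF subsetD[OF Fc_Adj s(2)], of "Suc n"] Adj_mono[OF subsetD[OF Fc_Adj t(2)], of "Suc n"]
      subsetD[OF Kc_Adj s(3)] subsetD[OF Kc_Adj t(3)] by simp_all
  note C = Adj_CK[OF L(1)] Adj_CK[OF L(2)] Adj_CK[OF L(3)] Adj_CK[OF L(4)]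
  have add: "opadd s t = opadd (opadd a b) (opadd x y)"
    unfolding s t by (auto simp: opadd_def fun_eq_iff restrict_def)
  have scale: "opscale c s = opadd (opscale c a) (opscale c x)"
    unfolding s by (auto simp: opadd_def opscale_def fun_eq_iff restrict_def algebra_simps)
  have star: "opstar s = opadd (opstar a) (opstar x)"
    unfolding s by (rule opstar_add[OF L(1,3)])
  have mul: "opmul s t = opadd (opmul a b) (opadd (opadd (opmul a y) (opmul x b)) (opmul x y))"
    unfolding s t using C Adj_linear(1)[OF L(1)] Adj_linear(1)[OF L(3)]
    by (auto simp: opadd_def opmul_def fun_eq_iff restrict_def)
  have K: "opadd x y \<in> Kc (Suc n)" "opscale c x \<in> Kc (Suc n)" "opstar x \<in> Kc (Suc n)"
    "opadd (opadd (opmul a y) (opmul x b)) (opmul x y) \<in> Kc (Suc n)"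
    by (intro Kc_add Kc_scale Kc_star Kc_ideal(1)[OF t(3) L(1)] Kc_ideal(2)[OF s(3) L(2)] Kc_mul s t)+
  show ?case unfolding add scale star mul Fc.simps using IH K by blast
qed

end

section \<open>The matrix block of a branch point\<close>

text \<open>A branch point \<open>b\<close>, given through two letters \<open>p\<close> and \<open>q\<close> that lead to it from \<open>h b\<close>, and the
  number \<open>r\<close> of its trace.\<close>

locale branch_pair = self_similar_system N \<gamma> h
  for N :: nat and \<gamma> :: "nat \<Rightarrow> 'k::metric_space \<Rightarrow> 'k" and h :: "'k \<Rightarrow> 'k" +
  fixes b :: 'k and p q :: nat and r :: nat
  assumes p: "p \<in> {1..N}" and q: "q \<in> {1..N}" and pq: "p \<noteq> q"
    and gp: "\<gamma> p (h b) = b" and gq: "\<gamma> q (h b) = b"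
begin

text \<open>Kernels of level \<open>r + 1 + k\<close> are evaluated at the point \<open>fwd k\<close> of the forward orbit of \<open>b\<close>;
  the word \<open>back_word k\<close> leads from there to \<open>h b\<close>.\<close>

definition fwd :: "nat \<Rightarrow> 'k" where "fwd k = (h ^^ Suc k) b"

definition back_letter :: "nat \<Rightarrow> nat" where "back_letter k = (SOME j. j \<in> {1..N} \<and> \<gamma> j (fwd (Suc k)) = fwd k)"

primrec back_word :: "nat \<Rightarrow> nat list" where "back_word 0 = []" | "back_word (Suc k) = back_word k @ [back_letter k]"

lemma back_letter: "back_letter k \<in> {1..N}" "\<gamma> (back_letter k) (fwd (Suc k)) = fwd k"
proof -
  have "\<exists>j. j \<in> {1..N} \<and> \<gamma> j (fwd (Suc k)) = fwd k"
    using ex_letter[of "fwd k"] by (auto simp: fwd_def)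
  then have "back_letter k \<in> {1..N} \<and> \<gamma> (back_letter k) (fwd (Suc k)) = fwd k" unfolding back_letter_def by (rule someI_ex)
  then show "back_letter k \<in> {1..N}" "\<gamma> (back_letter k) (fwd (Suc k)) = fwd k" by auto
qed

lemma back_word: "back_word k \<in> W k" "pt (back_word k) (fwd k) = h b"
proof -
  have "back_word k \<in> W k \<and> pt (back_word k) (fwd k) = h b"
  proof (induction k)
    case (Suc k)
    then show ?case using words_snoc[OF _ back_letter(1)[of k]] back_letter(2)[of k] by simp
  qed (simp add: fwd_def)
  then show "back_word k \<in> W k" "pt (back_word k) (fwd k) = h b" by auto
qed

abbreviation "lev k \<equiv> Suc (r + k)"

definition "pword k w = w @ p # back_word k"
definition "qword k w = w @ q # back_word k"

lemma PQ_W: "w \<in> W r \<Longrightarrow> pword k w \<in> W (lev k)" "w \<in> W r \<Longrightarrow> qword k w \<in> W (lev k)"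
  using words_append[of w N r "p # back_word k" "Suc k"] words_append[of w N r "q # back_word k" "Suc k"] p q back_word[of k]
  by (auto simp: pword_def qword_def words_Cons_iff)

lemma PQ_pt: "pt (pword k w) (fwd k) = pt (qword k w) (fwd k)"
  by (simp add: pword_def qword_def back_word gp gq)

lemma PQ_eq: "w \<in> W r \<Longrightarrow> w' \<in> W r \<Longrightarrow> pword k w = pword k w' \<longleftrightarrow> w = w'"
  "w \<in> W r \<Longrightarrow> w' \<in> W r \<Longrightarrow> pword k w \<noteq> qword k w'"
  using pq by (auto simp: pword_def qword_def dest!: words_length)

text \<open>The vector \<open>e\<^sub>w\<close>: the difference of the unit vectors of two words that lead to the same
  point \<open>\<gamma>\<^sub>w(b)\<close>.\<close>

definition jump :: "nat \<Rightarrow> nat list \<Rightarrow> nat list \<Rightarrow> complex" where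
  "jump k w u = (if u = pword k w then 1 else 0) - (if u = qword k w then 1 else 0)"

lemma sum_jump: "w \<in> W r \<Longrightarrow> (\<Sum>x\<in>W (lev k). a x * jump k w x) = a (pword k w) - a (qword k w)"
proof -
  assume w: "w \<in> W r"
  have "(\<Sum>x\<in>W (lev k). a x * jump k w x) =
      (\<Sum>x\<in>W (lev k). if x = pword k w then a x else 0) - (\<Sum>x\<in>W (lev k). if x = qword k w then a x else 0)"
    unfolding sum_subtractf[symmetric] by (intro sum.cong refl) (auto simp: jump_def)
  then show ?thesis using PQ_W[OF w] by simp
qed

lemma jump_pword: "w \<in> W r \<Longrightarrow> w' \<in> W r \<Longrightarrow> jump k w' (pword k w) = (if w = w' then 1 else 0)"
  using PQ_eq by (simp add: jump_def)

text \<open>Over \<open>fwd k\<close> the matrix \<open>\<kappa>\<close> maps \<open>e\<^sub>w\<close> to \<open>\<Sum>\<^sub>w\<^sub>' m w' w e\<^sub>w\<^sub>'\<close>, and its transpose does the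
  same with the transpose of \<open>m\<close>. The second half makes the span of the \<open>e\<^sub>w\<close> reducing, so that the
  relation is stable under adjoints.\<close>

definition intertwines :: "nat \<Rightarrow> (nat list \<Rightarrow> nat list \<Rightarrow> 'k \<Rightarrow> complex) \<Rightarrow> (nat list \<Rightarrow> nat list \<Rightarrow> complex) \<Rightarrow> bool" where
  "intertwines k \<kappa> m \<longleftrightarrow> (\<forall>u\<in>W (lev k). \<forall>w\<in>W r.
      \<kappa> u (pword k w) (fwd k) - \<kappa> u (qword k w) (fwd k) = (\<Sum>w'\<in>W r. m w' w * jump k w' u) \<and>
      \<kappa> (pword k w) u (fwd k) - \<kappa> (qword k w) u (fwd k) = (\<Sum>w'\<in>W r. m w w' * jump k w' u))"

definition has_block :: "nat \<Rightarrow> 'k fop \<Rightarrow> (nat list \<Rightarrow> nat list \<Rightarrow> complex) \<Rightarrow> bool" where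
  "has_block k t m \<longleftrightarrow> (\<exists>\<kappa>. kern (lev k) t \<kappa> \<and> intertwines k \<kappa> m)"

lemma has_blockI:
  assumes "kern (lev k) t \<kappa>"
    and "\<And>u w. u \<in> W (lev k) \<Longrightarrow> w \<in> W r \<Longrightarrow> \<kappa> u (pword k w) (fwd k) - \<kappa> u (qword k w) (fwd k) = (\<Sum>w'\<in>W r. m w' w * jump k w' u)"
    and "\<And>u w. u \<in> W (lev k) \<Longrightarrow> w \<in> W r \<Longrightarrow> \<kappa> (pword k w) u (fwd k) - \<kappa> (qword k w) u (fwd k) = (\<Sum>w'\<in>W r. m w w' * jump k w' u)"
  shows "has_block k t m"
  using assms unfolding has_block_def intertwines_def by blast

lemma intertwinesD:
  assumes "intertwines k \<kappa> m" "u \<in> W (lev k)" "w \<in> W r"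
  shows "\<kappa> u (pword k w) (fwd k) - \<kappa> u (qword k w) (fwd k) = (\<Sum>w'\<in>W r. m w' w * jump k w' u)"
    and "\<kappa> (pword k w) u (fwd k) - \<kappa> (qword k w) u (fwd k) = (\<Sum>w'\<in>W r. m w w' * jump k w' u)"
  using assms unfolding intertwines_def by blast+

text \<open>The vectors \<open>e\<^sub>w\<close> are independent, since \<open>pword k w'\<close> occurs in \<open>e\<^sub>w\<^sub>'\<close> only. Hence the
  block is determined by the kernel.\<close>

lemma intertwines_value:
  assumes m: "intertwines k \<kappa> m" and w: "w \<in> W r" "w' \<in> W r"
  shows "m w' w = \<kappa> (pword k w') (pword k w) (fwd k) - \<kappa> (pword k w') (qword k w) (fwd k)"
proof -
  have "(\<Sum>x\<in>W r. m x w * jump k x (pword k w')) = (\<Sum>x\<in>W r. if x = w' then m x w else 0)"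
    by (intro sum.cong refl) (use w in \<open>auto simp: jump_pword\<close>)
  then show ?thesis using intertwinesD(1)[OF m PQ_W(1)[OF w(2)] w(1)] w by simp
qed

lemma block_unique:
  assumes "has_block k t m" "has_block k t m'" "w \<in> W r" "w' \<in> W r" shows "m w' w = m' w' w"
proof -
  obtain \<kappa> \<kappa>' where 1: "kern (lev k) t \<kappa>" "intertwines k \<kappa> m" and 2: "kern (lev k) t \<kappa>'" "intertwines k \<kappa>' m'"
    using assms(1,2) unfolding has_block_def by blast
  show ?thesis
    unfolding intertwines_value[OF 1(2) assms(3,4)] intertwines_value[OF 2(2) assms(3,4)]
    using kern_unique[OF 1(1) 2(1)] PQ_W assms(3,4) by simp
qed

text \<open>The letter that \<open>back_word\<close> gains leads from \<open>fwd (Suc k)\<close> to \<open>fwd k\<close>, and the diagonal block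
  of the amplified kernel that belongs to this letter is the old kernel.\<close>

lemma block_Suc: assumes "has_block k t m" shows "has_block (Suc k) t m"
proof -
  obtain \<kappa> where \<kappa>: "kern (lev k) t \<kappa>" "intertwines k \<kappa> m"
    using assms unfolding has_block_def by blast
  note eq = intertwinesD[OF \<kappa>(2)]
  have PS: "pword (Suc k) w = pword k w @ [back_letter k]" "qword (Suc k) w = qword k w @ [back_letter k]" for w
    by (simp_all add: pword_def qword_def)
  have k': "kern (lev (Suc k)) t (amp \<kappa>)" using kern_Suc[OF \<kappa>(1)] by simp
  show ?thesis
  proof (rule has_blockI)
    show "kern (lev (Suc k)) t (amp \<kappa>)" by (rule k')
    fix u w assume "u \<in> W (lev (Suc k))" and w: "w \<in> W r"
    then obtain u' i where u: "u' \<in> W (lev k)" "i \<in> {1..N}" "u = u' @ [i]"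
      using words_snocE[of u N "lev k"] by auto
    have E': "jump (Suc k) w' (u' @ [i]) = (if i = back_letter k then jump k w' u' else 0)" for w'
      by (simp add: jump_def PS)
    show "amp \<kappa> u (pword (Suc k) w) (fwd (Suc k)) - amp \<kappa> u (qword (Suc k) w) (fwd (Suc k)) = (\<Sum>w'\<in>W r. m w' w * jump (Suc k) w' u)"
      unfolding u(3) E' using eq[OF u(1) w] back_letter(2)[of k] by (cases "i = back_letter k") (simp_all add: PS amp_snoc)
    show "amp \<kappa> (pword (Suc k) w) u (fwd (Suc k)) - amp \<kappa> (qword (Suc k) w) u (fwd (Suc k)) = (\<Sum>w'\<in>W r. m w w' * jump (Suc k) w' u)"
      unfolding u(3) E' using eq[OF u(1) w] back_letter(2)[of k] by (cases "i = back_letter k") (simp_all add: PS amp_snoc)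
  qed
qed

lemma block_mono: "has_block k t m \<Longrightarrow> k \<le> l \<Longrightarrow> has_block l t m"
  by (induction l) (auto simp: le_Suc_eq block_Suc)

lemma block_add: assumes "has_block k t m" "has_block k s m'" shows "has_block k (opadd t s) (\<lambda>u w. m u w + m' u w)"
proof -
  obtain \<kappa> where \<kappa>: "kern (lev k) t \<kappa>" "intertwines k \<kappa> m"
    using assms(1) unfolding has_block_def by blast
  note eq = intertwinesD[OF \<kappa>(2)]
  obtain \<kappa>' where \<kappa>': "kern (lev k) s \<kappa>'" "intertwines k \<kappa>' m'"
    using assms(2) unfolding has_block_def by blast
  note eq' = intertwinesD[OF \<kappa>'(2)]
  show ?thesis
  proof (rule has_blockI)
    show "kern (lev k) (opadd t s) (\<lambda>u w z. \<kappa> u w z + \<kappa>' u w z)" by (rule kern_add[OF \<kappa>(1) \<kappa>'(1)])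
    fix u w assume "u \<in> W (lev k)" "w \<in> W r"
    from eq[OF this] eq'[OF this]
    show "\<kappa> u (pword k w) (fwd k) + \<kappa>' u (pword k w) (fwd k) - (\<kappa> u (qword k w) (fwd k) + \<kappa>' u (qword k w) (fwd k)) = (\<Sum>w'\<in>W r. (m w' w + m' w' w) * jump k w' u)"
      and "\<kappa> (pword k w) u (fwd k) + \<kappa>' (pword k w) u (fwd k) - (\<kappa> (qword k w) u (fwd k) + \<kappa>' (qword k w) u (fwd k)) = (\<Sum>w'\<in>W r. (m w w' + m' w w') * jump k w' u)"
      by (simp_all add: distrib_right sum.distrib add_diff_add)
  qed
qed

lemma block_scale: assumes "has_block k t m" shows "has_block k (opscale c t) (\<lambda>u w. c * m u w)"
proof -
  obtain \<kappa> where \<kappa>: "kern (lev k) t \<kappa>" "intertwines k \<kappa> m"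
    using assms(1) unfolding has_block_def by blast
  note eq = intertwinesD[OF \<kappa>(2)]
  show ?thesis
  proof (rule has_blockI)
    show "kern (lev k) (opscale c t) (\<lambda>u w z. c * \<kappa> u w z)" by (rule kern_scale[OF \<kappa>(1)])
    fix u w assume "u \<in> W (lev k)" "w \<in> W r"
    from eq[OF this]
    show "c * \<kappa> u (pword k w) (fwd k) - c * \<kappa> u (qword k w) (fwd k) = (\<Sum>w'\<in>W r. (c * m w' w) * jump k w' u)"
      and "c * \<kappa> (pword k w) u (fwd k) - c * \<kappa> (qword k w) u (fwd k) = (\<Sum>w'\<in>W r. (c * m w w') * jump k w' u)"
      by (simp_all add: right_diff_distrib[symmetric] sum_distrib_left mult.assoc)
  qed
qed

lemma cnj_jump: "cnj (jump k w u) = jump k w u" by (simp add: jump_def)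

lemma block_star: assumes "has_block k t m" shows "has_block k (opstar t) (\<lambda>u w. cnj (m w u))"
proof -
  obtain \<kappa> where \<kappa>: "kern (lev k) t \<kappa>" "intertwines k \<kappa> m"
    using assms(1) unfolding has_block_def by blast
  note eq = intertwinesD[OF \<kappa>(2)]
  show ?thesis
  proof (rule has_blockI)
    show "kern (lev k) (opstar t) (\<lambda>u w z. cnj (\<kappa> w u z))" by (rule kern_star[OF \<kappa>(1)])
    fix u w assume "u \<in> W (lev k)" "w \<in> W r"
    from eq[OF this]
    show "cnj (\<kappa> (pword k w) u (fwd k)) - cnj (\<kappa> (qword k w) u (fwd k)) = (\<Sum>w'\<in>W r. cnj (m w w') * jump k w' u)"
      and "cnj (\<kappa> u (pword k w) (fwd k)) - cnj (\<kappa> u (qword k w) (fwd k)) = (\<Sum>w'\<in>W r. cnj (m w' w) * jump k w' u)"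
      by (simp_all add: complex_cnj_diff[symmetric] cnj_jump del: complex_cnj_diff)
  qed
qed

text \<open>Restriction to a reducing subspace is multiplicative: \<open>\<kappa> \<kappa>' e = \<kappa> e m' = e m m'\<close>.\<close>

lemma block_mul:
  assumes "has_block k t m" "has_block k s m'" shows "has_block k (opmul t s) (\<lambda>u w. \<Sum>x\<in>W r. m u x * m' x w)"
proof -
  obtain \<kappa> where \<kappa>: "kern (lev k) t \<kappa>" "intertwines k \<kappa> m"
    using assms(1) unfolding has_block_def by blast
  note eq = intertwinesD[OF \<kappa>(2)]
  obtain \<kappa>' where \<kappa>': "kern (lev k) s \<kappa>'" "intertwines k \<kappa>' m'"
    using assms(2) unfolding has_block_def by blast
  note eq' = intertwinesD[OF \<kappa>'(2)]
  show ?thesis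
  proof (rule has_blockI)
    show "kern (lev k) (opmul t s) (\<lambda>u w z. \<Sum>x\<in>W (lev k). \<kappa> u x z * \<kappa>' x w z)" by (rule kern_mul[OF \<kappa>(1) \<kappa>'(1)])
    fix u w assume u: "u \<in> W (lev k)" and w: "w \<in> W r"
    let ?z = "fwd k"
    have "(\<Sum>x\<in>W (lev k). \<kappa> u x ?z * \<kappa>' x (pword k w) ?z) - (\<Sum>x\<in>W (lev k). \<kappa> u x ?z * \<kappa>' x (qword k w) ?z)
        = (\<Sum>x\<in>W (lev k). \<kappa> u x ?z * (\<Sum>w'\<in>W r. m' w' w * jump k w' x))"
      unfolding sum_subtractf[symmetric] right_diff_distrib[symmetric]
      using eq' w by (intro sum.cong refl) simp
    also have "\<dots> = (\<Sum>w'\<in>W r. m' w' w * (\<Sum>x\<in>W (lev k). \<kappa> u x ?z * jump k w' x))"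
      unfolding sum_distrib_left by (subst sum.swap) (simp add: mult_ac)
    also have "\<dots> = (\<Sum>w'\<in>W r. m' w' w * (\<Sum>x\<in>W r. m x w' * jump k x u))"
      using eq u by (intro sum.cong refl) (simp add: sum_jump)
    also have "\<dots> = (\<Sum>x\<in>W r. (\<Sum>w'\<in>W r. m x w' * m' w' w) * jump k x u)"
      unfolding sum_distrib_left sum_distrib_right by (subst sum.swap) (simp add: mult_ac)
    finally show "(\<Sum>x\<in>W (lev k). \<kappa> u x ?z * \<kappa>' x (pword k w) ?z) - (\<Sum>x\<in>W (lev k). \<kappa> u x ?z * \<kappa>' x (qword k w) ?z)
        = (\<Sum>x\<in>W r. (\<Sum>w'\<in>W r. m x w' * m' w' w) * jump k x u)" .
    have "(\<Sum>x\<in>W (lev k). \<kappa> (pword k w) x ?z * \<kappa>' x u ?z) - (\<Sum>x\<in>W (lev k). \<kappa> (qword k w) x ?z * \<kappa>' x u ?z)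
        = (\<Sum>x\<in>W (lev k). (\<Sum>w'\<in>W r. m w w' * jump k w' x) * \<kappa>' x u ?z)"
      unfolding sum_subtractf[symmetric] left_diff_distrib[symmetric]
      using eq w by (intro sum.cong refl) simp
    also have "\<dots> = (\<Sum>w'\<in>W r. m w w' * (\<Sum>x\<in>W (lev k). \<kappa>' x u ?z * jump k w' x))"
      unfolding sum_distrib_left sum_distrib_right by (subst sum.swap) (simp add: mult_ac)
    also have "\<dots> = (\<Sum>w'\<in>W r. m w w' * (\<Sum>x\<in>W r. m' w' x * jump k x u))"
      using eq' u by (intro sum.cong refl) (simp add: sum_jump)
    also have "\<dots> = (\<Sum>x\<in>W r. (\<Sum>w'\<in>W r. m w w' * m' w' x) * jump k x u)"
      unfolding sum_distrib_left sum_distrib_right by (subst sum.swap) (simp add: mult_ac)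
    finally show "(\<Sum>x\<in>W (lev k). \<kappa> (pword k w) x ?z * \<kappa>' x u ?z) - (\<Sum>x\<in>W (lev k). \<kappa> (qword k w) x ?z * \<kappa>' x u ?z)
        = (\<Sum>x\<in>W r. (\<Sum>w'\<in>W r. m w w' * m' w' x) * jump k x u)" .
  qed
qed

text \<open>The words \<open>pword k w\<close> and \<open>qword k w\<close> lead to the same point, so the kernel of a compact operator
  of this level kills \<open>e\<^sub>w\<close>.\<close>

lemma block_high:
  assumes t: "t \<in> Kc (lev k)" shows "has_block k t (\<lambda>_ _. 0)"
proof -
  obtain \<kappa> where \<kappa>: "kern (lev k) t \<kappa>" "fibre_inv (lev k) \<kappa>" using Kc_kern[OF t] by blast
  have "\<kappa> u (pword k w) (fwd k) = \<kappa> u (qword k w) (fwd k)" "\<kappa> (pword k w) u (fwd k) = \<kappa> (qword k w) u (fwd k)"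
    if "u \<in> W (lev k)" "w \<in> W r" for u w
    using \<kappa>(2) that PQ_W PQ_pt unfolding fibre_inv_def by blast+
  then show ?thesis by (intro has_blockI[OF \<kappa>(1)]) simp_all
qed

text \<open>A kernel of level \<open>r\<close>, amplified once, is block diagonal in the last letter. Over \<open>h b\<close> the blocks
  of the letters \<open>p\<close> and \<open>q\<close> are both the old kernel over \<open>b\<close>.\<close>

lemma block_low:
  assumes k: "kern r t \<kappa>" shows "has_block 0 t (\<lambda>u w. \<kappa> u w b)"
proof (rule has_blockI)
  show "kern (lev 0) t (amp \<kappa>)" using kern_Suc[OF k] by simp
  fix u w assume "u \<in> W (lev 0)" and w: "w \<in> W r"
  then obtain u' i where u: "u' \<in> W r" "i \<in> {1..N}" "u = u' @ [i]"
    using words_snocE[of u N r] by auto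
  have z: "\<gamma> p (fwd 0) = b" "\<gamma> q (fwd 0) = b" by (simp_all add: fwd_def gp gq)
  have PQ0: "pword 0 w = w @ [p]" "qword 0 w = w @ [q]" for w by (simp_all add: pword_def qword_def)
  have E0: "jump 0 w' u = (if u' = w' then (if i = p then 1 else 0) - (if i = q then 1 else 0) else 0)" for w'
    by (simp add: jump_def PQ0 u)
  have S: "(\<Sum>w'\<in>W r. a w' * jump 0 w' u) = a u' * ((if i = p then 1 else 0) - (if i = q then 1 else 0))" for a
    using u(1) by (simp add: E0 if_distrib[of "\<lambda>x. _ * x"] cong: if_cong)
  show "amp \<kappa> u (pword 0 w) (fwd 0) - amp \<kappa> u (qword 0 w) (fwd 0) = (\<Sum>w'\<in>W r. \<kappa> w' w b * jump 0 w' u)"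
    unfolding S using z by (auto simp: PQ0 u amp_snoc)
  show "amp \<kappa> (pword 0 w) u (fwd 0) - amp \<kappa> (qword 0 w) u (fwd 0) = (\<Sum>w'\<in>W r. \<kappa> w w' b * jump 0 w' u)"
    unfolding S using z by (auto simp: PQ0 u amp_snoc)
qed

text \<open>Amplification repeats a kernel along the fibre, so its traces add up over the fibre.\<close>

lemma kern_mono: "kern n t k \<Longrightarrow> n \<le> m \<Longrightarrow> \<exists>k'. kern m t k' \<and>
    (\<forall>z. (\<Sum>w\<in>W m. k' w w z) = (\<Sum>v\<in>W (m - n). \<Sum>w\<in>W n. k w w (pt v z)))"
proof (induction m)
  case (Suc m)
  show ?case
  proof (cases "n = Suc m")
    case False
    then have nm: "n \<le> m" using Suc by simp
    then obtain k' where k': "kern m t k'"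
      "\<And>z. (\<Sum>w\<in>W m. k' w w z) = (\<Sum>v\<in>W (m - n). \<Sum>w\<in>W n. k w w (pt v z))"
      using Suc by blast
    have "(\<Sum>w\<in>W (Suc m). amp k' w w z) = (\<Sum>v\<in>W (Suc m - n). \<Sum>w\<in>W n. k w w (pt v z))" for z
      using nm by (simp add: sum_words_snoc amp_snoc k'(2) Suc_diff_le)
    then show ?thesis using kern_Suc[OF k'(1)] by blast
  qed (use Suc.prems in auto)
qed auto

text \<open>An element of \<open>\<F>\<^sup>(\<^sup>n\<^sup>)\<close> is a sum of compacts; those of level at most \<open>r\<close> get their block from
  \<open>block_low\<close>, the others from \<open>block_high\<close>.\<close>

lemma block_exists: "t \<in> Fc n \<Longrightarrow> \<exists>k m. has_block k t m"
proof -
  have K: "\<exists>k m. has_block k t m" if t: "t \<in> Kc n" for t n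
  proof (cases "n \<le> r")
    case True
    obtain k where "kern n t k" using Kc_kern[OF t] by blast
    then obtain k' where "kern r t k'" using kern_mono[OF _ True] by blast
    then show ?thesis using block_low by blast
  next
    case False
    then have "n = lev (n - Suc r)" by simp
    then show ?thesis using block_high[of t "n - Suc r"] t by metis
  qed
  show "t \<in> Fc n \<Longrightarrow> \<exists>k m. has_block k t m"
  proof (induction n arbitrary: t)
    case (Suc n)
    then obtain a s where t: "t = opadd a s" "a \<in> Fc n" "s \<in> Kc (Suc n)" by auto
    obtain k m where "has_block k a m" using Suc.IH t by blast
    moreover obtain l m' where "has_block l s m'" using K t by blast
    ultimately have "has_block (max k l) a m" "has_block (max k l) s m'" using block_mono by auto
    then show ?case unfolding t(1) using block_add by blast
  qed (use K in auto)
qed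

definition normalized_trace :: "(nat list \<Rightarrow> nat list \<Rightarrow> complex) \<Rightarrow> complex" where
  "normalized_trace m = (\<Sum>w\<in>W r. m w w) / of_nat N ^ r"

text \<open>The level \<open>k\<close> is quantified away, since the block does not change when \<open>k\<close> grows.\<close>

definition branch_trace :: "'k fop \<Rightarrow> complex" where
  "branch_trace t = (THE c. \<exists>k m. has_block k t m \<and> c = normalized_trace m)"

lemma branch_trace_eq: assumes "has_block k t m" shows "branch_trace t = normalized_trace m"
  unfolding branch_trace_def
proof (rule the_equality)
  show "\<exists>k m'. has_block k t m' \<and> normalized_trace m = normalized_trace m'" using assms by blast
  fix c assume "\<exists>k m. has_block k t m \<and> c = normalized_trace m"
  then obtain l m' where s: "has_block l t m'" "c = normalized_trace m'" by blast
  have "has_block (max k l) t m" "has_block (max k l) t m'" using assms s block_mono by auto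
  then show "c = normalized_trace m" unfolding s(2) normalized_trace_def using block_unique
    by (intro arg_cong[of _ _ "\<lambda>x. x / _"] sum.cong refl) blast
qed

lemma block_pair:
  assumes "t \<in> Fc n" "s \<in> Fc l" obtains k m m' where "has_block k t m" "has_block k s m'"
proof -
  obtain k m where 1: "has_block k t m" using block_exists assms by blast
  obtain l m' where 2: "has_block l s m'" using block_exists assms by blast
  show ?thesis using that block_mono[OF 1, of "max k l"] block_mono[OF 2, of "max k l"] by simp
qed

lemma branch_trace_add: assumes "t \<in> Fc n" "s \<in> Fc l" shows "branch_trace (opadd t s) = branch_trace t + branch_trace s"
proof -
  obtain k m m' where s: "has_block k t m" "has_block k s m'" by (rule block_pair[OF assms])
  show ?thesis unfolding branch_trace_eq[OF block_add[OF s]] branch_trace_eq[OF s(1)] branch_trace_eq[OF s(2)]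
    by (simp add: normalized_trace_def sum.distrib add_divide_distrib)
qed

lemma branch_trace_scale: assumes "t \<in> Fc n" shows "branch_trace (opscale c t) = c * branch_trace t"
proof -
  obtain k m where s: "has_block k t m" using block_exists assms by blast
  show ?thesis unfolding branch_trace_eq[OF block_scale[OF s]] branch_trace_eq[OF s]
    by (simp add: normalized_trace_def sum_distrib_left)
qed

lemma branch_trace_mul: assumes "t \<in> Fc n" "s \<in> Fc l" shows "branch_trace (opmul t s) = branch_trace (opmul s t)"
proof -
  obtain k m m' where s: "has_block k t m" "has_block k s m'" by (rule block_pair[OF assms])
  show ?thesis unfolding branch_trace_eq[OF block_mul[OF s]] branch_trace_eq[OF block_mul[OF s(2,1)]] normalized_trace_def
    by (subst sum.swap) (simp add: mult.commute)
qed

lemma branch_trace_pos: assumes "t \<in> Fc n" shows "branch_trace (opmul (opstar t) t) \<in> \<real>\<^sub>\<ge>\<^sub>0"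
proof -
  obtain k m where s: "has_block k t m" using block_exists assms by blast
  have "(\<Sum>w\<in>W r. \<Sum>x\<in>W r. cnj (m x w) * m x w) = complex_of_real (\<Sum>w\<in>W r. \<Sum>x\<in>W r. (cmod (m x w))\<^sup>2)"
    unfolding of_real_sum by (intro sum.cong refl) (metis complex_norm_square mult.commute)
  then have "branch_trace (opmul (opstar t) t) = complex_of_real ((\<Sum>w\<in>W r. \<Sum>x\<in>W r. (cmod (m x w))\<^sup>2) / real N ^ r)"
    unfolding branch_trace_eq[OF block_mul[OF block_star[OF s] s]] normalized_trace_def by simp
  then show ?thesis by (simp only: nonneg_Reals_of_real_iff) (intro divide_nonneg_nonneg sum_nonneg, auto)
qed

lemma branch_trace_bound: assumes t: "t \<in> Fc n" shows "cmod (branch_trace t) \<le> 2 * op_norm t"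
proof -
  obtain k m where s: "has_block k t m" using block_exists assms by blast
  obtain \<kappa> where \<kappa>: "kern (lev k) t \<kappa>" "intertwines k \<kappa> m"
    using s unfolding has_block_def by blast
  have o: "op_norm t \<ge> 0" using op_norm_nonneg[OF kern_Adj[OF \<kappa>(1)]] .
  have "cmod (m w w) \<le> 2 * op_norm t" if w: "w \<in> W r" for w
    unfolding intertwines_value[OF \<kappa>(2) w w]
    using norm_triangle_ineq4[of "\<kappa> (pword k w) (pword k w) (fwd k)" "\<kappa> (pword k w) (qword k w) (fwd k)"]
      kern_entry_bound[OF \<kappa>(1) PQ_W(1)[OF w] PQ_W(1)[OF w], of "fwd k"]
      kern_entry_bound[OF \<kappa>(1) PQ_W(1)[OF w] PQ_W(2)[OF w], of "fwd k"] by linarith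
  then have "cmod (\<Sum>w\<in>W r. m w w) \<le> (\<Sum>w\<in>W r. 2 * op_norm t)"
    by (intro sum_norm_le) auto
  then have "cmod (\<Sum>w\<in>W r. m w w) \<le> real N ^ r * (2 * op_norm t)" by (simp add: card_words)
  then show ?thesis unfolding branch_trace_eq[OF s] normalized_trace_def using N2
    by (simp add: norm_divide norm_power field_simps)
qed

lemma branch_trace_high: "t \<in> Kc n \<Longrightarrow> n > r \<Longrightarrow> branch_trace t = 0"
  using branch_trace_eq[OF block_high[of t "n - Suc r"]] by (simp add: normalized_trace_def)

lemma branch_trace_rank_one:
  assumes "i \<le> r" "f \<in> CK" "g \<in> CK"
  shows "branch_trace (rank_one i f g) = (\<Sum>v\<in>W (r - i). ip i g f (pt v b)) / of_nat N ^ r"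
proof -
  obtain k' where k': "kern r (rank_one i f g) k'"
    "\<And>z. (\<Sum>w\<in>W r. k' w w z) = (\<Sum>v\<in>W (r - i). \<Sum>w\<in>W i. f (pt w (pt v z)) * cnj (g (pt w (pt v z))))"
    using kern_mono[OF kern_rank_one[OF assms(2,3)] assms(1)] by blast
  show ?thesis unfolding branch_trace_eq[OF block_low[OF k'(1)]] normalized_trace_def k'(2)
    by (simp add: ip_def mult.commute)
qed

end

lemma uniform_limit_mult_bounded:
  fixes f :: "nat \<Rightarrow> 'a \<Rightarrow> complex"
  assumes "uniform_limit UNIV f l sequentially" "\<And>x. cmod (g x) \<le> B"
  shows "uniform_limit UNIV (\<lambda>k x. f k x * g x) (\<lambda>x. l x * g x) sequentially"
  unfolding uniform_limit_iff
proof (intro allI impI)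
  fix e :: real assume e: "e > 0"
  have B: "B \<ge> 0" using assms(2)[of undefined] norm_ge_zero order_trans by blast
  then have "e / (B + 1) > 0" using e by simp
  then have "\<forall>\<^sub>F k in sequentially. \<forall>x\<in>UNIV. dist (f k x) (l x) < e / (B + 1)"
    using assms(1) unfolding uniform_limit_iff by blast
  then show "\<forall>\<^sub>F k in sequentially. \<forall>x\<in>UNIV. dist (f k x * g x) (l x * g x) < e"
  proof (rule eventually_mono, intro ballI)
    fix k x assume "\<forall>x\<in>UNIV. dist (f k x) (l x) < e / (B + 1)"
    then have d: "dist (f k x) (l x) < e / (B + 1)" by blast
    have "dist (f k x * g x) (l x * g x) = dist (f k x) (l x) * cmod (g x)"
      by (simp add: dist_norm norm_mult[symmetric] left_diff_distrib)
    also have "\<dots> \<le> dist (f k x) (l x) * (B + 1)"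
      using assms(2)[of x] by (intro mult_left_mono) auto
    also have "\<dots> < e / (B + 1) * (B + 1)" using d B by (intro mult_strict_right_mono) auto
    finally show "dist (f k x * g x) (l x * g x) < e" using B by simp
  qed
qed

context self_similar_system begin

section \<open>Tensor powers are copies of \<open>C(K)\<close>\<close>

abbreviation "TA n \<equiv> alg_tensor N \<gamma> n"
abbreviation "TP n \<equiv> tensor_pow N \<gamma> n"

text \<open>The function on \<open>K\<close> that an elementary tensor \<open>x\<^sub>1 \<otimes> \<cdots> \<otimes> x\<^sub>n\<close> amounts to: the product of
  the \<open>x\<^sub>i\<close> along the forward orbit of \<open>t\<close>.\<close>

primrec path_val :: "('k \<times> 'k \<Rightarrow> complex) list \<Rightarrow> 'k \<Rightarrow> complex" where
  "path_val [] t = 1"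
| "path_val (x # xs) t = x (t, h t) * path_val xs (h t)"

definition tensor_val :: "nat \<Rightarrow> 'k tensor \<Rightarrow> 'k \<Rightarrow> complex" where
  "tensor_val n u x = (\<Sum>(xs, a)\<leftarrow>u. path_val xs x * a ((h ^^ n) x))"

lemma tensor_val_Nil: "tensor_val n [] = (\<lambda>_. 0)"
  and tensor_val_Cons: "tensor_val n ((xs, a) # u) = (\<lambda>x. path_val xs x * a ((h ^^ n) x) + tensor_val n u x)"
  and tensor_val_append: "tensor_val n (u @ v) = (\<lambda>x. tensor_val n u x + tensor_val n v x)"
  by (auto simp: tensor_val_def)

lemma tensor_val_act: "tensor_val n (map (\<lambda>(xs, a). (xs, \<lambda>y. a y * b y)) u) = (\<lambda>x. tensor_val n u x * b ((h ^^ n) x))"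
  by (induction u) (auto simp: tensor_val_Nil tensor_val_Cons algebra_simps)

lemma in_cograph: "(x, h x) \<in> cograph N \<gamma>"
  using ex_letter[of x] by (auto simp: cograph_def)

lemma X_graph_CK: "f \<in> X_carrier N \<gamma> \<Longrightarrow> (\<lambda>x. f (x, h x)) \<in> CK"
  unfolding X_carrier_def CK_def
  by (auto intro!: continuous_on_compose2[of "cograph N \<gamma>" f] continuous_intros cont_h in_cograph)

lemma path_val_CK: "set xs \<subseteq> X_carrier N \<gamma> \<Longrightarrow> path_val xs \<in> CK"
proof (induction xs)
  case (Cons x xs)
  have "(\<lambda>t. x (t, h t) * path_val xs (h t)) \<in> CK"
    using Cons by (intro CK_mult X_graph_CK CK_comp[OF _ cont_h]) auto
  then show ?case by (simp add: path_val.simps(2)[abs_def] fun_eq_iff[symmetric])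
qed (simp add: path_val.simps(1)[abs_def])

lemma TA_carrier: "u \<in> hcarrier (TA n) \<longleftrightarrow>
    (\<forall>(xs, a)\<in>set u. length xs = n \<and> set xs \<subseteq> X_carrier N \<gamma> \<and> a \<in> CK)"
  by (simp add: alg_tensor_def)

lemma tensor_val_CK: "u \<in> hcarrier (TA n) \<Longrightarrow> tensor_val n u \<in> CK"
proof (induction u)
  case (Cons p u)
  obtain xs a where [simp]: "p = (xs, a)" by (cases p)
  show ?case unfolding \<open>p = (xs, a)\<close> tensor_val_Cons
    using Cons by (intro CK_add CK_mod path_val_CK) (auto simp: TA_carrier)
qed (simp add: tensor_val_Nil)

text \<open>Each step of the recursion sums over the first letter of the words \<open>w\<close>.\<close>

lemma elem_ip_eq:
  "length xs = length ys \<Longrightarrow> elem_ip N \<gamma> c xs ys z =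
    (\<Sum>w\<in>W (length ys). c (pt w z) * cnj (path_val xs (pt w z)) * path_val ys (pt w z))"
proof (induction xs ys arbitrary: c rule: list_induct2)
  case (Cons x xs y ys)
  have "elem_ip N \<gamma> c (x # xs) (y # ys) z = (\<Sum>w\<in>W (length ys).
      X_ip N \<gamma> x (X_lact c y) (pt w z) * cnj (path_val xs (pt w z)) * path_val ys (pt w z))"
    by (simp add: Cons.IH)
  also have "\<dots> = (\<Sum>w\<in>W (length ys). \<Sum>j\<in>{1..N}.
      c (\<gamma> j (pt w z)) * cnj (path_val (x # xs) (\<gamma> j (pt w z))) * path_val (y # ys) (\<gamma> j (pt w z)))"
    unfolding X_ip_def sum_distrib_right
    by (intro sum.cong refl) (simp add: X_lact_def h_gamma)
  finally show ?case by (simp add: sum_words_Cons)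
qed simp

lemma tensor_ip_eq:
  assumes "u \<in> hcarrier (TA n)" "v \<in> hcarrier (TA n)"
  shows "tensor_ip N \<gamma> u v z = ip n (tensor_val n u) (tensor_val n v) z"
proof -
  have z: "ip n f (\<lambda>_. 0) z = 0" "ip n (\<lambda>_. 0) f z = 0" for f by (simp_all add: ip_def)
  have 1: "(\<Sum>(ys, b)\<leftarrow>v. cnj (a z) * elem_ip N \<gamma> (\<lambda>_. 1) xs ys z * b z) =
      ip n (\<lambda>x. path_val xs x * a ((h ^^ n) x)) (tensor_val n v) z" if "length xs = n" for xs a
    using assms(2)
  proof (induction v)
    case (Cons p v)
    obtain ys b where p: "p = (ys, b)" by (cases p)
    then have l: "length ys = n" and v: "v \<in> hcarrier (TA n)" using Cons.prems by (auto simp: TA_carrier)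
    have "cnj (a z) * elem_ip N \<gamma> (\<lambda>_. 1) xs ys z * b z =
        ip n (\<lambda>x. path_val xs x * a ((h ^^ n) x)) (\<lambda>x. path_val ys x * b ((h ^^ n) x)) z"
      using l that by (simp add: elem_ip_eq ip_mod_left ip_mod_right) (simp add: ip_def)
    then show ?case using Cons.IH[OF v] by (simp add: p tensor_val_Cons ip_add_right)
  qed (simp add: tensor_val_Nil z)
  show ?thesis
    using assms(1)
  proof (induction u)
    case (Cons p u)
    obtain xs a where p: "p = (xs, a)" by (cases p)
    then have l: "length xs = n" and u: "u \<in> hcarrier (TA n)" using Cons.prems by (auto simp: TA_carrier)
    then show ?case using Cons.IH[OF u] 1[OF l, of a] by (simp add: p tensor_val_Cons ip_add_left tensor_ip_def)
  qed (simp add: tensor_ip_def tensor_val_Nil z)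
qed

definition nrm :: "nat \<Rightarrow> ('k \<Rightarrow> complex) \<Rightarrow> real" where
  "nrm n f = sqrt (sup_norm (ip n f f))"

lemma sup_norm_ip: "sup_norm (ip n f f) = (SUP z. fsq n f z)"
  by (simp add: sup_norm_def ip_self fsq_nonneg)

lemma bdd_fsq: assumes "f \<in> CK" shows "bdd_above (range (fsq n f))"
proof -
  obtain B where "\<And>x. cmod (f x) \<le> B" using CK_bounded[OF assms] by blast
  then show ?thesis by (intro bdd_aboveI2[of _ _ "real (N ^ n) * B\<^sup>2"] fsq_le)
qed

lemma sup_fsq_nonneg: "f \<in> CK \<Longrightarrow> 0 \<le> (SUP z. fsq n f z)"
  by (rule cSUP_upper2[OF bdd_fsq, of _ undefined]) (auto simp: fsq_nonneg)

lemma fsq_le_nrm: assumes "f \<in> CK" shows "fsq n f z \<le> (nrm n f)\<^sup>2"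
  unfolding nrm_def sup_norm_ip using cSUP_upper[OF UNIV_I bdd_fsq[OF assms, of n], of z] sup_fsq_nonneg[OF assms]
  by simp

lemma nrm_nonneg: "f \<in> CK \<Longrightarrow> 0 \<le> nrm n f"
  unfolding nrm_def sup_norm_ip by (simp add: sup_fsq_nonneg)

lemma nrm_le: assumes "0 \<le> c" "\<And>z. fsq n f z \<le> c\<^sup>2" shows "nrm n f \<le> c"
  unfolding nrm_def sup_norm_ip
  by (rule real_le_lsqrt) (use assms in \<open>auto intro!: cSUP_least\<close>)

lemma sqrt_fsq_nrm: "f \<in> CK \<Longrightarrow> sqrt (fsq n f z) \<le> nrm n f"
  by (rule real_le_lsqrt) (auto simp: fsq_le_nrm nrm_nonneg)

lemma nrm_triangle: assumes "f \<in> CK" "g \<in> CK" shows "nrm n (\<lambda>x. f x + g x) \<le> nrm n f + nrm n g"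
proof (rule nrm_le)
  show "0 \<le> nrm n f + nrm n g" using assms by (simp add: nrm_nonneg)
  fix z
  have "sqrt (fsq n (\<lambda>x. f x + g x) z) \<le> nrm n f + nrm n g"
    using fsq_triangle[of n f g z] sqrt_fsq_nrm[OF assms(1), of n z] sqrt_fsq_nrm[OF assms(2), of n z] by linarith
  then show "fsq n (\<lambda>x. f x + g x) z \<le> (nrm n f + nrm n g)\<^sup>2"
    by (rule sqrt_le_D)
qed

lemma le_nrm: assumes "f \<in> CK" shows "cmod (f x) \<le> nrm n f"
proof (rule power2_le_imp_le)
  show "(cmod (f x))\<^sup>2 \<le> (nrm n f)\<^sup>2" using fsq_ge_hn[of f x n] fsq_le_nrm[OF assms, of n "(h ^^ n) x"] by linarith
qed (rule nrm_nonneg[OF assms])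

lemma nrm_le_sup: assumes "\<And>x. cmod (f x) \<le> B" shows "nrm n f \<le> sqrt (real (N ^ n)) * B"
proof (rule nrm_le)
  have "0 \<le> B" using assms[of undefined] norm_ge_zero order_trans by blast
  then show "0 \<le> sqrt (real (N ^ n)) * B" by simp
  show "fsq n f z \<le> (sqrt (real (N ^ n)) * B)\<^sup>2" for z
    using fsq_le[OF assms] by (simp add: power_mult_distrib)
qed

lemma TA_act:
  assumes "u \<in> hcarrier (TA n)" "b \<in> CK"
  shows "map (\<lambda>(xs, a). (xs, \<lambda>y. a y * b y)) u \<in> hcarrier (TA n)"
  unfolding TA_carrier
proof
  fix p assume "p \<in> set (map (\<lambda>(xs, a). (xs, \<lambda>y. a y * b y)) u)"
  then obtain xs a where p: "(xs, a) \<in> set u" "p = (xs, \<lambda>y. a y * b y)" by auto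
  then show "case p of (xs, a) \<Rightarrow> length xs = n \<and> set xs \<subseteq> X_carrier N \<gamma> \<and> a \<in> CK"
    using assms CK_mult[of a b] by (auto simp: TA_carrier)
qed

lemma TA_append: "u \<in> hcarrier (TA n) \<Longrightarrow> v \<in> hcarrier (TA n) \<Longrightarrow> u @ v \<in> hcarrier (TA n)"
  by (auto simp: TA_carrier)

lemma hdist_TA:
  assumes "u \<in> hcarrier (TA n)" "v \<in> hcarrier (TA n)"
  shows "hdist (TA n) u v = nrm n (\<lambda>x. tensor_val n u x - tensor_val n v x)"
proof -
  let ?w = "hplus (TA n) u (hact (TA n) v (\<lambda>_. -1))"
  have "tensor_val n ?w = (\<lambda>x. tensor_val n u x - tensor_val n v x)"
    using tensor_val_act[of n "\<lambda>_. -1" v] by (simp add: alg_tensor_def tensor_val_append del: tensor_val_act)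
  moreover have "hip (TA n) ?w ?w = ip n (tensor_val n ?w) (tensor_val n ?w)"
    using tensor_ip_eq[of ?w n ?w] TA_append[OF assms(1) TA_act[OF assms(2) CK_const[of "-1"]]]
    by (simp add: alg_tensor_def fun_eq_iff)
  ultimately show ?thesis by (simp add: hdist_def hnorm_def nrm_def)
qed

lemma TA_pm: "pseudometric_carrier (hcarrier (TA n)) (hdist (TA n))"
proof
  fix u v w assume u: "u \<in> hcarrier (TA n)"
  show "hdist (TA n) u u = 0" using nrm_le[of 0 n "\<lambda>_. 0"] nrm_nonneg[of "\<lambda>_. 0" n]
    by (simp add: hdist_TA u fsq_def)
  assume v: "v \<in> hcarrier (TA n)"
  have "fsq n (\<lambda>x. tensor_val n u x - tensor_val n v x) = fsq n (\<lambda>x. tensor_val n v x - tensor_val n u x)"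
    using fsq_minus_commute[of n "tensor_val n u" "tensor_val n v"] by (rule ext)
  then show "hdist (TA n) u v = hdist (TA n) v u"
    by (simp add: hdist_TA u v nrm_def sup_norm_ip)
  assume w: "w \<in> hcarrier (TA n)"
  show "hdist (TA n) u w \<le> hdist (TA n) u v + hdist (TA n) v w"
    using nrm_triangle[of "\<lambda>x. tensor_val n u x - tensor_val n v x" "\<lambda>x. tensor_val n v x - tensor_val n w x" n] tensor_val_CK u v w
    by (simp add: hdist_TA CK_diff)
qed

lemma TP_carrier: "hcarrier (TP n) = completion (hcarrier (TA n)) (hdist (TA n))"
  by (simp add: tensor_pow_def complete_mod_def Let_def)

definition \<Phi> :: "nat \<Rightarrow> (nat \<Rightarrow> 'k tensor) set \<Rightarrow> 'k \<Rightarrow> complex" where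
  "\<Phi> n C x = lim (\<lambda>k. tensor_val n (rep C k) x)"

abbreviation "tcl n \<equiv> tcls N \<gamma> n"

lemma tensor_val_limit:
  assumes s: "s \<in> cauchy_seqs (hcarrier (TA n)) (hdist (TA n))"
  shows "uniform_limit UNIV (\<lambda>k. tensor_val n (s k)) (\<Phi> n (tcl n s)) sequentially"
proof -
  interpret pseudometric_carrier "hcarrier (TA n)" "hdist (TA n)" by (rule TA_pm)
  have lip: "dist (tensor_val n u x) (tensor_val n v x) \<le> 1 * hdist (TA n) u v"
    if "u \<in> hcarrier (TA n)" "v \<in> hcarrier (TA n)" for u v x
    using le_nrm[of "\<lambda>x. tensor_val n u x - tensor_val n v x" x n] tensor_val_CK that by (simp add: hdist_TA dist_norm CK_diff)
  have lim: "(\<lambda>k. tensor_val n (s k) x) \<longlonglongrightarrow> \<Phi> n (tcl n s) x" for x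
    unfolding \<Phi>_def by (rule lim_rep[OF s _ lip]) auto
  show ?thesis unfolding uniform_limit_iff
  proof (intro allI impI)
    fix e :: real assume e: "e > 0"
    then obtain L where L: "\<forall>m\<ge>L. \<forall>k\<ge>L. hdist (TA n) (s m) (s k) < e/2"
      using s unfolding cauchy_seqs_def by (auto dest!: spec[of _ "e/2"])
    have "dist (tensor_val n (s m) x) (\<Phi> n (tcl n s) x) < e" if m: "m \<ge> L" for m x
    proof -
      have "(\<lambda>k. dist (tensor_val n (s m) x) (tensor_val n (s k) x)) \<longlonglongrightarrow> dist (tensor_val n (s m) x) (\<Phi> n (tcl n s) x)"
        by (intro tendsto_intros lim)
      moreover have "\<exists>L. \<forall>k\<ge>L. dist (tensor_val n (s m) x) (tensor_val n (s k) x) \<le> e/2"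
      proof (intro exI allI impI)
        fix k assume "k \<ge> L"
        then show "dist (tensor_val n (s m) x) (tensor_val n (s k) x) \<le> e/2"
          using lip[OF cauchy_seqsD[OF s, of m] cauchy_seqsD[OF s, of k], of x] L m by fastforce
      qed
      ultimately have "dist (tensor_val n (s m) x) (\<Phi> n (tcl n s) x) \<le> e/2" by (rule LIMSEQ_le_const2)
      then show ?thesis using e by simp
    qed
    then show "\<forall>\<^sub>F k in sequentially. \<forall>x\<in>UNIV. dist (tensor_val n (s k) x) (\<Phi> n (tcl n s) x) < e"
      unfolding eventually_sequentially by blast
  qed
qed

lemma rep_TP:
  assumes C: "C \<in> hcarrier (TP n)"
  shows "rep C k \<in> hcarrier (TA n)"
    and "uniform_limit UNIV (\<lambda>k. tensor_val n (rep C k)) (\<Phi> n C) sequentially"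
    and "\<Phi> n C \<in> CK"
proof -
  interpret pseudometric_carrier "hcarrier (TA n)" "hdist (TA n)" by (rule TA_pm)
  have r: "rep C \<in> cauchy_seqs (hcarrier (TA n)) (hdist (TA n))" "tcl n (rep C) = C"
    using C rep_in cls_rep unfolding TP_carrier by auto
  show 1: "rep C k \<in> hcarrier (TA n)" for k using cauchy_seqsD[OF r(1)] .
  show 2: "uniform_limit UNIV (\<lambda>k. tensor_val n (rep C k)) (\<Phi> n C) sequentially"
    using tensor_val_limit[OF r(1)] unfolding r(2) .
  have "\<forall>\<^sub>F k in sequentially. continuous_on UNIV (tensor_val n (rep C k))"
    using tensor_val_CK[OF 1] by (simp add: CK_def)
  then show "\<Phi> n C \<in> CK" unfolding CK_def mem_Collect_eq
    by (rule uniform_limit_theorem[OF _ 2]) simp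
qed

lemma hdist_small:
  assumes "u \<in> hcarrier (TA n)" "v \<in> hcarrier (TA n)"
    "\<And>x. dist (tensor_val n u x) (f x) < e" "\<And>x. dist (tensor_val n v x) (f x) < e"
  shows "hdist (TA n) u v \<le> sqrt (real (N ^ n)) * (2 * e)"
proof -
  have "cmod (tensor_val n u x - tensor_val n v x) \<le> 2 * e" for x
    using dist_triangle2[of "tensor_val n u x" "tensor_val n v x" "f x"] assms(3,4)[of x] by (simp add: dist_norm)
  then show ?thesis unfolding hdist_TA[OF assms(1,2)] by (rule nrm_le_sup)
qed

text \<open>The norm of \<open>X\<^sup>\<otimes>\<^sup>n\<close> lies between the supremum norm and a multiple of it, so a sequence of
  tensors is Cauchy if and only if the functions on \<open>K\<close> converge uniformly. The operations on classes are computed with this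
  lemma.\<close>

lemma tcl_limit:
  assumes s: "\<And>k. s k \<in> hcarrier (TA n)"
    and l: "uniform_limit UNIV (\<lambda>k. tensor_val n (s k)) f sequentially"
  shows "tcl n s \<in> hcarrier (TP n)" and "\<Phi> n (tcl n s) = f"
proof -
  interpret pseudometric_carrier "hcarrier (TA n)" "hdist (TA n)" by (rule TA_pm)
  let ?R = "sqrt (real (N ^ n)) * 2"
  have R: "?R > 0" using N2 by simp
  have "s \<in> cauchy_seqs (hcarrier (TA n)) (hdist (TA n))"
    unfolding cauchy_seqs_def
  proof (intro CollectI conjI allI impI s)
    fix e :: real assume e: "e > 0"
    then have "e / (2 * ?R) > 0" using R by (metis divide_pos_pos mult_pos_pos zero_less_numeral)
    then have "\<forall>\<^sub>F k in sequentially. \<forall>x\<in>UNIV. dist (tensor_val n (s k) x) (f x) < e / (2 * ?R)"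
      using l unfolding uniform_limit_iff by blast
    then obtain L where L: "\<And>k x. k \<ge> L \<Longrightarrow> dist (tensor_val n (s k) x) (f x) < e / (2 * ?R)"
      unfolding eventually_sequentially by blast
    have "hdist (TA n) (s m) (s k) < e" if "m \<ge> L" "k \<ge> L" for m k
    proof -
      have "hdist (TA n) (s m) (s k) \<le> sqrt (real (N ^ n)) * (2 * (e / (2 * ?R)))"
        by (rule hdist_small[OF s s L[OF that(1)] L[OF that(2)]])
      also have "\<dots> = e / 2" using R by simp
      finally show ?thesis using e by simp
    qed
    then show "\<exists>M. \<forall>m\<ge>M. \<forall>k\<ge>M. hdist (TA n) (s m) (s k) < e" by blast
  qed
  note c = this
  show "tcl n s \<in> hcarrier (TP n)" unfolding TP_carrier by (rule cls_in[OF c])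
  have "(\<lambda>k. tensor_val n (s k) x) \<longlonglongrightarrow> \<Phi> n (tcl n s) x" "(\<lambda>k. tensor_val n (s k) x) \<longlonglongrightarrow> f x" for x
    using tendsto_uniform_limitI[OF tensor_val_limit[OF c]] tendsto_uniform_limitI[OF l] by auto
  then show "\<Phi> n (tcl n s) = f" using LIMSEQ_unique by blast
qed

lemma \<Phi>_inj: assumes C: "C \<in> hcarrier (TP n)" and D: "D \<in> hcarrier (TP n)" and eq: "\<Phi> n C = \<Phi> n D"
  shows "C = D"
proof -
  interpret pseudometric_carrier "hcarrier (TA n)" "hdist (TA n)" by (rule TA_pm)
  let ?R = "sqrt (real (N ^ n)) * 2"
  have R: "?R > 0" using N2 by simp
  have "(\<lambda>k. hdist (TA n) (rep C k) (rep D k)) \<longlonglongrightarrow> 0"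
  proof (rule LIMSEQ_I)
    fix e :: real assume e: "e > 0"
    then have e': "e / (2 * ?R) > 0" using R by (metis divide_pos_pos mult_pos_pos zero_less_numeral)
    have "\<forall>\<^sub>F k in sequentially. \<forall>x\<in>UNIV. dist (tensor_val n (rep C k) x) (\<Phi> n C x) < e / (2 * ?R)"
      using rep_TP(2)[OF C] e' unfolding uniform_limit_iff by blast
    moreover have "\<forall>\<^sub>F k in sequentially. \<forall>x\<in>UNIV. dist (tensor_val n (rep D k) x) (\<Phi> n C x) < e / (2 * ?R)"
      using rep_TP(2)[OF D] e' unfolding uniform_limit_iff eq by blast
    ultimately have "\<forall>\<^sub>F k in sequentially. norm (hdist (TA n) (rep C k) (rep D k) - 0) < e"
    proof eventually_elim
      case (elim k)
      have "hdist (TA n) (rep C k) (rep D k) \<le> sqrt (real (N ^ n)) * (2 * (e / (2 * ?R)))"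
        by (rule hdist_small[of _ _ _ "\<Phi> n C"]) (use elim rep_TP(1) C D in auto)
      also have "\<dots> = e / 2" using R by simp
      finally show ?case using e d_nonneg[OF rep_TP(1)[OF C] rep_TP(1)[OF D]] by simp
    qed
    then show "\<exists>no. \<forall>k\<ge>no. norm (hdist (TA n) (rep C k) (rep D k) - 0) < e"
      by (simp add: eventually_sequentially)
  qed
  then have "tcl n (rep C) = tcl n (rep D)"
    using C D unfolding TP_carrier by (intro cls_eq rep_in)
  then show ?thesis using C D cls_rep unfolding TP_carrier by simp
qed

definition X_of :: "('k \<Rightarrow> complex) \<Rightarrow> 'k \<times> 'k \<Rightarrow> complex" where
  "X_of f = (\<lambda>p. if p \<in> cograph N \<gamma> then f (fst p) else 0)"

lemma X_of_X: assumes "f \<in> CK" shows "X_of f \<in> X_carrier N \<gamma>"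
proof -
  have "continuous_on (cograph N \<gamma>) (\<lambda>p. f (fst p))"
    using assms by (auto simp: CK_def intro!: continuous_on_compose2[of UNIV f] continuous_intros)
  then have "continuous_on (cograph N \<gamma>) (X_of f)"
    by (rule continuous_on_eq) (simp add: X_of_def)
  then show ?thesis by (simp add: X_carrier_def X_of_def)
qed

lemma X_of_graph: "X_of f (x, h x) = f x"
  by (simp add: X_of_def in_cograph)

text \<open>A single elementary tensor suffices: \<open>f\<close> in the first factor and \<open>1\<close> in the others.\<close>

lemma \<Phi>_surj: assumes f: "f \<in> CK" shows "\<exists>C\<in>hcarrier (TP n). \<Phi> n C = f"
proof -
  have one: "path_val (replicate m (X_of (\<lambda>_. 1))) x = 1" for m x
    by (induction m arbitrary: x) (simp_all add: X_of_graph)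
  have "\<exists>u\<in>hcarrier (TA n). tensor_val n u = f"
  proof (cases n)
    case 0
    then show ?thesis using f
      by (intro bexI[of _ "[([], f)]"]) (auto simp: tensor_val_Cons tensor_val_Nil TA_carrier)
  next
    case (Suc m)
    show ?thesis
      by (rule bexI[of _ "[(X_of f # replicate m (X_of (\<lambda>_. 1)), \<lambda>_. 1)]"])
         (use f Suc in \<open>auto simp: tensor_val_Cons tensor_val_Nil TA_carrier X_of_graph one intro!: X_of_X\<close>)
  qed
  then obtain u where u: "u \<in> hcarrier (TA n)" "tensor_val n u = f" by blast
  have "uniform_limit UNIV (\<lambda>k. tensor_val n u) f sequentially"
    unfolding u(2) by (simp add: uniform_limit_iff)
  then show ?thesis using tcl_limit[of "\<lambda>_. u" n f] u(1) by blast
qed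

definition U :: "nat \<Rightarrow> ('k \<Rightarrow> complex) \<Rightarrow> (nat \<Rightarrow> 'k tensor) set" where
  "U n = inv_into (hcarrier (TP n)) (\<Phi> n)"

lemma U_in: "f \<in> CK \<Longrightarrow> U n f \<in> hcarrier (TP n)"
  and \<Phi>_U: "f \<in> CK \<Longrightarrow> \<Phi> n (U n f) = f"
proof -
  assume "f \<in> CK"
  then have "f \<in> \<Phi> n ` hcarrier (TP n)" using \<Phi>_surj[of f n] by blast
  then show "U n f \<in> hcarrier (TP n)" "\<Phi> n (U n f) = f"
    unfolding U_def by (auto intro: inv_into_into f_inv_into_f)
qed

lemma U_\<Phi>: "C \<in> hcarrier (TP n) \<Longrightarrow> U n (\<Phi> n C) = C"
  using \<Phi>_inj U_in \<Phi>_U rep_TP(3) by metis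

lemma \<Phi>_plus:
  assumes C: "C \<in> hcarrier (TP n)" and D: "D \<in> hcarrier (TP n)"
  shows "hplus (TP n) C D \<in> hcarrier (TP n)" and "\<Phi> n (hplus (TP n) C D) = (\<lambda>x. \<Phi> n C x + \<Phi> n D x)"
proof -
  have E: "hplus (TP n) C D = tcl n (\<lambda>k. rep C k @ rep D k)"
    by (simp add: tensor_pow_def complete_mod_def Let_def) (simp add: alg_tensor_def)
  have car: "rep C k @ rep D k \<in> hcarrier (TA n)" for k
    by (intro TA_append rep_TP(1) C D)
  have lim: "uniform_limit UNIV (\<lambda>k. tensor_val n (rep C k @ rep D k)) (\<lambda>x. \<Phi> n C x + \<Phi> n D x) sequentially"
    unfolding tensor_val_append by (intro uniform_limit_add rep_TP C D)
  show "hplus (TP n) C D \<in> hcarrier (TP n)" "\<Phi> n (hplus (TP n) C D) = (\<lambda>x. \<Phi> n C x + \<Phi> n D x)"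
    unfolding E using tcl_limit[of "\<lambda>k. rep C k @ rep D k", OF car lim] by auto
qed

lemma \<Phi>_act:
  assumes C: "C \<in> hcarrier (TP n)" and a: "a \<in> CK"
  shows "hact (TP n) C a \<in> hcarrier (TP n)" and "\<Phi> n (hact (TP n) C a) = (\<lambda>x. \<Phi> n C x * a ((h ^^ n) x))"
proof -
  let ?s = "\<lambda>k. map (\<lambda>(xs, b). (xs, \<lambda>y. b y * a y)) (rep C k)"
  have E: "hact (TP n) C a = tcl n ?s"
    by (simp add: tensor_pow_def complete_mod_def Let_def) (simp add: alg_tensor_def)
  have car: "?s k \<in> hcarrier (TA n)" for k
    by (intro TA_act rep_TP(1) C a)
  obtain B where "\<And>x. cmod (a x) \<le> B" using CK_bounded[OF a] by blast
  then have lim: "uniform_limit UNIV (\<lambda>k. tensor_val n (?s k)) (\<lambda>x. \<Phi> n C x * a ((h ^^ n) x)) sequentially"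
    unfolding tensor_val_act by (intro uniform_limit_mult_bounded[OF rep_TP(2)[OF C], of _ B])
  show "hact (TP n) C a \<in> hcarrier (TP n)" "\<Phi> n (hact (TP n) C a) = (\<lambda>x. \<Phi> n C x * a ((h ^^ n) x))"
    unfolding E using tcl_limit[of ?s, OF car lim] by auto
qed

lemma \<Phi>_ip:
  assumes C: "C \<in> hcarrier (TP n)" and D: "D \<in> hcarrier (TP n)"
  shows "hip (TP n) C D = ip n (\<Phi> n C) (\<Phi> n D)"
proof
  fix z
  have "hip (TP n) C D z = lim (\<lambda>k. ip n (tensor_val n (rep C k)) (tensor_val n (rep D k)) z)"
    using tensor_ip_eq[OF rep_TP(1)[OF C] rep_TP(1)[OF D]]
    by (simp add: tensor_pow_def complete_mod_def Let_def) (simp add: alg_tensor_def)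
  also have "\<dots> = ip n (\<Phi> n C) (\<Phi> n D) z"
    unfolding ip_def
    by (intro limI tendsto_intros tendsto_uniform_limitI[OF rep_TP(2)] C D UNIV_I)
  finally show "hip (TP n) C D z = ip n (\<Phi> n C) (\<Phi> n D) z" .
qed

lemma hnorm_TP: "C \<in> hcarrier (TP n) \<Longrightarrow> hnorm (TP n) C = nrm n (\<Phi> n C)"
  by (simp add: hnorm_def nrm_def \<Phi>_ip)

lemma path_val_snoc: "path_val (xs @ [y]) t = path_val xs t * y ((h ^^ length xs) t, (h ^^ Suc (length xs)) t)"
  by (induction xs arbitrary: t) (simp_all add: funpow_swap1)

lemma \<Phi>_tensor_right:
  assumes C: "C \<in> hcarrier (TP n)" and x: "x \<in> X_carrier N \<gamma>"
  shows "tensor_right N \<gamma> n C x \<in> hcarrier (TP (Suc n))"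
    and "\<Phi> (Suc n) (tensor_right N \<gamma> n C x) = (\<lambda>t. \<Phi> n C t * x ((h ^^ n) t, h ((h ^^ n) t)))"
proof -
  let ?s = "\<lambda>k. map (\<lambda>(xs, a). (xs @ [X_lact a x], \<lambda>_::'k. 1 :: complex)) (rep C k)"
  have Xl: "X_lact a x \<in> X_carrier N \<gamma>" if "a \<in> CK" for a
  proof -
    have "continuous_on (cograph N \<gamma>) (\<lambda>p. a (fst p) * x p)"
      using x that by (auto simp: CK_def X_carrier_def intro!: continuous_on_compose2[of UNIV a] continuous_intros)
    then show ?thesis using x by (auto simp: X_carrier_def X_lact_def case_prod_unfold)
  qed
  have car: "?s k \<in> hcarrier (TA (Suc n))" for k
    unfolding TA_carrier
  proof
    fix p assume "p \<in> set (?s k)"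
    then obtain xs a where p: "(xs, a) \<in> set (rep C k)" "p = (xs @ [X_lact a x], \<lambda>_::'k. 1)" by auto
    then show "case p of (xs, a) \<Rightarrow> length xs = Suc n \<and> set xs \<subseteq> X_carrier N \<gamma> \<and> a \<in> CK"
      using rep_TP(1)[OF C, of k] Xl[of a] by (auto simp: TA_carrier)
  qed
  have tv: "tensor_val (Suc n) (map (\<lambda>(xs, a). (xs @ [X_lact a x], \<lambda>_::'k. 1)) u) = (\<lambda>t. tensor_val n u t * x ((h ^^ n) t, h ((h ^^ n) t)))"
    if "u \<in> hcarrier (TA n)" for u
    using that
  proof (induction u)
    case (Cons p u)
    obtain xs a where p: "p = (xs, a)" by (cases p)
    then have l: "length xs = n" and u: "u \<in> hcarrier (TA n)" using Cons.prems by (auto simp: TA_carrier)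
    show ?case using Cons.IH[OF u] by (simp add: p tensor_val_Cons path_val_snoc l X_lact_def algebra_simps fun_eq_iff)
  qed (simp add: tensor_val_Nil)
  obtain B where B: "\<And>t. cmod (x (t, h t)) \<le> B" using CK_bounded[OF X_graph_CK[OF x]] by blast
  have lim: "uniform_limit UNIV (\<lambda>k. tensor_val (Suc n) (?s k)) (\<lambda>t. \<Phi> n C t * x ((h ^^ n) t, h ((h ^^ n) t))) sequentially"
    unfolding tv[OF rep_TP(1)[OF C]] by (intro uniform_limit_mult_bounded[OF rep_TP(2)[OF C], of _ B] B)
  show "tensor_right N \<gamma> n C x \<in> hcarrier (TP (Suc n))"
    and "\<Phi> (Suc n) (tensor_right N \<gamma> n C x) = (\<lambda>t. \<Phi> n C t * x ((h ^^ n) t, h ((h ^^ n) t)))"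
    unfolding tensor_right_def using tcl_limit[of ?s, OF car lim] by auto
qed

lemma \<Phi>_left_action0:
  assumes C: "C \<in> hcarrier (TP 0)" and f: "f \<in> CK"
  shows "left_action N \<gamma> 0 f C \<in> hcarrier (TP 0)" and "\<Phi> 0 (left_action N \<gamma> 0 f C) = (\<lambda>x. f x * \<Phi> 0 C x)"
proof -
  let ?s = "\<lambda>k. map (elem_lact f) (rep C k)"
  have car: "?s k \<in> hcarrier (TA 0)" for k
    using rep_TP(1)[OF C, of k] CK_mult[OF f] unfolding TA_carrier by auto
  have tv: "tensor_val 0 (map (elem_lact f) u) = (\<lambda>t. tensor_val 0 u t * f t)" if "u \<in> hcarrier (TA 0)" for u
    using that
  proof (induction u)
    case (Cons p u)
    obtain xs a where p: "p = (xs, a)" by (cases p)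
    then have l: "xs = []" and u: "u \<in> hcarrier (TA 0)" using Cons.prems by (auto simp: TA_carrier)
    show ?case using Cons.IH[OF u] by (simp add: p tensor_val_Cons l algebra_simps fun_eq_iff)
  qed (simp add: tensor_val_Nil)
  obtain B where B: "\<And>t. cmod (f t) \<le> B" using CK_bounded[OF f] by blast
  have lim: "uniform_limit UNIV (\<lambda>k. tensor_val 0 (?s k)) (\<lambda>t. \<Phi> 0 C t * f t) sequentially"
    unfolding tv[OF rep_TP(1)[OF C]] by (intro uniform_limit_mult_bounded[OF rep_TP(2)[OF C], of _ B] B)
  show "left_action N \<gamma> 0 f C \<in> hcarrier (TP 0)" and "\<Phi> 0 (left_action N \<gamma> 0 f C) = (\<lambda>x. f x * \<Phi> 0 C x)"
    unfolding left_action_def using tcl_limit[of ?s, OF car lim] C by (auto simp: mult.commute)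
qed


section \<open>Operators on tensor powers as operators on \<open>C(K)\<close>\<close>

text \<open>Conjugation with \<open>\<Phi>\<close> turns operators on the tensor power into operators on \<open>C(K)\<close>; \<open>\<iota>\<close> is the
  way back.\<close>

definition \<rho> :: "nat \<Rightarrow> 'k oper \<Rightarrow> 'k fop" where
  "\<rho> n T = (\<lambda>f\<in>CK. \<Phi> n (T (U n f)))"

definition \<iota> :: "nat \<Rightarrow> 'k fop \<Rightarrow> 'k oper" where
  "\<iota> n t = (\<lambda>\<xi>\<in>hcarrier (TP n). U n (t (\<Phi> n \<xi>)))"

abbreviation "HT n \<equiv> hcarrier (TP n)"
abbreviation "LC n \<equiv> acarrier (LX N \<gamma> n)"

lemma \<Phi>_CK: "\<xi> \<in> HT n \<Longrightarrow> \<Phi> n \<xi> \<in> CK" by (rule rep_TP(3))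

lemma \<rho>_PiE: "T \<in> HT n \<rightarrow>\<^sub>E HT n \<Longrightarrow> \<rho> n T \<in> CK \<rightarrow>\<^sub>E CK"
  by (auto simp: \<rho>_def intro!: \<Phi>_CK PiE_mem[of T "HT n" "\<lambda>_. HT n"] U_in)

lemma \<iota>_PiE: "t \<in> CK \<rightarrow>\<^sub>E CK \<Longrightarrow> \<iota> n t \<in> HT n \<rightarrow>\<^sub>E HT n"
  by (auto simp: \<iota>_def intro!: U_in PiE_mem[of t CK "\<lambda>_. CK"] \<Phi>_CK)

lemma \<rho>_\<Phi>: "\<xi> \<in> HT n \<Longrightarrow> \<rho> n T (\<Phi> n \<xi>) = \<Phi> n (T \<xi>)"
  by (simp add: \<rho>_def \<Phi>_CK U_\<Phi>)

lemma \<rho>_apply: "f \<in> CK \<Longrightarrow> \<rho> n T f = \<Phi> n (T (U n f))" by (simp add: \<rho>_def)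

lemma \<iota>_\<rho>: "T \<in> HT n \<rightarrow>\<^sub>E HT n \<Longrightarrow> \<iota> n (\<rho> n T) = T"
  by (rule PiE_ext[OF \<iota>_PiE[OF \<rho>_PiE]]) (auto simp: \<iota>_def \<rho>_\<Phi> intro!: U_\<Phi>)

lemma \<rho>_\<iota>: "t \<in> CK \<rightarrow>\<^sub>E CK \<Longrightarrow> \<rho> n (\<iota> n t) = t"
  by (rule PiE_ext[OF \<rho>_PiE[OF \<iota>_PiE]]) (auto simp: \<rho>_def \<iota>_def U_in \<Phi>_U intro!: \<Phi>_U)

lemma is_adjoint_\<rho>:
  assumes T: "T \<in> HT n \<rightarrow>\<^sub>E HT n" and S: "S \<in> HT n \<rightarrow>\<^sub>E HT n"
  shows "is_adjoint (TP n) T S \<longleftrightarrow> isadj n (\<rho> n T) (\<rho> n S)"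
proof
  assume a: "is_adjoint (TP n) T S"
  have "ip n (\<rho> n T f) g z = ip n f (\<rho> n S g) z" if "f \<in> CK" "g \<in> CK" for f g z
  proof -
    have "hip (TP n) (T (U n f)) (U n g) = hip (TP n) (U n f) (S (U n g))"
      using a U_in that by (simp add: is_adjoint_def)
    then show ?thesis
      using that PiE_mem[OF T] PiE_mem[OF S] U_in by (simp add: \<Phi>_ip \<Phi>_U \<rho>_def)
  qed
  then show "isadj n (\<rho> n T) (\<rho> n S)" using \<rho>_PiE[OF T] \<rho>_PiE[OF S] by (simp add: isadj_def)
next
  assume a: "isadj n (\<rho> n T) (\<rho> n S)"
  have "hip (TP n) (T x) y = hip (TP n) x (S y)" if xy: "x \<in> HT n" "y \<in> HT n" for x y
  proof
    fix z
    have "ip n (\<Phi> n (T x)) (\<Phi> n y) z = ip n (\<Phi> n x) (\<Phi> n (S y)) z"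
      using isadjD[OF a \<Phi>_CK[OF xy(1)] \<Phi>_CK[OF xy(2)]] by (simp add: \<rho>_\<Phi> xy)
    then show "hip (TP n) (T x) y z = hip (TP n) x (S y) z"
      using xy PiE_mem[OF T] PiE_mem[OF S] by (simp add: \<Phi>_ip)
  qed
  then show "is_adjoint (TP n) T S" using S by (simp add: is_adjoint_def)
qed

lemma LC_iff: "T \<in> LC n \<longleftrightarrow> T \<in> HT n \<rightarrow>\<^sub>E HT n \<and> \<rho> n T \<in> Adj n"
proof
  assume "T \<in> LC n"
  then obtain S where T: "T \<in> HT n \<rightarrow>\<^sub>E HT n" "is_adjoint (TP n) T S" by (auto simp: adjointables_def)
  moreover from this have "S \<in> HT n \<rightarrow>\<^sub>E HT n" by (simp add: is_adjoint_def)
  ultimately show "T \<in> HT n \<rightarrow>\<^sub>E HT n \<and> \<rho> n T \<in> Adj n"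
    using is_adjoint_\<rho> unfolding Adj_def by blast
next
  assume a: "T \<in> HT n \<rightarrow>\<^sub>E HT n \<and> \<rho> n T \<in> Adj n"
  then obtain s where s: "isadj n (\<rho> n T) s" by (auto simp: Adj_def)
  then have s2: "s \<in> CK \<rightarrow>\<^sub>E CK" by (simp add: isadj_def)
  then have "is_adjoint (TP n) T (\<iota> n s)"
    using a s is_adjoint_\<rho>[of T n "\<iota> n s"] by (simp add: \<iota>_PiE \<rho>_\<iota>)
  then show "T \<in> LC n" using a by (auto simp: adjointables_def)
qed

lemma \<iota>_LC: "t \<in> Adj n \<Longrightarrow> \<iota> n t \<in> LC n"
  and \<rho>_\<iota>_Adj: "t \<in> Adj n \<Longrightarrow> \<rho> n (\<iota> n t) = t"
  by (simp_all add: LC_iff Adj_ext \<iota>_PiE \<rho>_\<iota>)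

lemma \<iota>_\<rho>_LC: "T \<in> LC n \<Longrightarrow> \<iota> n (\<rho> n T) = T"
  and \<rho>_Adj: "T \<in> LC n \<Longrightarrow> \<rho> n T \<in> Adj n"
  and LC_HT: "T \<in> LC n \<Longrightarrow> \<xi> \<in> HT n \<Longrightarrow> T \<xi> \<in> HT n"
  by (auto simp: LC_iff \<iota>_\<rho>)

lemma \<rho>_inj: "T \<in> LC n \<Longrightarrow> S \<in> LC n \<Longrightarrow> \<rho> n T = \<rho> n S \<Longrightarrow> T = S"
  by (metis \<iota>_\<rho>_LC)

lemma LC_plus:
  assumes T: "T \<in> LC n" and S: "S \<in> LC n"
  shows "aplus (LX N \<gamma> n) T S \<in> LC n" "\<rho> n (aplus (LX N \<gamma> n) T S) = opadd (\<rho> n T) (\<rho> n S)"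
proof -
  let ?R = "\<lambda>x\<in>HT n. hplus (TP n) (T x) (S x)"
  have E: "aplus (LX N \<gamma> n) T S = ?R" by (simp add: adjointables_def)
  have P: "?R \<in> HT n \<rightarrow>\<^sub>E HT n" using LC_HT[OF T] LC_HT[OF S] \<Phi>_plus(1) by auto
  have r: "\<rho> n ?R = opadd (\<rho> n T) (\<rho> n S)"
    unfolding \<rho>_def opadd_def using LC_HT[OF T] LC_HT[OF S] by (auto simp: fun_eq_iff U_in \<Phi>_plus(2))
  show "aplus (LX N \<gamma> n) T S \<in> LC n" "\<rho> n (aplus (LX N \<gamma> n) T S) = opadd (\<rho> n T) (\<rho> n S)"
    unfolding E LC_iff r using P Adj_add \<rho>_Adj T S by auto
qed

lemma LC_times:
  assumes T: "T \<in> LC n" and S: "S \<in> LC n"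
  shows "atimes (LX N \<gamma> n) T S \<in> LC n" "\<rho> n (atimes (LX N \<gamma> n) T S) = opmul (\<rho> n T) (\<rho> n S)"
proof -
  let ?R = "\<lambda>x\<in>HT n. T (S x)"
  have E: "atimes (LX N \<gamma> n) T S = ?R" by (simp add: adjointables_def)
  have P: "?R \<in> HT n \<rightarrow>\<^sub>E HT n" using LC_HT[OF T] LC_HT[OF S] by auto
  have r: "\<rho> n ?R = opmul (\<rho> n T) (\<rho> n S)"
    unfolding opmul_def by (rule ext) (auto simp: U_in \<rho>_def LC_HT[OF S] LC_HT[OF T] U_\<Phi> \<Phi>_CK)
  show "atimes (LX N \<gamma> n) T S \<in> LC n" "\<rho> n (atimes (LX N \<gamma> n) T S) = opmul (\<rho> n T) (\<rho> n S)"
    unfolding E LC_iff r using P Adj_mul \<rho>_Adj T S by auto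
qed

lemma LC_scale:
  assumes T: "T \<in> LC n"
  shows "ascale (LX N \<gamma> n) c T \<in> LC n" "\<rho> n (ascale (LX N \<gamma> n) c T) = opscale c (\<rho> n T)"
proof -
  let ?R = "\<lambda>x\<in>HT n. hact (TP n) (T x) (\<lambda>_. c)"
  have E: "ascale (LX N \<gamma> n) c T = ?R" by (simp add: adjointables_def)
  have P: "?R \<in> HT n \<rightarrow>\<^sub>E HT n" using LC_HT[OF T] \<Phi>_act(1) by auto
  have r: "\<rho> n ?R = opscale c (\<rho> n T)"
    unfolding \<rho>_def opscale_def using LC_HT[OF T] by (auto simp: fun_eq_iff U_in \<Phi>_act(2) mult.commute)
  show "ascale (LX N \<gamma> n) c T \<in> LC n" "\<rho> n (ascale (LX N \<gamma> n) c T) = opscale c (\<rho> n T)"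
    unfolding E LC_iff r using P Adj_scale \<rho>_Adj T by auto
qed

lemma LC_star:
  assumes T: "T \<in> LC n"
  shows "astar (LX N \<gamma> n) T \<in> LC n" "\<rho> n (astar (LX N \<gamma> n) T) = opstar (\<rho> n T)"
proof -
  note t = \<rho>_Adj[OF T]
  have TP: "T \<in> HT n \<rightarrow>\<^sub>E HT n" using T by (simp add: LC_iff)
  have "astar (LX N \<gamma> n) T = (THE S. is_adjoint (TP n) T S)" by (simp add: adjointables_def)
  also have "\<dots> = \<iota> n (opstar (\<rho> n T))"
  proof (rule the_equality)
    show "is_adjoint (TP n) T (\<iota> n (opstar (\<rho> n T)))"
      using is_adjoint_\<rho>[OF TP, of "\<iota> n (opstar (\<rho> n T))"] isadj_opstar[OF t] opstar_Adj[OF t]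
      by (simp add: \<iota>_PiE Adj_ext \<rho>_\<iota>_Adj)
    fix S assume S: "is_adjoint (TP n) T S"
    then have SP: "S \<in> HT n \<rightarrow>\<^sub>E HT n" by (simp add: is_adjoint_def)
    then have "opstar (\<rho> n T) = \<rho> n S" using S is_adjoint_\<rho>[OF TP SP] opstar_eq by blast
    then show "S = \<iota> n (opstar (\<rho> n T))" using \<iota>_\<rho>[OF SP] by simp
  qed
  finally have E: "astar (LX N \<gamma> n) T = \<iota> n (opstar (\<rho> n T))" .
  show "astar (LX N \<gamma> n) T \<in> LC n" "\<rho> n (astar (LX N \<gamma> n) T) = opstar (\<rho> n T)"
    unfolding E using \<iota>_LC \<rho>_\<iota>_Adj opstar_Adj[OF t] by auto
qed

text \<open>The supremum over the unit ball is a fibrewise bound by homogeneity, and every fibrewise bound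
  dominates it.\<close>

lemma LC_norm:
  assumes T: "T \<in> LC n" shows "anorm (LX N \<gamma> n) T = op_norm (\<rho> n T)"
proof -
  let ?t = "\<rho> n T"
  note t = \<rho>_Adj[OF T]
  define B where "B = {nrm n (?t f) | f. f \<in> CK \<and> nrm n f \<le> 1}"
  have "{hnorm (TP n) (T x) | x. x \<in> HT n \<and> hnorm (TP n) x \<le> 1} = B"
  proof (intro set_eqI iffI)
    fix y assume "y \<in> {hnorm (TP n) (T x) | x. x \<in> HT n \<and> hnorm (TP n) x \<le> 1}"
    then obtain x where "x \<in> HT n" "hnorm (TP n) x \<le> 1" "y = hnorm (TP n) (T x)" by blast
    then show "y \<in> B" unfolding B_def
      by (auto intro!: exI[of _ "\<Phi> n x"] simp: hnorm_TP LC_HT[OF T] \<rho>_\<Phi> \<Phi>_CK)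
  next
    fix y assume "y \<in> B"
    then obtain f where "f \<in> CK" "nrm n f \<le> 1" "y = nrm n (?t f)" unfolding B_def by blast
    then show "y \<in> {hnorm (TP n) (T x) | x. x \<in> HT n \<and> hnorm (TP n) x \<le> 1}"
      by (auto intro!: exI[of _ "U n f"] simp: hnorm_TP LC_HT[OF T] U_in \<Phi>_U \<rho>_apply)
  qed
  then have A: "anorm (LX N \<gamma> n) T = Sup B" by (simp add: adjointables_def)
  have le: "y \<le> op_norm ?t" if y: "y \<in> B" for y
  proof -
    obtain f where f: "f \<in> CK" "nrm n f \<le> 1" "y = nrm n (?t f)" using y unfolding B_def by blast
    have "(nrm n f)\<^sup>2 \<le> 1" using f nrm_nonneg by (simp add: power_le_one)
    then have f1: "fsq n f z \<le> 1" for z using fsq_le_nrm[OF f(1), of n z] by linarith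
    have "fsq n (?t f) z \<le> (op_norm ?t)\<^sup>2" for z
    proof -
      have "fsq n (?t f) z \<le> (op_norm ?t)\<^sup>2 * fsq n f z" using bnd_op_norm[OF t] f(1) by (simp add: bnd_def)
      also have "\<dots> \<le> (op_norm ?t)\<^sup>2 * 1" using f1 by (intro mult_left_mono) auto
      finally show ?thesis by simp
    qed
    then show ?thesis unfolding f(3) using op_norm_nonneg[OF t] by (rule nrm_le[rotated])
  qed
  have bdd: "bdd_above B" using le by (rule bdd_aboveI)
  have "nrm n (\<lambda>_. 0 :: complex) \<le> 0" by (rule nrm_le) (auto simp: fsq_def)
  then have z: "nrm n (?t (\<lambda>_. 0)) \<in> B" unfolding B_def by (auto intro!: exI[of _ "\<lambda>_. 0"])
  have "op_norm ?t \<le> Sup B"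
  proof (rule op_norm_le[of n], rule fibrewise_bound[OF t])
    show "0 \<le> Sup B"
      by (rule cSup_upper2[OF z _ bdd]) (rule nrm_nonneg[OF Adj_CK[OF t CK_const]])
    fix f c z assume f: "f \<in> CK" and c: "0 < c" and fc: "\<And>z. fsq n f z \<le> c"
    let ?a = "complex_of_real (1 / sqrt c)"
    let ?g = "\<lambda>x. ?a * f x"
    have g: "?g \<in> CK" by (intro CK_mult CK_const f)
    have fs: "fsq n (\<lambda>x. ?a * f' x) z = fsq n f' z / c" for f' z
      using c by (simp add: fsq_def norm_mult norm_divide power_divide sum_divide_distrib)
    have "nrm n ?g \<le> 1" by (rule nrm_le) (use fc c in \<open>auto simp only: fs power_one divide_le_eq_1\<close>)
    then have "nrm n (?t ?g) \<in> B" unfolding B_def using g by blast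
    then have le: "nrm n (?t ?g) \<le> Sup B" using bdd by (rule cSup_upper)
    have "fsq n (?t f) z / c = fsq n (?t ?g) z"
      unfolding Adj_linear(3)[OF t f f] fs ..
    also have "\<dots> \<le> (nrm n (?t ?g))\<^sup>2" by (rule fsq_le_nrm[OF Adj_CK[OF t g]])
    also have "\<dots> \<le> (Sup B)\<^sup>2" using le nrm_nonneg[OF Adj_CK[OF t g]] by (rule power_mono)
    finally show "fsq n (?t f) z \<le> (Sup B)\<^sup>2 * c" using c by (simp add: field_simps)
  qed
  moreover have "Sup B \<le> op_norm ?t" using z le by (intro cSup_least) auto
  ultimately show ?thesis unfolding A by simp
qed

lemma LC_dist: "T \<in> LC n \<Longrightarrow> S \<in> LC n \<Longrightarrow> adist (LX N \<gamma> n) T S = op_dist (\<rho> n T) (\<rho> n S)"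
  by (simp add: adist_def op_dist_def LC_norm LC_plus LC_scale)

lemma theta_\<rho>:
  assumes "\<xi> \<in> HT n" "\<eta> \<in> HT n"
  shows "theta (TP n) \<xi> \<eta> \<in> LC n" "\<rho> n (theta (TP n) \<xi> \<eta>) = rank_one n (\<Phi> n \<xi>) (\<Phi> n \<eta>)"
proof -
  have C: "hip (TP n) \<eta> z \<in> CK" if "z \<in> HT n" for z using that assms by (simp add: \<Phi>_ip ip_CK \<Phi>_CK)
  have P: "theta (TP n) \<xi> \<eta> \<in> HT n \<rightarrow>\<^sub>E HT n"
    unfolding theta_def using C assms \<Phi>_act(1) by auto
  have "\<Phi> n (hact (TP n) \<xi> (hip (TP n) \<eta> (U n f))) = (\<lambda>x. \<Phi> n \<xi> x * ip n (\<Phi> n \<eta>) f ((h ^^ n) x))"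
    if "f \<in> CK" for f
    unfolding \<Phi>_act(2)[OF assms(1) C[OF U_in[OF that]]] by (simp add: \<Phi>_ip assms U_in that \<Phi>_U)
  then have r: "\<rho> n (theta (TP n) \<xi> \<eta>) = rank_one n (\<Phi> n \<xi>) (\<Phi> n \<eta>)"
    unfolding \<rho>_def rank_one_def theta_def by (simp add: U_in cong: restrict_cong)
  show "theta (TP n) \<xi> \<eta> \<in> LC n" "\<rho> n (theta (TP n) \<xi> \<eta>) = rank_one n (\<Phi> n \<xi>) (\<Phi> n \<eta>)"
    unfolding LC_iff r using P rank_one_Adj \<Phi>_CK assms by auto
qed

abbreviation "KC n \<equiv> acarrier (KX N \<gamma> n)"

lemma KX_ops:
  "aplus (KX N \<gamma> n) = aplus (LX N \<gamma> n)" "atimes (KX N \<gamma> n) = atimes (LX N \<gamma> n)"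
  "ascale (KX N \<gamma> n) = ascale (LX N \<gamma> n)" "astar (KX N \<gamma> n) = astar (LX N \<gamma> n)"
  "anorm (KX N \<gamma> n) = anorm (LX N \<gamma> n)"
  by (simp_all add: compacts_def generated_subalg_def)

lemma KC_eq: "KC n = \<Inter>{B. closed_star_subalg (LX N \<gamma> n) B \<and>
    {theta (TP n) x y | x y. x \<in> HT n \<and> y \<in> HT n} \<subseteq> B}"
  by (simp add: compacts_def generated_subalg_def)

lemma closed_sub_limit:
  "closed_sub n B \<Longrightarrow> t \<in> Adj n \<Longrightarrow> (\<And>j. s j \<in> B) \<Longrightarrow> (\<lambda>j. op_dist (s j) t) \<longlonglongrightarrow> 0 \<Longrightarrow> t \<in> B"
  unfolding closed_sub_def by blast

lemma closed_star_subalg_\<rho>: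
  assumes B: "closed_sub n B" shows "closed_star_subalg (LX N \<gamma> n) {T \<in> LC n. \<rho> n T \<in> B}"
  unfolding closed_star_subalg_def
proof (intro conjI ballI allI impI)
  fix s x assume x: "x \<in> LC n"
    and s: "(\<forall>j. s j \<in> {T \<in> LC n. \<rho> n T \<in> B}) \<and> (\<lambda>j. adist (LX N \<gamma> n) (s j) x) \<longlonglongrightarrow> 0"
  have "(\<lambda>j. op_dist (\<rho> n (s j)) (\<rho> n x)) = (\<lambda>j. adist (LX N \<gamma> n) (s j) x)"
    using s x by (simp add: LC_dist)
  then have "(\<lambda>j. op_dist (\<rho> n (s j)) (\<rho> n x)) \<longlonglongrightarrow> 0" using s by simp
  then have "\<rho> n x \<in> B" using s by (intro closed_sub_limit[OF B \<rho>_Adj[OF x], of "\<lambda>j. \<rho> n (s j)"]) auto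
  then show "x \<in> {T \<in> LC n. \<rho> n T \<in> B}" using x by simp
next
  have ops: "\<And>s t. s \<in> B \<Longrightarrow> t \<in> B \<Longrightarrow> opadd s t \<in> B" "\<And>s t. s \<in> B \<Longrightarrow> t \<in> B \<Longrightarrow> opmul s t \<in> B"
    "\<And>c s. s \<in> B \<Longrightarrow> opscale c s \<in> B" "\<And>s. s \<in> B \<Longrightarrow> opstar s \<in> B"
    using B by (simp_all add: closed_sub_def)
  fix x c assume x: "x \<in> {T \<in> LC n. \<rho> n T \<in> B}"
  then show "ascale (LX N \<gamma> n) c x \<in> {T \<in> LC n. \<rho> n T \<in> B}" "astar (LX N \<gamma> n) x \<in> {T \<in> LC n. \<rho> n T \<in> B}"
    by (simp_all add: ops LC_scale LC_star)
  fix y assume "y \<in> {T \<in> LC n. \<rho> n T \<in> B}"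
  with x show "aplus (LX N \<gamma> n) x y \<in> {T \<in> LC n. \<rho> n T \<in> B}" "atimes (LX N \<gamma> n) x y \<in> {T \<in> LC n. \<rho> n T \<in> B}"
    by (simp_all add: ops LC_plus LC_times)
qed auto

lemma \<iota>_add: "s \<in> Adj n \<Longrightarrow> t \<in> Adj n \<Longrightarrow> \<iota> n (opadd s t) = aplus (LX N \<gamma> n) (\<iota> n s) (\<iota> n t)"
  by (rule \<rho>_inj[of _ n]) (auto simp: \<iota>_LC LC_plus \<rho>_\<iota>_Adj Adj_add)

lemma \<iota>_mul: "s \<in> Adj n \<Longrightarrow> t \<in> Adj n \<Longrightarrow> \<iota> n (opmul s t) = atimes (LX N \<gamma> n) (\<iota> n s) (\<iota> n t)"
  by (rule \<rho>_inj[of _ n]) (auto simp: \<iota>_LC LC_times \<rho>_\<iota>_Adj Adj_mul)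

lemma \<iota>_scale: "s \<in> Adj n \<Longrightarrow> \<iota> n (opscale c s) = ascale (LX N \<gamma> n) c (\<iota> n s)"
  by (rule \<rho>_inj[of _ n]) (auto simp: \<iota>_LC LC_scale \<rho>_\<iota>_Adj Adj_scale)

lemma \<iota>_star: "s \<in> Adj n \<Longrightarrow> \<iota> n (opstar s) = astar (LX N \<gamma> n) (\<iota> n s)"
  by (rule \<rho>_inj[of _ n]) (auto simp: \<iota>_LC LC_star \<rho>_\<iota>_Adj opstar_Adj)

lemma closed_sub_\<iota>:
  assumes B: "closed_star_subalg (LX N \<gamma> n) B" shows "closed_sub n {t \<in> Adj n. \<iota> n t \<in> B}"
  unfolding closed_sub_def
proof (intro conjI ballI allI impI)
  fix s t assume "s \<in> {t \<in> Adj n. \<iota> n t \<in> B}" "t \<in> {t \<in> Adj n. \<iota> n t \<in> B}"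
  then show "opadd s t \<in> {t \<in> Adj n. \<iota> n t \<in> B}" "opmul s t \<in> {t \<in> Adj n. \<iota> n t \<in> B}"
    using B by (auto simp: \<iota>_add \<iota>_mul Adj_add Adj_mul closed_star_subalg_def)
next
  fix s c assume "s \<in> {t \<in> Adj n. \<iota> n t \<in> B}"
  then show "opscale c s \<in> {t \<in> Adj n. \<iota> n t \<in> B}" "opstar s \<in> {t \<in> Adj n. \<iota> n t \<in> B}"
    using B by (auto simp: \<iota>_scale \<iota>_star Adj_scale opstar_Adj closed_star_subalg_def)
next
  fix s t assume t: "t \<in> Adj n" and s: "(\<forall>j. s j \<in> {t \<in> Adj n. \<iota> n t \<in> B}) \<and> (\<lambda>j. op_dist (s j) t) \<longlonglongrightarrow> 0"
  then have "(\<lambda>j. adist (LX N \<gamma> n) (\<iota> n (s j)) (\<iota> n t)) \<longlonglongrightarrow> 0"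
    by (simp add: LC_dist \<iota>_LC \<rho>_\<iota>_Adj)
  moreover have "\<forall>j. \<iota> n (s j) \<in> B" using s by blast
  ultimately have "\<iota> n t \<in> B" using B \<iota>_LC[OF t] unfolding closed_star_subalg_def
    by (elim conjE) (drule spec[of _ "\<lambda>j. \<iota> n (s j)"], blast)
  then show "t \<in> {t \<in> Adj n. \<iota> n t \<in> B}" using t by simp
qed auto

text \<open>Both sides are the least closed subalgebras that contain the rank one operators, and closed
  subalgebras correspond to each other under \<open>\<rho>\<close>.\<close>

lemma KC_iff: "T \<in> KC n \<longleftrightarrow> T \<in> LC n \<and> \<rho> n T \<in> Kc n"
proof
  assume T: "T \<in> KC n"
  have "{theta (TP n) x y | x y. x \<in> HT n \<and> y \<in> HT n} \<subseteq> {T \<in> LC n. \<rho> n T \<in> Kc n}"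
    by (auto simp: theta_\<rho> intro!: Kc_rank_one \<Phi>_CK)
  then have "T \<in> {T \<in> LC n. \<rho> n T \<in> Kc n}"
    using T closed_star_subalg_\<rho>[OF closed_sub_Kc[of n]] unfolding KC_eq by blast
  then show "T \<in> LC n \<and> \<rho> n T \<in> Kc n" by simp
next
  assume T: "T \<in> LC n \<and> \<rho> n T \<in> Kc n"
  show "T \<in> KC n" unfolding KC_eq
  proof (rule InterI, elim CollectE conjE)
    fix B assume B: "closed_star_subalg (LX N \<gamma> n) B" "{theta (TP n) x y | x y. x \<in> HT n \<and> y \<in> HT n} \<subseteq> B"
    have "rank_one n f g \<in> {t \<in> Adj n. \<iota> n t \<in> B}" if "f \<in> CK" "g \<in> CK" for f g
    proof -
      have "\<iota> n (rank_one n f g) = theta (TP n) (U n f) (U n g)"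
        by (rule \<rho>_inj[of _ n]) (use that in \<open>auto simp: theta_\<rho> U_in \<Phi>_U \<rho>_\<iota>_Adj rank_one_Adj intro!: \<iota>_LC\<close>)
      moreover have "theta (TP n) (U n f) (U n g) \<in> B" using B(2) U_in that by blast
      ultimately show ?thesis using that rank_one_Adj by simp
    qed
    then have "Kc n \<subseteq> {t \<in> Adj n. \<iota> n t \<in> B}" by (rule Kc_least[OF closed_sub_\<iota>[OF B(1)]])
    then have "\<iota> n (\<rho> n T) \<in> B" using T by blast
    then show "T \<in> B" using T \<iota>_\<rho>_LC by simp
  qed
qed

lemma KC_LC: "T \<in> KC n \<Longrightarrow> T \<in> LC n" by (simp add: KC_iff)

lemma \<iota>_KC: "t \<in> Kc n \<Longrightarrow> \<iota> n t \<in> KC n"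
  using Kc_Adj by (auto simp: KC_iff \<iota>_LC \<rho>_\<iota>_Adj subset_iff)

lemma theta_KC: "x \<in> HT n \<Longrightarrow> y \<in> HT n \<Longrightarrow> theta (TP n) x y \<in> KC n"
  by (simp add: KC_iff theta_\<rho> Kc_rank_one \<Phi>_CK)

section \<open>The embeddings \<open>T \<mapsto> T \<otimes> I\<close>\<close>

text \<open>As \<open>\<rho> T\<close> commutes with multiplication by functions of \<open>h\<^sup>n\<close>, the operators \<open>T\<close> and
  \<open>T \<otimes> I\<close> are the same operator on \<open>C(K)\<close>.\<close>

lemma tensor_id_eq:
  assumes T: "T \<in> LC n" shows "tensor_id N \<gamma> n T = \<iota> (Suc n) (\<rho> n T)"
  unfolding tensor_id_def
proof (rule the_equality)
  note t = \<rho>_Adj[OF T]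
  have tS: "\<rho> n T \<in> Adj (Suc n)" using Adj_mono[OF t] by simp
  have "\<iota> (Suc n) (\<rho> n T) (tensor_right N \<gamma> n \<xi> x) = tensor_right N \<gamma> n (T \<xi>) x"
    if \<xi>: "\<xi> \<in> HT n" and x: "x \<in> X_carrier N \<gamma>" for \<xi> x
  proof (rule \<Phi>_inj)
    note X = X_graph_CK[OF x]
    show "\<iota> (Suc n) (\<rho> n T) (tensor_right N \<gamma> n \<xi> x) \<in> HT (Suc n)"
      by (rule LC_HT[OF \<iota>_LC[OF tS] \<Phi>_tensor_right(1)[OF \<xi> x]])
    show "tensor_right N \<gamma> n (T \<xi>) x \<in> HT (Suc n)" by (rule \<Phi>_tensor_right(1)[OF LC_HT[OF T \<xi>] x])
    have "\<Phi> (Suc n) (\<iota> (Suc n) (\<rho> n T) (tensor_right N \<gamma> n \<xi> x)) =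
        \<rho> n T (\<lambda>t. \<Phi> n \<xi> t * x ((h ^^ n) t, h ((h ^^ n) t)))"
      using \<rho>_\<Phi>[OF \<Phi>_tensor_right(1)[OF \<xi> x], of "\<iota> (Suc n) (\<rho> n T)"]
      by (simp add: \<rho>_\<iota>_Adj[OF tS] \<Phi>_tensor_right(2)[OF \<xi> x])
    also have "\<dots> = (\<lambda>t. \<Phi> n (T \<xi>) t * x ((h ^^ n) t, h ((h ^^ n) t)))"
      using Adj_linear(4)[OF t \<Phi>_CK[OF \<xi>] \<Phi>_CK[OF \<xi>] X] by (simp add: \<rho>_\<Phi>[OF \<xi>])
    finally show "\<Phi> (Suc n) (\<iota> (Suc n) (\<rho> n T) (tensor_right N \<gamma> n \<xi> x)) = \<Phi> (Suc n) (tensor_right N \<gamma> n (T \<xi>) x)"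
      by (simp add: \<Phi>_tensor_right(2)[OF LC_HT[OF T \<xi>] x])
  qed
  then show "\<iota> (Suc n) (\<rho> n T) \<in> LC (Suc n) \<and> (\<forall>\<xi>\<in>HT n. \<forall>x\<in>X_carrier N \<gamma>.
      \<iota> (Suc n) (\<rho> n T) (tensor_right N \<gamma> n \<xi> x) = tensor_right N \<gamma> n (T \<xi>) x)"
    using \<iota>_LC[OF tS] by blast
  fix S assume S: "S \<in> LC (Suc n) \<and> (\<forall>\<xi>\<in>HT n. \<forall>x\<in>X_carrier N \<gamma>.
      S (tensor_right N \<gamma> n \<xi> x) = tensor_right N \<gamma> n (T \<xi>) x)"
  have "\<rho> (Suc n) S = \<rho> n T"
  proof (rule Adj_eqI[OF \<rho>_Adj t])
    show "S \<in> LC (Suc n)" using S by simp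
    fix f :: "'k \<Rightarrow> complex" assume f: "f \<in> CK"
    let ?x = "X_of (\<lambda>_. 1)"
    have x: "?x \<in> X_carrier N \<gamma>" by (rule X_of_X) simp
    note R = \<Phi>_tensor_right[OF U_in[OF f] x] \<Phi>_tensor_right[OF LC_HT[OF T U_in[OF f]] x]
    have "\<rho> (Suc n) S f = \<rho> (Suc n) S (\<Phi> (Suc n) (tensor_right N \<gamma> n (U n f) ?x))"
      by (simp add: R(2) \<Phi>_U[OF f] X_of_graph)
    also have "\<dots> = \<Phi> (Suc n) (tensor_right N \<gamma> n (T (U n f)) ?x)"
      unfolding \<rho>_\<Phi>[OF R(1)] using S U_in[OF f] x by simp
    also have "\<dots> = \<rho> n T f" by (simp add: R(4) X_of_graph \<rho>_apply[OF f])
    finally show "\<rho> (Suc n) S f = \<rho> n T f" .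
  qed
  then show "S = \<iota> (Suc n) (\<rho> n T)" using S \<iota>_\<rho>_LC by metis
qed

lemma ampl_\<rho>:
  assumes T: "T \<in> LC n" shows "ampl N \<gamma> n k T \<in> LC (n + k) \<and> \<rho> (n + k) (ampl N \<gamma> n k T) = \<rho> n T"
proof (induction k)
  case (Suc k)
  have "\<rho> n T \<in> Adj (Suc (n + k))" using Adj_mono[OF \<rho>_Adj[OF T], of "Suc (n + k)"] by simp
  then show ?case using Suc by (simp add: tensor_id_eq \<iota>_LC \<rho>_\<iota>_Adj)
qed (use T in simp)

lemma ampl_to:
  assumes T: "T \<in> LC n" and nl: "n \<le> l"
  shows "ampl N \<gamma> n (l - n) T \<in> LC l" "\<rho> l (ampl N \<gamma> n (l - n) T) = \<rho> n T"
  using ampl_\<rho>[OF T, of "l - n"] nl by simp_all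

lemma F_level_iff: "T \<in> F_level N \<gamma> n \<longleftrightarrow> T \<in> LC n \<and> \<rho> n T \<in> Fc n"
proof
  assume "T \<in> F_level N \<gamma> n"
  then obtain S where S: "\<forall>i\<le>n. S i \<in> KC i" "T = asum (LX N \<gamma> n) (\<lambda>i. ampl N \<gamma> i (n - i) (S i)) n"
    unfolding F_level_def by blast
  have a: "ampl N \<gamma> i (n - i) (S i) \<in> LC n" "\<rho> n (ampl N \<gamma> i (n - i) (S i)) = \<rho> i (S i)" "\<rho> i (S i) \<in> Kc i"
    if "i \<le> n" for i
    using ampl_to[OF KC_LC that] S(1) that KC_iff by auto
  have "asum (LX N \<gamma> n) (\<lambda>i. ampl N \<gamma> i (n - i) (S i)) m \<in> LC n \<and>
      \<rho> n (asum (LX N \<gamma> n) (\<lambda>i. ampl N \<gamma> i (n - i) (S i)) m) \<in> Fc m" if "m \<le> n" for m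
    using that
  proof (induction m)
    case 0
    then show ?case using a[of 0] by simp
  next
    case (Suc m)
    then show ?case using a[of "Suc m"] by (auto simp: LC_plus)
  qed
  then show "T \<in> LC n \<and> \<rho> n T \<in> Fc n" unfolding S(2) by blast
next
  assume T: "T \<in> LC n \<and> \<rho> n T \<in> Fc n"
  have "\<exists>S. (\<forall>i\<le>m. S i \<in> KC i) \<and> asum (LX N \<gamma> n) (\<lambda>i. ampl N \<gamma> i (n - i) (S i)) m \<in> LC n \<and>
     \<rho> n (asum (LX N \<gamma> n) (\<lambda>i. ampl N \<gamma> i (n - i) (S i)) m) = t" if "m \<le> n" "t \<in> Fc m" for m t
    using that
  proof (induction m arbitrary: t)
    case 0
    then have "t \<in> Kc 0" by simp
    then show ?case
      using ampl_to[OF KC_LC[OF \<iota>_KC], of t 0 n] subsetD[OF Kc_Adj] by (intro exI[of _ "\<lambda>_. \<iota> 0 t"]) (simp add: \<iota>_KC \<rho>_\<iota>_Adj)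
  next
    case (Suc m)
    then obtain a s where t: "t = opadd a s" "a \<in> Fc m" "s \<in> Kc (Suc m)" by auto
    obtain S where S: "\<forall>i\<le>m. S i \<in> KC i" "asum (LX N \<gamma> n) (\<lambda>i. ampl N \<gamma> i (n - i) (S i)) m \<in> LC n"
      "\<rho> n (asum (LX N \<gamma> n) (\<lambda>i. ampl N \<gamma> i (n - i) (S i)) m) = a"
      using Suc.IH[OF _ t(2)] Suc.prems by auto
    \<comment> \<open>The summands up to level \<open>m\<close> stay, and the compact part of level \<open>Suc m\<close> is appended.\<close>
    let ?S = "S(Suc m := \<iota> (Suc m) s)"
    have same: "asum (LX N \<gamma> n) (\<lambda>i. ampl N \<gamma> i (n - i) (?S i)) l = asum (LX N \<gamma> n) (\<lambda>i. ampl N \<gamma> i (n - i) (S i)) l"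
      if "l \<le> m" for l using that by (induction l) auto
    have K: "\<iota> (Suc m) s \<in> KC (Suc m)" by (rule \<iota>_KC[OF t(3)])
    note A = ampl_to[OF KC_LC[OF K] Suc.prems(1)]
    have "\<rho> (Suc m) (\<iota> (Suc m) s) = s" using t(3) Kc_Adj by (auto simp: \<rho>_\<iota>_Adj subset_iff)
    then have "\<rho> n (ampl N \<gamma> (Suc m) (n - Suc m) (\<iota> (Suc m) s)) = s" using A by simp
    moreover have "asum (LX N \<gamma> n) (\<lambda>i. ampl N \<gamma> i (n - i) (?S i)) (Suc m) =
        aplus (LX N \<gamma> n) (asum (LX N \<gamma> n) (\<lambda>i. ampl N \<gamma> i (n - i) (S i)) m)
          (ampl N \<gamma> (Suc m) (n - Suc m) (\<iota> (Suc m) s))"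
      by (simp only: asum.simps same[OF order_refl] fun_upd_same)
    moreover have "\<forall>i\<le>Suc m. ?S i \<in> KC i" using S(1) K by (simp add: le_Suc_eq)
    ultimately show ?case
      using LC_plus[OF S(2) A(1)] S(3) t(1) by (intro exI[of _ ?S]) simp
  qed
  then obtain S where S: "\<forall>i\<le>n. S i \<in> KC i" "asum (LX N \<gamma> n) (\<lambda>i. ampl N \<gamma> i (n - i) (S i)) n \<in> LC n"
     "\<rho> n (asum (LX N \<gamma> n) (\<lambda>i. ampl N \<gamma> i (n - i) (S i)) n) = \<rho> n T" using T by blast
  have "T = asum (LX N \<gamma> n) (\<lambda>i. ampl N \<gamma> i (n - i) (S i)) n"
    by (rule \<rho>_inj[OF conjunct1[OF T] S(2) S(3)[symmetric]])
  then show "T \<in> F_level N \<gamma> n" unfolding F_level_def using S(1) by blast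
qed

section \<open>The core\<close>

abbreviation "PC \<equiv> pre_core N \<gamma>"

text \<open>The operator on \<open>C(K)\<close> behind a pair of the pre-core. It forgets the level, and all operations
  and distances of the pre-core are those of these operators.\<close>

definition core_op :: "nat \<times> 'k oper \<Rightarrow> 'k fop" where "core_op x = \<rho> (fst x) (snd x)"

lemma PC_iff: "x \<in> acarrier PC \<longleftrightarrow> snd x \<in> LC (fst x) \<and> core_op x \<in> Fc (fst x)"
  by (cases x) (simp add: pre_core_def F_level_iff core_op_def)

lemma to_level_core_op:
  assumes "x \<in> acarrier PC" "fst x \<le> l"
  shows "to_level N \<gamma> l x \<in> LC l" "\<rho> l (to_level N \<gamma> l x) = core_op x" "core_op x \<in> Fc l"
  using assms ampl_to[of "snd x" "fst x" l] Fc_mono[OF assms(2)]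
  by (auto simp: to_level_def case_prod_unfold PC_iff core_op_def)

lemma PC_plus:
  assumes "x \<in> acarrier PC" "y \<in> acarrier PC"
  shows "aplus PC x y \<in> acarrier PC" "core_op (aplus PC x y) = opadd (core_op x) (core_op y)"
  using to_level_core_op[OF assms(1), of "max (fst x) (fst y)"] to_level_core_op[OF assms(2), of "max (fst x) (fst y)"]
  by (auto simp: PC_iff) (auto simp: pre_core_def Let_def core_op_def LC_plus Fc_closed)

lemma PC_times:
  assumes "x \<in> acarrier PC" "y \<in> acarrier PC"
  shows "atimes PC x y \<in> acarrier PC" "core_op (atimes PC x y) = opmul (core_op x) (core_op y)"
  using to_level_core_op[OF assms(1), of "max (fst x) (fst y)"] to_level_core_op[OF assms(2), of "max (fst x) (fst y)"]
  by (auto simp: PC_iff) (auto simp: pre_core_def Let_def core_op_def LC_times Fc_closed)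

lemma PC_scale:
  assumes "x \<in> acarrier PC"
  shows "ascale PC c x \<in> acarrier PC" "core_op (ascale PC c x) = opscale c (core_op x)"
  using assms Fc_closed by (auto simp: PC_iff) (auto simp: pre_core_def core_op_def LC_scale Fc_closed case_prod_unfold)

lemma PC_star:
  assumes "x \<in> acarrier PC"
  shows "astar PC x \<in> acarrier PC" "core_op (astar PC x) = opstar (core_op x)"
  using assms Fc_closed by (auto simp: PC_iff) (auto simp: pre_core_def core_op_def LC_star Fc_closed case_prod_unfold)

lemma PC_norm: "x \<in> acarrier PC \<Longrightarrow> anorm PC x = op_norm (core_op x)"
proof -
  assume "x \<in> acarrier PC"
  then have "snd x \<in> LC (fst x)" by (simp add: PC_iff)
  then show "anorm PC x = op_norm (core_op x)" by (simp add: pre_core_def core_op_def LC_norm case_prod_unfold)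
qed

lemma PC_dist: "x \<in> acarrier PC \<Longrightarrow> y \<in> acarrier PC \<Longrightarrow> adist PC x y = op_dist (core_op x) (core_op y)"
  by (simp add: adist_def op_dist_def PC_norm PC_plus PC_scale)

lemma PC_Adj: "x \<in> acarrier PC \<Longrightarrow> fst x \<le> l \<Longrightarrow> core_op x \<in> Adj l"
  using to_level_core_op(3) Fc_Adj by blast

lemma pre_cstar_core: "pre_cstar PC"
proof (rule pre_cstar.intro)
  show "pseudometric_carrier (acarrier PC) (adist PC)"
  proof
    fix x y z assume x: "x \<in> acarrier PC" 
    show "adist PC x x = 0" using x PC_Adj[OF x order_refl] by (simp add: PC_dist op_dist_self)
    assume y: "y \<in> acarrier PC"
    show "adist PC x y = adist PC y x"
      using op_dist_sym[OF PC_Adj[OF x] PC_Adj[OF y], of "max (fst x) (fst y)"] x y by (simp add: PC_dist)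
    assume z: "z \<in> acarrier PC"
    let ?l = "max (fst x) (max (fst y) (fst z))"
    show "adist PC x z \<le> adist PC x y + adist PC y z"
      using op_dist_tri[OF PC_Adj[OF x] PC_Adj[OF y] PC_Adj[OF z], of ?l] x y z by (simp add: PC_dist)
  qed
next
  fix x x' y y' assume x: "x \<in> acarrier PC" "x' \<in> acarrier PC" and y: "y \<in> acarrier PC" "y' \<in> acarrier PC"
  let ?l = "max (max (fst x) (fst x')) (max (fst y) (fst y'))"
  have L: "core_op x \<in> Adj ?l" "core_op x' \<in> Adj ?l" "core_op y \<in> Adj ?l" "core_op y' \<in> Adj ?l"
    using PC_Adj x y by auto
  show "adist PC (aplus PC x y) (aplus PC x' y') \<le> adist PC x x' + adist PC y y'"
    using op_dist_add[OF L] x y by (simp add: PC_dist PC_plus)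
  show "adist PC (atimes PC x y) (atimes PC x' y') \<le> anorm PC x * adist PC y y' + adist PC x x' * anorm PC y'"
    using op_dist_mul[OF L] x y by (simp add: PC_dist PC_times PC_norm)
next
  fix x x' c assume x: "x \<in> acarrier PC" "x' \<in> acarrier PC"
  let ?l = "max (fst x) (fst x')"
  have L: "core_op x \<in> Adj ?l" "core_op x' \<in> Adj ?l" using PC_Adj x by auto
  show "adist PC (ascale PC c x) (ascale PC c x') \<le> cmod c * adist PC x x'"
    using op_dist_scale[OF L] x by (simp add: PC_dist PC_scale)
  show "adist PC (astar PC x) (astar PC x') \<le> adist PC x x'"
    using op_dist_star[OF L] x by (simp add: PC_dist PC_star)
  show "\<bar>anorm PC x - anorm PC x'\<bar> \<le> adist PC x x'"
    using op_norm_diff[OF L] x by (simp add: PC_dist PC_norm)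
next
  fix x assume x: "x \<in> acarrier PC"
  show "0 \<le> anorm PC x" using op_norm_nonneg[OF PC_Adj[OF x order_refl]] x by (simp add: PC_norm)
qed (auto simp: PC_plus PC_times PC_scale PC_star)

end

section \<open>Transferred point masses\<close>

text \<open>The sum of the point masses in a finite set, as a Borel measure.\<close>

definition count_measure :: "'k::metric_space set \<Rightarrow> 'k measure" where
  "count_measure S = distr (count_space S) borel (\<lambda>x. x)"

lemma sets_count_measure [simp]: "sets (count_measure S) = sets borel"
  by (simp add: count_measure_def)

lemma integral_count_measure:
  fixes a :: "'k::metric_space \<Rightarrow> complex"
  assumes "finite S" "a \<in> borel_measurable borel"
  shows "(\<integral>x. a x \<partial>count_measure S) = (\<Sum>x\<in>S. a x)"
  unfolding count_measure_def using assms
  by (subst integral_distr) (auto simp: lebesgue_integral_count_space_finite)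

lemma finite_count_measure: "finite S \<Longrightarrow> finite_measure (count_measure S)"
  unfolding count_measure_def
  by (intro finite_measure.finite_measure_distr finite_measure_count_space) auto

lemma dirac_eq: "dirac b = count_measure {b}"
proof (rule measure_eqI)
  fix A assume A: "A \<in> sets (dirac b)"
  then have A': "A \<in> sets borel" by (simp add: dirac_def)
  have "emeasure (count_measure {b}) A = emeasure (count_space {b}) (A \<inter> {b})"
    unfolding count_measure_def using A' by (subst emeasure_distr) auto
  also have "\<dots> = indicator A b" by (auto simp: indicator_def)
  finally show "emeasure (dirac b) A = emeasure (count_measure {b}) A" using A' by (simp add: dirac_def)
qed (simp add: dirac_def)

lemma integral_scale_measure:
  fixes f :: "'k \<Rightarrow> complex"
  assumes c: "0 \<le> c" and f: "f \<in> borel_measurable M"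
  shows "(\<integral>x. f x \<partial>scale_measure (ennreal c) M) = of_real c * (\<integral>x. f x \<partial>M)"
proof -
  have "scale_measure (ennreal c) M = density M (\<lambda>_. ennreal c)"
    by (rule measure_eqI) (auto simp: emeasure_density_const)
  then show ?thesis
    using integral_density[of f M "\<lambda>_. c"] c f by (simp add: scaleR_conv_of_real)
qed

lemma finite_measure_eqI_bounded:
  fixes \<nu> \<nu>' :: "'k::metric_space measure"
  assumes s: "sets \<nu> = sets borel" "sets \<nu>' = sets borel" and fin: "finite_measure \<nu>" "finite_measure \<nu>'"
    and eq: "\<And>a :: 'k \<Rightarrow> complex. a \<in> borel_measurable borel \<Longrightarrow> bounded (range a) \<Longrightarrow> (\<integral>x. a x \<partial>\<nu>) = (\<integral>x. a x \<partial>\<nu>')"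
  shows "\<nu> = \<nu>'"
proof (rule measure_eqI)
  fix A assume "A \<in> sets \<nu>"
  then have A: "A \<in> sets borel" "A \<in> sets \<nu>'" "A \<in> sets \<nu>" using s by auto
  let ?a = "\<lambda>x. complex_of_real (indicator A x)"
  have m: "?a \<in> borel_measurable borel" using A by measurable
  have b: "bounded (range ?a)" by (rule boundedI[of _ 1]) (auto simp: indicator_def)
  have "complex_of_real (measure \<nu> A) = (\<integral>x. ?a x \<partial>\<nu>)" "complex_of_real (measure \<nu>' A) = (\<integral>x. ?a x \<partial>\<nu>')"
    using A sets_eq_imp_space_eq[OF s(1)] sets_eq_imp_space_eq[OF s(2)] by (simp_all add: integral_complex_of_real)
  then have "measure \<nu> A = measure \<nu>' A" using eq[OF m b] by (metis of_real_eq_iff)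
  then show "emeasure \<nu> A = emeasure \<nu>' A"
    using finite_measure.emeasure_eq_measure[OF fin(1)] finite_measure.emeasure_eq_measure[OF fin(2)] by simp
qed (use s in simp)

context self_similar_system begin

lemma finite_hn_vimage: "finite ((h ^^ n) -` {y})"
  by (simp add: hn_vimage)

text \<open>Outside the finite set \<open>h(B\<^sub>\<gamma>)\<close> the letters lead to \<open>N\<close> different points, and the sum over
  preimages is the sum over letters.\<close>

lemma borel_tilde:
  assumes a: "a \<in> borel_measurable borel" shows "tilde h a \<in> borel_measurable borel"
proof -
  let ?g = "\<lambda>y. \<Sum>j\<in>{1..N}. a (\<gamma> j y)"
  have g: "?g \<in> borel_measurable borel"
  proof (rule borel_measurable_sum)
    fix j assume "j \<in> {1..N}"
    then have "\<gamma> j \<in> borel_measurable borel" by (intro borel_measurable_continuous_onI cont_gamma)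
    then show "(\<lambda>y. a (\<gamma> j y)) \<in> borel_measurable borel" using a by (rule measurable_compose)
  qed
  have "tilde h a y = ?g y" if "y \<notin> h ` branch_set N \<gamma>" for y
  proof -
    have "inj_on (\<lambda>j. \<gamma> j y) {1..N}"
    proof (rule inj_onI, rule ccontr)
      fix i j assume ij: "i \<in> {1..N}" "j \<in> {1..N}" "\<gamma> i y = \<gamma> j y" "i \<noteq> j"
      then have "\<gamma> i y \<in> branch_set N \<gamma>" unfolding branch_set_def by blast
      moreover have "h (\<gamma> i y) = y" by (rule h_gamma[OF ij(1)])
      ultimately show False using that by (metis imageI)
    qed
    then show ?thesis unfolding tilde_def h_vimage by (simp add: sum.reindex)
  qed
  then show ?thesis
    using finite_branch
    by (intro measurable_discrete_difference[OF g, of "h ` branch_set N \<gamma>"]) (auto intro: uncountable_infinite countable_finite)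
qed

lemma transfer_count_measure:
  assumes S: "finite S" shows "transfer_measure h (count_measure S) = count_measure (h -` S)"
  unfolding transfer_measure_def
proof (rule the_equality)
  have U: "h -` S = (\<Union>y\<in>S. h -` {y})" by auto
  have finh: "finite (h -` {y})" for y using finite_hn_vimage[of 1 y] by simp
  have fin: "finite (h -` S)" unfolding U using S finh by blast
  have int: "(\<integral>y. tilde h a y \<partial>count_measure S) = (\<integral>x. a x \<partial>count_measure (h -` S))"
    if a: "a \<in> borel_measurable borel" for a
  proof -
    have "(\<integral>y. tilde h a y \<partial>count_measure S) = (\<Sum>y\<in>S. \<Sum>x\<in>h -` {y}. a x)"
      unfolding integral_count_measure[OF S borel_tilde[OF a]] by (simp add: tilde_def)
    also have "\<dots> = (\<Sum>x\<in>h -` S. a x)"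
      unfolding U using S finh by (intro sum.UNION_disjoint[symmetric]) auto
    finally show ?thesis by (simp add: integral_count_measure[OF fin a])
  qed
  show "sets (count_measure (h -` S)) = sets borel \<and> finite_measure (count_measure (h -` S)) \<and>
    (\<forall>a\<in>borel_measurable borel. bounded (range a) \<longrightarrow>
       (\<integral>x. a x \<partial>count_measure (h -` S)) = (\<integral>y. tilde h a y \<partial>count_measure S))"
    using int finite_count_measure[OF fin] by simp
  fix \<nu> assume "sets \<nu> = sets borel \<and> finite_measure \<nu> \<and>
    (\<forall>a\<in>borel_measurable borel. bounded (range a) \<longrightarrow>
       (\<integral>x. a x \<partial>\<nu>) = (\<integral>y. tilde h a y \<partial>count_measure S))"
  then show "\<nu> = count_measure (h -` S)"
    using int finite_count_measure[OF fin] by (intro finite_measure_eqI_bounded) auto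
qed

lemma transfer_dirac: "(transfer_measure h ^^ k) (dirac b) = count_measure ((h ^^ k) -` {b})"
proof (induction k)
  case (Suc k)
  have "h -` ((h ^^ k) -` {b}) = (h ^^ Suc k) -` {b}" by (auto simp: funpow_swap1)
  then show ?case by (simp add: Suc transfer_count_measure[OF finite_hn_vimage] o_def)
qed (simp add: dirac_eq)

lemma sum_fibre_branch:
  assumes "b \<in> branch_set N \<gamma>"
  shows "(\<Sum>x\<in>(h ^^ k) -` {b}. f x) = (\<Sum>w\<in>W k. f (pt w b))"
  unfolding hn_vimage by (simp add: sum.reindex[OF inj_pt_branch[OF assms]])

lemma CK_borel: "f \<in> CK \<Longrightarrow> f \<in> borel_measurable borel"
  by (simp add: CK_def borel_measurable_continuous_onI)

lemma integral_mu_br: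
  assumes b: "b \<in> branch_set N \<gamma>" and f: "f \<in> CK"
  shows "(\<integral>x. f x \<partial>mu_br N h b r i) = (\<Sum>w\<in>W (r - i). f (pt w b)) / of_nat N ^ (r - i)"
proof -
  have m: "f \<in> borel_measurable (count_measure S)" for S
    using CK_borel[OF f] by (simp cong: measurable_cong_sets)
  show ?thesis
    unfolding mu_br_def transfer_dirac
    by (simp add: integral_scale_measure[OF _ m] integral_count_measure[OF finite_hn_vimage CK_borel[OF f]]
        sum_fibre_branch[OF b])
qed

section \<open>Traces on the compact operators\<close>

lemma opmul_assoc: "c \<in> Adj n \<Longrightarrow> opmul (opmul a b) c = opmul a (opmul b c)"
  by (rule ext) (simp add: opmul_def Adj_CK)

lemma Adj_id: "(\<lambda>f\<in>CK. f) \<in> Adj n"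
  unfolding Adj_def isadj_def by (auto intro!: exI[of _ "\<lambda>f\<in>CK. f"])

lemma opmul_id: "t \<in> Adj n \<Longrightarrow> opmul t (\<lambda>f\<in>CK. f) = t" "t \<in> Adj n \<Longrightarrow> opmul (\<lambda>f\<in>CK. f) t = t"
  by (rule PiE_ext[of _ CK "\<lambda>_. CK"]; auto simp: opmul_def Adj_CK PiE_iff dest: Adj_ext)+

text \<open>The operators \<open>s\<close> such that \<open>\<delta>\<close> kills \<open>R s S\<close> for all adjointable \<open>R\<close> and \<open>S\<close> are closed
  under products, which is not clear for the kernel of \<open>\<delta>\<close> itself. Requiring the same of \<open>opstar s\<close>
  makes them a closed subalgebra.\<close>

lemma Kc_functional_zero:
  assumes add: "\<And>s t. s \<in> Kc n \<Longrightarrow> t \<in> Kc n \<Longrightarrow> \<delta> (opadd s t) = \<delta> s + \<delta> t"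
    and scale: "\<And>c s. s \<in> Kc n \<Longrightarrow> \<delta> (opscale c s) = c * \<delta> s"
    and bound: "\<And>s. s \<in> Kc n \<Longrightarrow> cmod (\<delta> s) \<le> M * op_norm s" and M: "M \<ge> 0"
    and zero: "\<And>f g. f \<in> CK \<Longrightarrow> g \<in> CK \<Longrightarrow> \<delta> (rank_one n f g) = 0"
    and s: "s \<in> Kc n"
  shows "\<delta> s = 0"
proof -
  define D where "D s \<longleftrightarrow> (\<forall>R\<in>Adj n. \<forall>S\<in>Adj n. \<delta> (opmul R (opmul s S)) = 0)" for s
  let ?B = "{s \<in> Kc n. D s \<and> D (opstar s)}"
  have K: "opmul R (opmul s S) \<in> Kc n" if "s \<in> Kc n" "R \<in> Adj n" "S \<in> Adj n" for R s S
    using that by (intro Kc_ideal)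
  have L: "s \<in> Adj n" if "s \<in> Kc n" for s using that Kc_Adj by blast
  have Dadd: "D (opadd s t)" if st: "s \<in> Kc n" "t \<in> Kc n" "D s" "D t" for s t
    unfolding D_def
  proof (intro ballI)
    fix R S assume RS: "R \<in> Adj n" "S \<in> Adj n"
    have "opmul R (opmul (opadd s t) S) = opadd (opmul R (opmul s S)) (opmul R (opmul t S))"
      by (rule ext) (simp add: opmul_def opadd_def Adj_CK[OF RS(2)] Adj_CK[OF L[OF st(1)]] Adj_CK[OF L[OF st(2)]] Adj_linear(1)[OF RS(1)])
    then show "\<delta> (opmul R (opmul (opadd s t) S)) = 0"
      using st RS K by (simp add: add D_def)
  qed
  have Dscale: "D (opscale c s)" if st: "s \<in> Kc n" "D s" for c s
    unfolding D_def
  proof (intro ballI)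
    fix R S assume RS: "R \<in> Adj n" "S \<in> Adj n"
    have "opmul R (opmul (opscale c s) S) = opscale c (opmul R (opmul s S))"
      by (rule ext) (simp add: opmul_def opscale_def Adj_CK[OF RS(2)] Adj_CK[OF L[OF st(1)]]
          Adj_linear(3)[OF RS(1), of "s (S x)" "s (S x)" c for x])
    then show "\<delta> (opmul R (opmul (opscale c s) S)) = 0"
      using st RS K by (simp add: scale D_def)
  qed
  have Dmul: "D (opmul s t)" if st: "s \<in> Adj n" "t \<in> Adj n" "D s" for s t
    using st unfolding D_def by (auto simp: opmul_assoc[of _ n] intro: Adj_mul)
  have Dlim: "D t" if t: "t \<in> Kc n" and sj: "\<And>j. s j \<in> Kc n" "\<And>j. D (s j)" and l: "(\<lambda>j. op_dist (s j) t) \<longlonglongrightarrow> 0" for s t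
    unfolding D_def
  proof (intro ballI)
    fix R S assume RS: "R \<in> Adj n" "S \<in> Adj n"
    let ?T = "opmul R (opmul t S)"
    have "cmod (\<delta> ?T) \<le> M * (op_norm R * (op_dist (s j) t * op_norm S))" for j
    proof -
      let ?a = "opmul R (opmul (s j) S)"
      have aK: "?a \<in> Kc n" "?T \<in> Kc n" using K sj(1) t RS by auto
      have "\<delta> (opadd ?a (opscale (-1) ?T)) = - \<delta> ?T"
        using sj(2)[of j] RS aK by (simp add: add scale Kc_scale D_def)
      then have "cmod (\<delta> ?T) \<le> M * op_dist ?a ?T"
        using bound[OF Kc_add[OF aK(1) Kc_scale[OF aK(2), of "-1"]]] by (simp add: op_dist_def)
      also have "op_dist ?a ?T \<le> op_norm R * op_dist (opmul (s j) S) (opmul t S)"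
        using op_dist_mul[OF RS(1,1) Adj_mul[OF L[OF sj(1)] RS(2)] Adj_mul[OF L[OF t] RS(2)]] op_dist_self[OF RS(1)] by simp
      also have "op_dist (opmul (s j) S) (opmul t S) \<le> op_dist (s j) t * op_norm S"
        using op_dist_mul[OF L[OF sj(1)] L[OF t] RS(2,2)] op_dist_self[OF RS(2)] by simp
      finally show ?thesis using M op_norm_nonneg[OF RS(1)] by (simp add: mult_left_mono)
    qed
    moreover have "(\<lambda>j. M * (op_norm R * (op_dist (s j) t * op_norm S))) \<longlonglongrightarrow> 0"
      by (intro tendsto_mult_right_zero tendsto_mult_left_zero l)
    ultimately have "cmod (\<delta> ?T) \<le> 0" by (intro LIMSEQ_le_const) auto
    then show "\<delta> ?T = 0" by simp
  qed
  have "closed_sub n ?B"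
    unfolding closed_sub_def
  proof (intro conjI ballI allI impI)
    fix s t assume s: "s \<in> ?B" and t: "t \<in> ?B"
    then have K: "s \<in> Kc n" "t \<in> Kc n" "opstar s \<in> Kc n" "opstar t \<in> Kc n"
      and D: "D s" "D t" "D (opstar s)" "D (opstar t)" by (auto intro: Kc_star)
    show "opadd s t \<in> ?B" using K D
      by (simp add: Kc_add Dadd opstar_add[OF L L])
    show "opmul s t \<in> ?B" using K D
      by (simp add: Kc_mul Dmul L opstar_mul[OF L L])
  next
    fix c s assume "s \<in> ?B"
    then have K: "s \<in> Kc n" "opstar s \<in> Kc n" and D: "D s" "D (opstar s)" by (auto intro: Kc_star)
    show "opscale c s \<in> ?B" using K D by (simp add: Kc_scale Dscale opstar_scale[OF L])
    show "opstar s \<in> ?B" using K D by (simp add: opstar_opstar[OF L])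
  next
    fix s t assume t: "t \<in> Adj n" and st: "(\<forall>j. s j \<in> ?B) \<and> (\<lambda>j. op_dist (s j) t) \<longlonglongrightarrow> 0"
    have sK: "s j \<in> Kc n" "D (s j)" "D (opstar (s j))" for j using st by auto
    have tK: "t \<in> Kc n" by (rule Kc_limit[where s = s, OF t sK(1)]) (use st in simp)
    have D1: "D t" by (rule Dlim[where s = s, OF tK sK(1,2)]) (use st in simp)
    have "(\<lambda>j. op_dist (opstar (s j)) (opstar t)) \<longlonglongrightarrow> 0"
      using st by (intro tendsto_sandwich[OF _ _ tendsto_const conjunct2[OF st]])
        (auto intro!: always_eventually op_dist_star[OF L[OF sK(1)] t] op_dist_nonneg[OF opstar_Adj[OF L[OF sK(1)]] opstar_Adj[OF t]])
    then have "D (opstar t)" by (rule Dlim[where s = "\<lambda>j. opstar (s j)", OF Kc_star[OF tK] Kc_star[OF sK(1)] sK(3)])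
    then show "t \<in> ?B" using tK D1 by simp
  qed (use Kc_Adj in auto)
  moreover have "rank_one n f g \<in> ?B" if fg: "f \<in> CK" "g \<in> CK" for f g
  proof -
    have "D (rank_one n f g)" if "f \<in> CK" "g \<in> CK" for f g
      unfolding D_def using that by (simp add: opmul_rank_one zero Adj_CK[of _ n] opstar_Adj)
    then show ?thesis using fg by (simp add: Kc_rank_one opstar_rank_one)
  qed
  ultimately have "Kc n \<subseteq> ?B" by (rule Kc_least)
  then have "\<delta> (opmul (\<lambda>f\<in>CK. f) (opmul s (\<lambda>f\<in>CK. f))) = 0" using s Adj_id unfolding D_def by blast
  then show ?thesis by (simp add: opmul_id[OF L[OF s]])
qed

lemma KX_trace_unique:
  assumes t: "finite_trace (KX N \<gamma> n) \<tau>" "finite_trace (KX N \<gamma> n) \<tau>'"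
    and eq: "\<And>x y. x \<in> HT n \<Longrightarrow> y \<in> HT n \<Longrightarrow> \<tau> (theta (TP n) x y) = \<tau>' (theta (TP n) x y)"
  shows "\<tau> = \<tau>'"
proof (rule extensionalityI[of _ "KC n"])
  show "\<tau> \<in> extensional (KC n)" "\<tau>' \<in> extensional (KC n)" using t by (simp_all add: finite_trace_def)
  have bd: "\<exists>M\<ge>0. \<forall>x\<in>KC n. cmod (\<sigma> x) \<le> M * op_norm (\<rho> n x)" if "finite_trace (KX N \<gamma> n) \<sigma>" for \<sigma>
  proof -
    have "\<exists>M. \<forall>x\<in>KC n. cmod (\<sigma> x) \<le> M * anorm (KX N \<gamma> n) x" using that by (simp only: finite_trace_def)
    then obtain M where M: "\<forall>x\<in>KC n. cmod (\<sigma> x) \<le> M * anorm (KX N \<gamma> n) x" ..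
    have "cmod (\<sigma> x) \<le> \<bar>M\<bar> * op_norm (\<rho> n x)" if x: "x \<in> KC n" for x
    proof -
      have "M * op_norm (\<rho> n x) \<le> \<bar>M\<bar> * op_norm (\<rho> n x)"
        using op_norm_nonneg[OF \<rho>_Adj[OF KC_LC[OF x]]] by (intro mult_right_mono) auto
      then show ?thesis using M[rule_format, OF x] by (simp add: KX_ops LC_norm[OF KC_LC[OF x]])
    qed
    then show ?thesis by (intro exI[of _ "\<bar>M\<bar>"]) simp
  qed
  obtain M where M: "M \<ge> 0" "\<forall>x\<in>KC n. cmod (\<tau> x) \<le> M * op_norm (\<rho> n x)" using bd[OF t(1)] by blast
  obtain M' where M': "M' \<ge> 0" "\<forall>x\<in>KC n. cmod (\<tau>' x) \<le> M' * op_norm (\<rho> n x)" using bd[OF t(2)] by blast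
  have L: "s \<in> Adj n" if "s \<in> Kc n" for s using that Kc_Adj by blast
  fix T assume T: "T \<in> KC n"
  have "\<tau> (\<iota> n (\<rho> n T)) - \<tau>' (\<iota> n (\<rho> n T)) = 0"
  proof (rule Kc_functional_zero[where \<delta> = "\<lambda>s. \<tau> (\<iota> n s) - \<tau>' (\<iota> n s)" and s = "\<rho> n T" and M = "M + M'" and n = n])
    show "\<rho> n T \<in> Kc n" using T by (simp add: KC_iff)
    show "M + M' \<ge> 0" using M M' by simp
    show "cmod (\<tau> (\<iota> n s) - \<tau>' (\<iota> n s)) \<le> (M + M') * op_norm s" if "s \<in> Kc n" for s
      using norm_triangle_ineq4[of "\<tau> (\<iota> n s)" "\<tau>' (\<iota> n s)"] M(2)[rule_format, OF \<iota>_KC[OF that]]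
        M'(2)[rule_format, OF \<iota>_KC[OF that]] by (simp add: \<rho>_\<iota>_Adj[OF L[OF that]] distrib_right)
    show "\<tau> (\<iota> n (opadd s u)) - \<tau>' (\<iota> n (opadd s u)) = \<tau> (\<iota> n s) - \<tau>' (\<iota> n s) + (\<tau> (\<iota> n u) - \<tau>' (\<iota> n u))"
      if "s \<in> Kc n" "u \<in> Kc n" for s u
      using t that \<iota>_KC by (simp add: finite_trace_def \<iota>_add[OF L L] KX_ops)
    show "\<tau> (\<iota> n (opscale c s)) - \<tau>' (\<iota> n (opscale c s)) = c * (\<tau> (\<iota> n s) - \<tau>' (\<iota> n s))"
      if "s \<in> Kc n" for c s
      using t that \<iota>_KC by (simp add: finite_trace_def \<iota>_scale[OF L] KX_ops right_diff_distrib)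
    show "\<tau> (\<iota> n (rank_one n f g)) - \<tau>' (\<iota> n (rank_one n f g)) = 0" if "f \<in> CK" "g \<in> CK" for f g
    proof -
      have "\<iota> n (rank_one n f g) = theta (TP n) (U n f) (U n g)"
        by (rule \<rho>_inj[of _ n]) (use that in \<open>auto simp: theta_\<rho> U_in \<Phi>_U \<rho>_\<iota>_Adj rank_one_Adj intro!: \<iota>_LC\<close>)
      then show ?thesis using eq[OF U_in[OF that(1)] U_in[OF that(2)]] by simp
    qed
  qed
  then show "\<tau> T = \<tau>' T" by (simp add: \<iota>_\<rho>_LC[OF KC_LC[OF T]])
qed

section \<open>Traces on the core\<close>

interpretation PC: pre_cstar PC by (rule pre_cstar_core)

lemma core_eq: "core N \<gamma> = complete_alg PC" by (simp add: core_def)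

lemma into_core_eq: "into_core N \<gamma> n T = PC.const_cl (n, T)" by (simp add: into_core_def)

lemma PC_pair: "(n, T) \<in> acarrier PC \<longleftrightarrow> T \<in> LC n \<and> \<rho> n T \<in> Fc n"
  by (simp add: PC_iff core_op_def)

lemma KC_PC: "T \<in> KC n \<Longrightarrow> (n, T) \<in> acarrier PC"
  using Kc_Fc by (auto simp: PC_pair KC_iff)

lemma const_cl_core_op:
  assumes "x \<in> acarrier PC" "y \<in> acarrier PC" "core_op x = core_op y" shows "PC.const_cl x = PC.const_cl y"
proof -
  interpret pseudometric_carrier "acarrier PC" "adist PC" by (rule PC.pm)
  show ?thesis
  proof (intro cls_eq const_cauchy assms)
    have "adist PC x y = 0"
      unfolding PC_dist[OF assms(1,2)] assms(3) by (rule op_dist_self[OF PC_Adj[OF assms(2) order_refl]])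
    then show "(\<lambda>n. adist PC x y) \<longlonglongrightarrow> 0" by simp
  qed
qed

lemma restrict_trace:
  assumes t: "finite_trace (core N \<gamma>) \<tau>" shows "finite_trace (KX N \<gamma> n) (restrict_to_K N \<gamma> n \<tau>)"
proof -
  note t' = t[unfolded core_eq]
  have K: "aplus (LX N \<gamma> n) S T \<in> KC n" "atimes (LX N \<gamma> n) S T \<in> KC n" if "S \<in> KC n" "T \<in> KC n" for S T
    using that by (simp_all add: KC_iff LC_plus LC_times Kc_add Kc_mul)
  have Ku: "ascale (LX N \<gamma> n) c S \<in> KC n" "astar (LX N \<gamma> n) S \<in> KC n" if "S \<in> KC n" for S c
    using that by (simp_all add: KC_iff LC_scale LC_star Kc_scale Kc_star)
  have P: "aplus PC (n, S) (n, T) = (n, aplus (LX N \<gamma> n) S T)" "atimes PC (n, S) (n, T) = (n, atimes (LX N \<gamma> n) S T)"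
      "ascale PC c (n, S) = (n, ascale (LX N \<gamma> n) c S)" "astar PC (n, S) = (n, astar (LX N \<gamma> n) S)"
      "anorm PC (n, S) = anorm (LX N \<gamma> n) S" for S T c
    by (simp_all add: pre_core_def to_level_def)
  have V: "restrict_to_K N \<gamma> n \<tau> T = \<tau> (PC.const_cl (n, T))" if "T \<in> KC n" for T
    using that by (simp add: restrict_to_K_def into_core_eq)
  have C: "PC.const_cl (n, T) \<in> acarrier (complete_alg PC)" if "T \<in> KC n" for T
    by (rule PC.const_cl_in[OF KC_PC[OF that]])
  show ?thesis unfolding finite_trace_def KX_ops
  proof (intro conjI ballI allI)
    show "restrict_to_K N \<gamma> n \<tau> \<in> extensional (KC n)" by (simp add: restrict_to_K_def)
    have "\<exists>M. \<forall>x\<in>acarrier (complete_alg PC). cmod (\<tau> x) \<le> M * anorm (complete_alg PC) x"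
      using t' by (simp only: finite_trace_def)
    then obtain M where M: "\<forall>x\<in>acarrier (complete_alg PC). cmod (\<tau> x) \<le> M * anorm (complete_alg PC) x" ..
    then show "\<exists>M. \<forall>x\<in>KC n. cmod (restrict_to_K N \<gamma> n \<tau> x) \<le> M * anorm (LX N \<gamma> n) x"
    proof (intro exI[of _ M] ballI)
      fix x assume x: "x \<in> KC n"
      show "cmod (restrict_to_K N \<gamma> n \<tau> x) \<le> M * anorm (LX N \<gamma> n) x"
        using M[rule_format, OF C[OF x]] by (simp add: V[OF x] PC.norm_const_cl[OF KC_PC[OF x]] P)
    qed
    fix S assume S: "S \<in> KC n"
    have sc: "\<tau> (ascale (complete_alg PC) c (PC.const_cl (n, S))) = c * \<tau> (PC.const_cl (n, S))" for c
      using t' C[OF S] unfolding finite_trace_def by blast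
    show "restrict_to_K N \<gamma> n \<tau> (ascale (LX N \<gamma> n) c S) = c * restrict_to_K N \<gamma> n \<tau> S" for c
      using sc[of c] by (simp add: V S Ku PC.const_cl_scale[OF KC_PC[OF S]] P)
    have "\<tau> (atimes (complete_alg PC) (astar (complete_alg PC) (PC.const_cl (n, S))) (PC.const_cl (n, S))) \<in> \<real>\<^sub>\<ge>\<^sub>0"
      using t' C[OF S] unfolding finite_trace_def by blast
    then show "restrict_to_K N \<gamma> n \<tau> (atimes (LX N \<gamma> n) (astar (LX N \<gamma> n) S) S) \<in> \<real>\<^sub>\<ge>\<^sub>0"
      by (simp add: V S K Ku PC.const_cl_star[OF KC_PC[OF S]] PC.const_cl_times KC_PC P)
    fix T assume T: "T \<in> KC n"
    have "\<tau> (aplus (complete_alg PC) (PC.const_cl (n, S)) (PC.const_cl (n, T))) = \<tau> (PC.const_cl (n, S)) + \<tau> (PC.const_cl (n, T))"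
      using t' C[OF S] C[OF T] unfolding finite_trace_def by blast
    then show "restrict_to_K N \<gamma> n \<tau> (aplus (LX N \<gamma> n) S T) = restrict_to_K N \<gamma> n \<tau> S + restrict_to_K N \<gamma> n \<tau> T"
      by (simp add: V S T K PC.const_cl_plus KC_PC P)
    have "\<tau> (atimes (complete_alg PC) (PC.const_cl (n, S)) (PC.const_cl (n, T))) = \<tau> (atimes (complete_alg PC) (PC.const_cl (n, T)) (PC.const_cl (n, S)))"
      using t' C[OF S] C[OF T] unfolding finite_trace_def by blast
    then show "restrict_to_K N \<gamma> n \<tau> (atimes (LX N \<gamma> n) S T) = restrict_to_K N \<gamma> n \<tau> (atimes (LX N \<gamma> n) T S)"
      by (simp add: V S T K PC.const_cl_times KC_PC P)
  qed
qed

text \<open>An element of the pre-core has the class of a sum of compacts of different levels, one for each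
  step in the construction of \<open>Fc\<close>.\<close>

lemma core_trace_unique:
  assumes t: "finite_trace (core N \<gamma>) \<tau>" "finite_trace (core N \<gamma>) \<tau>'"
    and eq: "\<And>i T. T \<in> KC i \<Longrightarrow> \<tau> (into_core N \<gamma> i T) = \<tau>' (into_core N \<gamma> i T)"
  shows "\<tau> = \<tau>'"
proof (rule PC.traces_eq[OF t[unfolded core_eq]])
  have add: "\<sigma> (PC.const_cl (aplus PC x y)) = \<sigma> (PC.const_cl x) + \<sigma> (PC.const_cl y)"
    if "finite_trace (core N \<gamma>) \<sigma>" "x \<in> acarrier PC" "y \<in> acarrier PC" for \<sigma> x y
  proof -
    have "\<sigma> (aplus (complete_alg PC) (PC.const_cl x) (PC.const_cl y)) = \<sigma> (PC.const_cl x) + \<sigma> (PC.const_cl y)"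
      using that(1) PC.const_cl_in[OF that(2)] PC.const_cl_in[OF that(3)] unfolding core_eq finite_trace_def by blast
    then show ?thesis by (simp add: PC.const_cl_plus that)
  qed
  have L: "s \<in> Adj n" if "s \<in> Kc n" for s n using that Kc_Adj by blast
  have *: "\<tau> (PC.const_cl x) = \<tau>' (PC.const_cl x)" if "x \<in> acarrier PC" "core_op x \<in> Fc n" for x n
    using that
  proof (induction n arbitrary: x)
    case 0
    have "PC.const_cl x = PC.const_cl (0, \<iota> 0 (core_op x))"
      using 0 by (intro const_cl_core_op) (auto simp: core_op_def[of "(0, _)"] \<rho>_\<iota>_Adj L intro!: KC_PC \<iota>_KC)
    then show ?case using eq[OF \<iota>_KC, of "core_op x" 0] 0 by (simp add: into_core_eq)
  next
    case (Suc n)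
    then obtain a s where as: "core_op x = opadd a s" "a \<in> Fc n" "s \<in> Kc (Suc n)" by auto
    have aL: "a \<in> Adj n" using as(2) Fc_Adj by blast
    let ?y = "(n, \<iota> n a)" and ?z = "(Suc n, \<iota> (Suc n) s)"
    have y: "?y \<in> acarrier PC" "core_op ?y = a" using as(2) aL by (simp_all add: PC_pair \<iota>_LC \<rho>_\<iota>_Adj core_op_def)
    have z: "?z \<in> acarrier PC" "core_op ?z = s" using KC_PC[OF \<iota>_KC[OF as(3)]] L[OF as(3)] by (simp_all add: \<rho>_\<iota>_Adj core_op_def)
    have E: "PC.const_cl x = PC.const_cl (aplus PC ?y ?z)"
      using Suc.prems y z as by (intro const_cl_core_op) (simp_all add: PC_plus)
    have "\<tau> (PC.const_cl ?y) = \<tau>' (PC.const_cl ?y)" using Suc.IH[OF y(1)] y(2) as(2) by simp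
    moreover have "\<tau> (PC.const_cl ?z) = \<tau>' (PC.const_cl ?z)" using eq[OF \<iota>_KC[OF as(3)]] by (simp add: into_core_eq)
    ultimately show ?case unfolding E using add[OF t(1) y(1) z(1)] add[OF t(2) y(1) z(1)] by simp
  qed
  fix x assume "x \<in> acarrier PC"
  then show "\<tau> (PC.const_cl x) = \<tau>' (PC.const_cl x)" using * PC_iff by blast
qed

text \<open>On \<open>X\<^sup>\<otimes>\<^sup>0 = A\<close> multiplication by \<open>f\<close> is the rank one operator \<open>\<theta>\<^sub>f\<^sub>,\<^sub>1\<close>.\<close>

lemma left_action0:
  assumes f: "f \<in> CK"
  shows "left_action N \<gamma> 0 f \<in> KC 0" and "\<rho> 0 (left_action N \<gamma> 0 f) = rank_one 0 f (\<lambda>_. 1)"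
proof -
  have P: "left_action N \<gamma> 0 f \<in> HT 0 \<rightarrow>\<^sub>E HT 0"
    using \<Phi>_left_action0(1)[OF _ f] by (auto simp: PiE_iff) (simp add: left_action_def)
  show r: "\<rho> 0 (left_action N \<gamma> 0 f) = rank_one 0 f (\<lambda>_. 1)"
    unfolding \<rho>_def rank_one_def by (rule ext) (simp add: \<Phi>_left_action0(2)[OF U_in f] \<Phi>_U ip_def)
  show "left_action N \<gamma> 0 f \<in> KC 0"
    unfolding KC_iff LC_iff r using P rank_one_Adj[OF f CK_const] Kc_rank_one[OF f CK_const] by blast
qed

end

section \<open>The traces of a branch point on the core\<close>

context branch_pair begin

interpretation PC: pre_cstar PC by (rule pre_cstar_core)

lemma b_branch: "b \<in> branch_set N \<gamma>"
  unfolding branch_set_def using p q pq gp gq by (metis (mono_tags, lifting) mem_Collect_eq)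

lemma ex_trace:
  obtains \<tau> where "finite_trace (core N \<gamma>) \<tau>"
    "\<And>i T. T \<in> KC i \<Longrightarrow> \<tau> (into_core N \<gamma> i T) = branch_trace (\<rho> i T)"
proof -
  obtain \<tau> where \<tau>: "finite_trace (complete_alg PC) \<tau>" "\<And>x. x \<in> acarrier PC \<Longrightarrow> \<tau> (PC.const_cl x) = branch_trace (core_op x)"
  proof (rule PC.trace_extends[of "\<lambda>x. branch_trace (core_op x)" 2])
    have F: "core_op x \<in> Fc (fst x)" if "x \<in> acarrier PC" for x using that by (simp add: PC_iff)
    fix x assume x: "x \<in> acarrier PC"
    show "branch_trace (core_op (ascale PC c x)) = c * branch_trace (core_op x)" for c by (simp add: PC_scale x branch_trace_scale[OF F[OF x]])
    show "cmod (branch_trace (core_op x)) \<le> 2 * anorm PC x" by (simp add: PC_norm x branch_trace_bound[OF F[OF x]])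
    show "branch_trace (core_op (atimes PC (astar PC x) x)) \<in> \<real>\<^sub>\<ge>\<^sub>0" by (simp add: PC_times PC_star x branch_trace_pos[OF F[OF x]])
    fix y assume y: "y \<in> acarrier PC"
    show "branch_trace (core_op (aplus PC x y)) = branch_trace (core_op x) + branch_trace (core_op y)" by (simp add: PC_plus x y branch_trace_add[OF F[OF x] F[OF y]])
    show "branch_trace (core_op (atimes PC x y)) = branch_trace (core_op (atimes PC y x))" by (simp add: PC_times x y branch_trace_mul[OF F[OF x] F[OF y]])
  qed auto
  show thesis
    by (rule that[of \<tau>]) (use \<tau> in \<open>simp_all add: core_eq into_core_eq KC_PC core_op_def\<close>)
qed

text \<open>The property that characterizes \<open>\<pi>\<^sub>i(\<mu>\<^sub>i\<^sup>(\<^sup>b\<^sup>,\<^sup>r\<^sup>))\<close>.\<close>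

definition trace_spec :: "nat \<Rightarrow> ('k oper \<Rightarrow> complex) \<Rightarrow> bool" where
  "trace_spec i \<sigma> \<longleftrightarrow> finite_trace (KX N \<gamma> i) \<sigma> \<and>
     (\<forall>\<xi>\<in>HT i. \<forall>\<eta>\<in>HT i. \<sigma> (theta (TP i) \<xi> \<eta>) =
          (1 / of_nat N ^ i) * (\<integral>y. hip (TP i) \<eta> \<xi> y \<partial>mu_br N h b r i))"

lemma trace_spec_unique: "trace_spec i \<sigma> \<Longrightarrow> trace_spec i \<sigma>' \<Longrightarrow> \<sigma> = \<sigma>'"
  by (rule KX_trace_unique[of i]) (auto simp: trace_spec_def)

lemma pi_trace_eq: "trace_spec i \<sigma> \<Longrightarrow> pi_trace N \<gamma> i (mu_br N h b r i) = \<sigma>"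
  unfolding pi_trace_def trace_spec_def[symmetric] by (rule the_equality) (auto intro: trace_spec_unique)

lemma branch_trace_theta:
  assumes i: "i \<le> r" and x: "\<xi> \<in> HT i" "\<eta> \<in> HT i"
  shows "branch_trace (\<rho> i (theta (TP i) \<xi> \<eta>)) = (1 / of_nat N ^ i) * (\<integral>y. hip (TP i) \<eta> \<xi> y \<partial>mu_br N h b r i)"
proof -
  have "(of_nat N :: complex) ^ r = of_nat N ^ i * of_nat N ^ (r - i)"
    using i by (simp add: power_add[symmetric])
  then show ?thesis
    using x by (simp add: theta_\<rho> branch_trace_rank_one[OF i] \<Phi>_CK \<Phi>_ip integral_mu_br[OF b_branch] ip_CK)
qed

lemma branch_trace_A:
  assumes f: "f \<in> CK"
  shows "branch_trace (\<rho> 0 (left_action N \<gamma> 0 f)) = (\<integral>x. f x \<partial>mu_br N h b r 0)"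
  by (simp add: left_action0[OF f] branch_trace_rank_one[OF _ f CK_const] integral_mu_br[OF b_branch f]) (simp add: ip_def)

text \<open>The trace \<open>\<pi>\<^sub>i(\<mu>\<^sub>i\<^sup>(\<^sup>b\<^sup>,\<^sup>r\<^sup>))\<close> exists because the trace on the core restricts to it.\<close>

lemma pi_trace_spec: assumes i: "i \<le> r" shows "trace_spec i (pi_trace N \<gamma> i (mu_br N h b r i))"
proof -
  obtain \<tau> where \<tau>: "finite_trace (core N \<gamma>) \<tau>" "\<And>i T. T \<in> KC i \<Longrightarrow> \<tau> (into_core N \<gamma> i T) = branch_trace (\<rho> i T)"
    using ex_trace by blast
  have "trace_spec i (restrict_to_K N \<gamma> i \<tau>)"
    unfolding trace_spec_def using restrict_trace[OF \<tau>(1)] branch_trace_theta[OF i]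
    by (simp add: restrict_to_K_def theta_KC \<tau>(2))
  then show ?thesis using pi_trace_eq by simp
qed

lemma values_iff:
  assumes t: "finite_trace (core N \<gamma>) \<tau>"
  shows "has_restrictions N \<gamma> h b r \<tau> \<longleftrightarrow> has_values N \<gamma> h b r \<tau>"
proof -
  have A: "(\<integral>x. f x \<partial>mu_br N h b r 0) = (1 / of_nat N ^ r) * (\<Sum>x\<in>(h ^^ r) -` {b}. f x)" if "f \<in> CK" for f
    using integral_mu_br[OF b_branch that, of r 0] by (simp add: sum_fibre_branch[OF b_branch])
  have V: "restrict_to_K N \<gamma> i \<tau> T = \<tau> (into_core N \<gamma> i T)" if "T \<in> KC i" for i T
    using that by (simp add: restrict_to_K_def)
  have R: "restrict_to_K N \<gamma> i \<tau> = pi_trace N \<gamma> i (mu_br N h b r i) \<longleftrightarrow> trace_spec i (restrict_to_K N \<gamma> i \<tau>)"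
    if "i \<le> r" for i using pi_trace_eq pi_trace_spec[OF that] by metis
  have S: "trace_spec i (restrict_to_K N \<gamma> i \<tau>) \<longleftrightarrow> (\<forall>x\<in>HT i. \<forall>y\<in>HT i.
        \<tau> (into_core N \<gamma> i (theta (TP i) x y)) =
          (1 / of_nat N ^ i) * (\<integral>z. hip (TP i) y x z \<partial>mu_br N h b r i))" for i
    unfolding trace_spec_def using restrict_trace[OF t] by (simp add: V theta_KC)
  have M: "scale_measure (ennreal (1 / real N ^ r)) ((transfer_measure h ^^ r) (dirac b)) = mu_br N h b r 0"
    by (simp add: mu_br_def)
  show ?thesis
    unfolding has_restrictions_def has_values_def M using A R S by (auto simp: V)
qed

lemma ex1_trace: "\<exists>!\<tau>. finite_trace (core N \<gamma>) \<tau> \<and> has_restrictions N \<gamma> h b r \<tau>"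
proof (rule ex_ex1I)
  obtain \<tau> where \<tau>: "finite_trace (core N \<gamma>) \<tau>" "\<And>i T. T \<in> KC i \<Longrightarrow> \<tau> (into_core N \<gamma> i T) = branch_trace (\<rho> i T)"
    using ex_trace by blast
  have "has_restrictions N \<gamma> h b r \<tau>"
    unfolding has_restrictions_def
  proof (intro conjI ballI allI impI)
    show "\<tau> (A_into_core N \<gamma> f) = (\<integral>x. f x \<partial>mu_br N h b r 0)" if "f \<in> CK" for f
      using that by (simp add: A_into_core_def \<tau>(2) left_action0(1) branch_trace_A)
    show "restrict_to_K N \<gamma> i \<tau> = pi_trace N \<gamma> i (mu_br N h b r i)" if "i \<le> r" for i
      by (rule pi_trace_eq[symmetric])
        (use restrict_trace[OF \<tau>(1)] branch_trace_theta[OF that] in \<open>simp add: trace_spec_def restrict_to_K_def theta_KC \<tau>(2)\<close>)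
    show "restrict_to_K N \<gamma> i \<tau> T = 0" if "r < i" "T \<in> KC i" for i T
      using that by (simp add: restrict_to_K_def \<tau>(2) branch_trace_high[of _ i] KC_iff)
  qed
  then show "\<exists>\<tau>. finite_trace (core N \<gamma>) \<tau> \<and> has_restrictions N \<gamma> h b r \<tau>" using \<tau>(1) by blast
  fix \<tau> \<tau>' assume t: "finite_trace (core N \<gamma>) \<tau> \<and> has_restrictions N \<gamma> h b r \<tau>"
    "finite_trace (core N \<gamma>) \<tau>' \<and> has_restrictions N \<gamma> h b r \<tau>'"
  show "\<tau> = \<tau>'"
  proof (rule core_trace_unique)
    fix i T assume T: "T \<in> KC i"
    have "restrict_to_K N \<gamma> i \<tau> T = restrict_to_K N \<gamma> i \<tau>' T"
      using t T unfolding has_restrictions_def by (cases "i \<le> r") auto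
    then show "\<tau> (into_core N \<gamma> i T) = \<tau>' (into_core N \<gamma> i T)" using T by (simp add: restrict_to_K_def)
  qed (use t in auto)
qed

end

theorem proposition6p1:
  fixes N :: nat
    and \<gamma> :: "nat \<Rightarrow> 'k::metric_space \<Rightarrow> 'k"
    and h :: "'k \<Rightarrow> 'k"
    and b :: 'k
    and r :: nat
  assumes "compact (UNIV :: 'k set)"
    and "N \<ge> 2"
    and "self_similar N \<gamma>"
    and "assumption_A N \<gamma> h"
    and "b \<in> branch_set N \<gamma>"
  shows "(\<exists>!\<tau>. finite_trace (core N \<gamma>) \<tau> \<and> has_restrictions N \<gamma> h b r \<tau>) \<and>
    (\<forall>\<tau>. finite_trace (core N \<gamma>) \<tau> \<longrightarrow>
       (has_restrictions N \<gamma> h b r \<tau> \<longleftrightarrow> has_values N \<gamma> h b r \<tau>))"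
proof -
  obtain a p q where pq: "p \<in> {1..N}" "q \<in> {1..N}" "p \<noteq> q" "b = \<gamma> p a" "b = \<gamma> q a"
    using assms(5) unfolding branch_set_def by blast
  interpret self_similar_system N \<gamma> h
    by unfold_locales (use assms in auto)
  have "a = h b" using h_gamma[OF pq(1)] pq(4) by simp
  then interpret branch_pair N \<gamma> h b p q r
    by unfold_locales (use pq in auto)
  show ?thesis using ex1_trace values_iff by blast
qed

end
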